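(* Let $\mathcal{G}=(X,Y,A,B,\lambda)$ be an imitation game, and let $p\in\mathcal{C}_{ns}(\mathcal{G})$ be a perfect non-signalling correlation. If there exist a von Neumann algebra $\mathcal{U}$, a $*$-homomorphism $\rho:\mathbb{C}\langle X,A\rangle\otimes_{\mathrm{alg}}\mathbb{C}\langle Y,B\rangle\to\mathcal{U}$ and an amenable tracial state $\tau$ on $\mathcal{U}$ such that $$\tau\circ\rho(e_a^x\otimes f_b^y)=p(a,b\mid x,y)\quad\text{for all } x\in X,\ y\in Y,\ a\in A,\ b\in B,$$ then $p\in\mathcal{C}_{qa}(\mathcal{G})$.
   Context: A non-local game $\mathcal{G}=(X,Y,A,B,\lambda)$ consists of finite sets $X,Y$ (questions for Alice and Bob), finite sets $A,B$ (answers for Alice and Bob), and a scoring function $\lambda:X\times Y\times A\times B\to\{0,1\}$. The game is an imitation game if: (a) for any $x\in X$ and $a,a'\in A$ with $a\neq a'$, there exists $y\in Y$ such that $\sum_{b\in B}\lambda(x,y,a,b)\lambda(x,y,a',b)=0$; and (b) for any $y\in Y$ and $b,b'\in B$ with $b\neq b'$, there exists $x\in X$ such that $\sum_{a\in A}\lambda(x,y,a,b)\lambda(x,y,a,b')=0$. A non-signalling correlation is a function $p:X\times Y\times A\times B\to[0,1]$, written $p(a,b\mid x,y)$, such that $\sum_{b}p(a,b\mid x,y)=\sum_b p(a,b\mid x,y')$ for all $x\in X$, $y,y'\in Y$, $a\in A$; $\sum_a p(a,b\mid x,y)=\sum_a p(a,b\mid x',y)$ for all $x,x'\in X$, $y\in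 Y$, $b\in B$; and $\sum_{(a,b)\in A\times B}p(a,b\mid x,y)=1$ for all $x\in X$, $y\in Y$. The set of these is $\mathcal{C}_{ns}(X,Y,A,B)$. A correlation $p$ is perfect for $\mathcal{G}$ if $\lambda(x,y,a,b)=0$ implies $p(a,b\mid x,y)=0$; $\mathcal{C}_{ns}(\mathcal{G})$ is the set of perfect non-signalling correlations. $p\in\mathcal{C}_{ns}(X,Y,A,B)$ is a quantum correlation if there are finite-dimensional Hilbert spaces $\mathcal{H}_A,\mathcal{H}_B$, a unit vector $\psi\in\mathcal{H}_A\otimes\mathcal{H}_B$, and, for every $x\in X$ and $y\in Y$, projection-valued measures $\{P_a^x:a\in A\}\subset\mathcal{B}(\mathcal{H}_A)$ and $\{Q_b^y:b\in B\}\subset\mathcal{B}(\mathcal{H}_B)$ (families of orthogonal projections summing to the identity) with $p(a,b\mid x,y)=\langle\psi|P_a^x\otimes Q_b^y|\psi\rangle$. The set of these is $\mathcal{C}_q(X,Y,A,B)$; its closure is $\mathcal{C}_{qa}(X,Y,A,B)$, and $\mathcal{C}_{qa}(\mathcal{G})=\mathcal{C}_{ns}(\mathcal{G})\cap\mathcal{C}_{qa}(X,Y,A,B)$. $\mathcal{A}(X,A)$ is the universal (unital) C$^*$-algebra generated by projections $e_a^x$ ($x\in X$, $a\in A$) satisfying $\sum_{a\in A}e_a^x=1$ for all $x\in X$; $\mathcal{A}(Y,B)$ is the universal C$^*$-algebra generated by projections $f_b^y$ ($y\in Y$, $b\in B$) satisfying $\sum_{b\in B}f_b^y=1$ for all $y\in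 Y$. $\mathbb{C}\langle X,A\rangle\subset\mathcal{A}(X,A)$ is the $\mathbb{C}$-subalgebra generated by all the $e_a^x$ (it is a $*$-subalgebra), and $\mathbb{C}\langle Y,B\rangle\subset\mathcal{A}(Y,B)$ is the $\mathbb{C}$-subalgebra generated by all the $f_b^y$. $\otimes_{\mathrm{alg}}$ is the algebraic tensor product of $*$-algebras. A state is a positive linear functional with value $1$ at the unit; a state $\tau$ is tracial if $\tau(ab)=\tau(ba)$ for all $a,b$. A tracial state $\tau$ on a C$^*$-algebra $\mathcal{M}\subseteq\mathcal{B}(\mathcal{H})$ is amenable if there is a state $\omega$ on $\mathcal{B}(\mathcal{H})$ with $\omega|_{\mathcal{M}}=\tau$ and $\omega(uTu^* )=\omega(T)$ for all $T\in\mathcal{B}(\mathcal{H})$ and all unitaries $u\in\mathcal{M}$. *)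

theory Defs
  imports "HOL-Analysis.Analysis" "HOL-Library.Poly_Mapping"
begin

section \<open>Complex *-algebras, C*-algebras and Hilbert spaces\<close>

class complex_vector = ab_group_add +
  fixes scaleC :: "complex \<Rightarrow> 'a \<Rightarrow> 'a" (infixr \<open>*\<^sub>C\<close> 75)
  assumes scaleC_add_right: "c *\<^sub>C (x + y) = c *\<^sub>C x + c *\<^sub>C y"
    and scaleC_add_left: "(c + d) *\<^sub>C x = c *\<^sub>C x + d *\<^sub>C x"
    and scaleC_scaleC [simp]: "c *\<^sub>C d *\<^sub>C x = (c * d) *\<^sub>C x"
    and scaleC_one [simp]: "1 *\<^sub>C x = x"
begin

lemma scaleC_zero_right [simp]: "c *\<^sub>C 0 = 0"
  using scaleC_add_right[of c 0 0] by simp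

lemma scaleC_zero_left [simp]: "0 *\<^sub>C x = 0"
  using scaleC_add_left[of 0 0 x] by simp

lemma scaleC_minus_left [simp]: "(- c) *\<^sub>C x = - (c *\<^sub>C x)"
  using scaleC_add_left[of c "- c" x] by (simp add: eq_neg_iff_add_eq_0 add.commute)

lemma scaleC_minus_right [simp]: "c *\<^sub>C (- x) = - (c *\<^sub>C x)"
  using scaleC_add_right[of c x "- x"] by (simp add: eq_neg_iff_add_eq_0 add.commute)

lemma scaleC_diff_right: "c *\<^sub>C (x - y) = c *\<^sub>C x - c *\<^sub>C y"
  using scaleC_add_right[of c x "- y"] by simp

lemma scaleC_minus_one: "(-1) *\<^sub>C x = - x"
  by simp

end

text \<open>Unital associative complex *-algebras.  The library class \<open>ring_1\<close> is not used because
  it excludes the zero algebra.\<close>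

class star_algebra = ring + monoid_mult + complex_vector +
  fixes star :: "'a \<Rightarrow> 'a"
  assumes mult_scaleC_left [simp]: "(c *\<^sub>C x) * y = c *\<^sub>C (x * y)"
    and mult_scaleC_right [simp]: "x * (c *\<^sub>C y) = c *\<^sub>C (x * y)"
    and star_star [simp]: "star (star x) = x"
    and star_add: "star (x + y) = star x + star y"
    and star_scaleC: "star (c *\<^sub>C x) = cnj c *\<^sub>C star x"
    and star_mult: "star (x * y) = star y * star x"

class cstar_algebra = star_algebra + banach +
  assumes of_real_scaleC: "of_real r *\<^sub>C x = r *\<^sub>R x"
    and norm_scaleC: "norm (c *\<^sub>C x) = cmod c * norm x"
    and norm_mult_le: "norm (x * y) \<le> norm x * norm y"
    and norm_star_mult: "norm (star x * x) = (norm x)\<^sup>2"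

subclass (in cstar_algebra) real_normed_algebra
proof
  fix r :: real and x y :: 'a
  show "r *\<^sub>R x * y = r *\<^sub>R (x * y)" "x * r *\<^sub>R y = r *\<^sub>R (x * y)"
    by (simp_all flip: of_real_scaleC)
qed (rule norm_mult_le)

text \<open>The inner product is linear in the second argument.\<close>

class chilbert_space = complex_vector + banach +
  fixes cinner :: "'a \<Rightarrow> 'a \<Rightarrow> complex"
  assumes of_real_scaleC_vec: "of_real r *\<^sub>C x = r *\<^sub>R x"
    and cinner_commute: "cinner x y = cnj (cinner y x)"
    and cinner_add_right: "cinner x (y + z) = cinner x y + cinner x z"
    and cinner_scaleC_right: "cinner x (c *\<^sub>C y) = c * cinner x y"
    and cinner_self: "cinner x x = of_real ((norm x)\<^sup>2)"

instantiation complex :: chilbert_space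
begin

definition scaleC_complex :: "complex \<Rightarrow> complex \<Rightarrow> complex" where
  "scaleC_complex c z = c * z"

definition cinner_complex :: "complex \<Rightarrow> complex \<Rightarrow> complex" where
  "cinner_complex y z = cnj y * z"

instance
proof
  show "cinner z z = of_real ((norm z)\<^sup>2)" for z :: complex
    using complex_norm_square[of z] by (simp add: cinner_complex_def mult.commute)
qed (simp_all add: scaleC_complex_def cinner_complex_def algebra_simps scaleR_conv_of_real)

end

lemma star_zero [simp]: "star (0 :: 'a::star_algebra) = 0"
  using star_add[of "0::'a" 0] by simp

lemma star_minus: "star (- x) = - star (x :: 'a::star_algebra)"
  using star_scaleC[of "-1" x] by simp

lemma star_one [simp]: "star (1 :: 'a::star_algebra) = 1"
  by (metis mult.left_neutral mult.right_neutral star_mult star_star)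

definition projection :: "'a::star_algebra \<Rightarrow> bool" where
  "projection x \<longleftrightarrow> star x = x \<and> x * x = x"

definition unitary :: "'a::star_algebra \<Rightarrow> bool" where
  "unitary u \<longleftrightarrow> star u * u = 1 \<and> u * star u = 1"

text \<open>A *-homomorphism is not required to be unital.\<close>

definition star_hom :: "('a::star_algebra \<Rightarrow> 'b::star_algebra) \<Rightarrow> bool" where
  "star_hom \<rho> \<longleftrightarrow>
     (\<forall>x y. \<rho> (x + y) = \<rho> x + \<rho> y) \<and> (\<forall>c x. \<rho> (c *\<^sub>C x) = c *\<^sub>C \<rho> x) \<and>
     (\<forall>x y. \<rho> (x * y) = \<rho> x * \<rho> y) \<and> (\<forall>x. \<rho> (star x) = star (\<rho> x))"

definition star_subalgebra :: "'a::star_algebra set \<Rightarrow> bool" where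
  "star_subalgebra S \<longleftrightarrow> 1 \<in> S \<and> (\<forall>x\<in>S. \<forall>y\<in>S. x + y \<in> S \<and> x * y \<in> S) \<and>
     (\<forall>x\<in>S. star x \<in> S \<and> (\<forall>c. c *\<^sub>C x \<in> S))"

text \<open>States on a unital C*-algebra \<open>S\<close> of operators are functions on the ambient algebra,
  of which only the values on \<open>S\<close> matter.  The positive elements of a C*-algebra are
  those of the form \<open>x\<^sup>* x\<close>.\<close>

definition state_on :: "'a::star_algebra set \<Rightarrow> ('a \<Rightarrow> complex) \<Rightarrow> bool" where
  "state_on S \<phi> \<longleftrightarrow>
     (\<forall>x\<in>S. \<forall>y\<in>S. \<phi> (x + y) = \<phi> x + \<phi> y) \<and> (\<forall>x\<in>S. \<forall>c. \<phi> (c *\<^sub>C x) = c * \<phi> x) \<and>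
     (\<forall>x\<in>S. \<phi> (star x * x) \<in> \<real>\<^sub>\<ge>\<^sub>0) \<and> \<phi> 1 = 1"

definition tracial_state_on :: "'a::star_algebra set \<Rightarrow> ('a \<Rightarrow> complex) \<Rightarrow> bool" where
  "tracial_state_on S \<tau> \<longleftrightarrow> state_on S \<tau> \<and> (\<forall>x\<in>S. \<forall>y\<in>S. \<tau> (x * y) = \<tau> (y * x))"


section \<open>Bounded operators on a complex Hilbert space\<close>

lemma cinner_add_left: "cinner (x + y) z = cinner x z + cinner y (z :: 'h::chilbert_space)"
  by (metis cinner_add_right cinner_commute complex_cnj_add)

lemma cinner_scaleC_left: "cinner (c *\<^sub>C x) y = cnj c * cinner x (y :: 'h::chilbert_space)"
  by (metis cinner_commute cinner_scaleC_right complex_cnj_mult)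

lemma cinner_zero_right [simp]: "cinner x (0 :: 'h::chilbert_space) = 0"
  using cinner_scaleC_right[of x 0 x] by simp

lemma cinner_zero_left [simp]: "cinner 0 (x :: 'h::chilbert_space) = 0"
  using cinner_scaleC_left[of 0 x x] by simp

lemma cinner_minus_right: "cinner x (- y) = - cinner x (y :: 'h::chilbert_space)"
  using cinner_scaleC_right[of x "-1" y] by simp

lemma cinner_minus_left: "cinner (- x) y = - cinner x (y :: 'h::chilbert_space)"
  using cinner_scaleC_left[of "-1" x y] by simp

lemma cinner_diff_right: "cinner x (y - z) = cinner x y - cinner x (z :: 'h::chilbert_space)"
  using cinner_add_right[of x y "- z"] by (simp add: cinner_minus_right)

lemma cinner_diff_left: "cinner (x - y) z = cinner x z - cinner y (z :: 'h::chilbert_space)"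
  using cinner_add_left[of x "- y" z] by (simp add: cinner_minus_left)

lemma cinner_eqI:
  assumes "\<And>x. cinner x y = cinner x (z :: 'h::chilbert_space)"
  shows "y = z"
  using assms[of "y - z"] cinner_self[of "y - z"] by (simp add: cinner_diff_right)

lemma cinner_eqI':
  assumes "\<And>x. cinner y x = cinner (z :: 'h::chilbert_space) x"
  shows "y = z"
  by (rule cinner_eqI, subst (1 2) cinner_commute) (simp add: assms)

lemma norm_add_square:
  "(norm (x + y :: 'h::chilbert_space))\<^sup>2 = (norm x)\<^sup>2 + 2 * Re (cinner x y) + (norm y)\<^sup>2"
proof -
  have "of_real ((norm (x + y))\<^sup>2) = cinner x x + cinner x y + cinner y x + cinner y y"
    by (simp only: cinner_self[symmetric] cinner_add_left cinner_add_right add_ac)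
  also have "Re \<dots> = (norm x)\<^sup>2 + 2 * Re (cinner x y) + (norm y)\<^sup>2"
    using cinner_commute[of y x] by (simp add: cinner_self)
  finally show ?thesis by simp
qed

lemma norm_scaleC_vec: "norm (c *\<^sub>C x) = cmod c * norm (x :: 'h::chilbert_space)"
proof -
  have "of_real ((norm (c *\<^sub>C x))\<^sup>2) = cnj c * c * cinner x x"
    by (simp only: cinner_self[symmetric] cinner_scaleC_left cinner_scaleC_right mult_ac)
  also have "\<dots> = of_real ((cmod c * norm x)\<^sup>2)"
    using complex_norm_square[of c]
    by (simp add: cinner_self power_mult_distrib mult.commute)
  finally have "(norm (c *\<^sub>C x))\<^sup>2 = (cmod c * norm x)\<^sup>2"
    by (simp only: of_real_eq_iff)
  then show ?thesis by simp
qed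

lemma cinner_Cauchy_Schwarz: "cmod (cinner x y) \<le> norm x * norm (y :: 'h::chilbert_space)"
proof (cases "x = 0")
  case False
  define t where "t = - (cinner x y) / of_real ((norm x)\<^sup>2)"
  have nz: "(norm x)\<^sup>2 > 0" using False by simp
  have "0 \<le> (norm (y + t *\<^sub>C x))\<^sup>2" by simp
  also have "\<dots> = (norm y)\<^sup>2 + 2 * Re (t * cnj (cinner x y)) + (cmod t)\<^sup>2 * (norm x)\<^sup>2"
    using cinner_commute[of y x]
    by (simp add: norm_add_square cinner_scaleC_right norm_scaleC_vec power_mult_distrib)
  also have "t * cnj (cinner x y) = - of_real ((cmod (cinner x y))\<^sup>2 / (norm x)\<^sup>2)"
    using complex_norm_square[of "cinner x y"] by (simp add: t_def)
  also have "(cmod t)\<^sup>2 * (norm x)\<^sup>2 = (cmod (cinner x y))\<^sup>2 / (norm x)\<^sup>2"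
    using nz by (simp add: t_def norm_divide norm_mult power2_eq_square)
  finally have "(cmod (cinner x y))\<^sup>2 / (norm x)\<^sup>2 \<le> (norm y)\<^sup>2" by simp
  then have "(cmod (cinner x y))\<^sup>2 \<le> (norm x * norm y)\<^sup>2"
    using nz by (simp add: divide_le_eq power_mult_distrib mult.commute)
  then show ?thesis by (rule power2_le_imp_le) simp
qed simp

lemma riesz_representation:
  fixes f :: "'h::chilbert_space \<Rightarrow> complex"
  assumes add: "\<And>x y. f (x + y) = f x + f y" and scale: "\<And>c x. f (c *\<^sub>C x) = c * f x"
    and bound: "\<And>x. cmod (f x) \<le> K * norm x"
  shows "\<exists>z. \<forall>x. f x = cinner z x"
proof (cases "\<forall>x. f x = 0")
  case True
  then show ?thesis by (intro exI[of _ 0]) simp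
next
  case False
  then obtain x0 where x0: "f x0 \<noteq> 0" by blast
  have scaleR: "f (r *\<^sub>R x) = of_real r * f x" for r x
    using scale[of "of_real r" x] by (simp add: of_real_scaleC_vec)
  have diff: "f (x - y) = f x - f y" for x y
    using add[of x "(-1) *\<^sub>C y"] scale[of "-1" y] by simp
  define C where "C = {x. f x = 1}"
  have Cne: "inverse (f x0) *\<^sub>C x0 \<in> C"
    using x0 by (simp add: C_def scale)
  define m where "m = Inf (norm ` C)"
  have m_le: "m \<le> norm x" if "x \<in> C" for x
    unfolding m_def by (rule cInf_lower) (use that in \<open>auto intro: bdd_belowI[of _ 0]\<close>)
  have m0: "0 \<le> m" unfolding m_def by (rule cInf_greatest) (use Cne in auto)
  have par: "(norm (x - y))\<^sup>2 \<le> 2 * (norm x)\<^sup>2 + 2 * (norm y)\<^sup>2 - 4 * m\<^sup>2" if "x \<in> C" "y \<in> C" for x y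
  proof -
    have "(1/2) *\<^sub>R (x + y) \<in> C" using that by (simp add: C_def scaleR add)
    from m_le[OF this] have "2 * m \<le> norm (x + y)" by simp
    then have "(2 * m)\<^sup>2 \<le> (norm (x + y))\<^sup>2" using m0 by (intro power_mono) auto
    moreover have "(norm (x - y))\<^sup>2 + (norm (x + y))\<^sup>2 = 2 * (norm x)\<^sup>2 + 2 * (norm y)\<^sup>2"
      using norm_add_square[of x y] norm_add_square[of x "- y"] by (simp add: cinner_minus_right)
    ultimately show ?thesis by (simp add: power_mult_distrib)
  qed
  have "\<exists>x\<in>C. norm x < m + inverse (Suc n)" for n
    using cInf_lessD[of "norm ` C" "m + inverse (Suc n)"] Cne unfolding m_def by fastforce
  then obtain X where X: "\<And>n. X n \<in> C" "\<And>n. norm (X n) < m + inverse (real (Suc n))"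
    by metis
  have X': "norm (X n) \<le> m + inverse (real (Suc n))" for n
    by (rule less_imp_le[OF X(2)])
  have lim_m: "(\<lambda>n. norm (X n)) \<longlonglongrightarrow> m"
  proof (rule tendsto_sandwich[of "\<lambda>_. m" _ _ "\<lambda>n. m + inverse (real (Suc n))"])
    show "(\<lambda>n. m + inverse (real (Suc n))) \<longlonglongrightarrow> m"
      using tendsto_add[OF tendsto_const[of m] LIMSEQ_inverse_real_of_nat] by simp
    show "\<forall>\<^sub>F n in sequentially. m \<le> norm (X n)"
      by (rule always_eventually) (intro allI m_le X(1))
    show "\<forall>\<^sub>F n in sequentially. norm (X n) \<le> m + inverse (real (Suc n))"
      by (rule always_eventually) (intro allI X')
  qed (rule tendsto_const)
  have "Cauchy X"
  proof (rule metric_CauchyI)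
    fix e :: real assume e: "e > 0"
    have "(\<lambda>n. (norm (X n))\<^sup>2) \<longlonglongrightarrow> m\<^sup>2" using lim_m by (rule tendsto_power)
    moreover have "m\<^sup>2 < m\<^sup>2 + e\<^sup>2 / 4" using e by simp
    ultimately have "eventually (\<lambda>n. (norm (X n))\<^sup>2 < m\<^sup>2 + e\<^sup>2 / 4) sequentially"
      by (rule order_tendstoD(2))
    then obtain N where N: "\<And>n. n \<ge> N \<Longrightarrow> (norm (X n))\<^sup>2 < m\<^sup>2 + e\<^sup>2 / 4"
      by (auto simp: eventually_sequentially)
    have "dist (X i) (X j) < e" if "i \<ge> N" "j \<ge> N" for i j
    proof -
      have "(norm (X i - X j))\<^sup>2 < e\<^sup>2"
        using par[OF X(1) X(1), of i j] N[OF that(1)] N[OF that(2)] by simp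
      then show ?thesis using e by (simp add: dist_norm power2_less_imp_less)
    qed
    then show "\<exists>N. \<forall>i\<ge>N. \<forall>j\<ge>N. dist (X i) (X j) < e" by blast
  qed
  then obtain v where v: "X \<longlonglongrightarrow> v" using Cauchy_convergent convergent_def by blast
  have "norm v = m" using tendsto_norm[OF v] lim_m LIMSEQ_unique by blast
  have "(\<lambda>n. f (X n)) \<longlonglongrightarrow> f v"
  proof (rule Lim_null[THEN iffD2], rule Lim_null_comparison[of _ "\<lambda>n. K * norm (X n - v)"])
    show "(\<lambda>n. K * norm (X n - v)) \<longlonglongrightarrow> 0"
      using tendsto_mult[OF tendsto_const[of K] tendsto_norm[OF Lim_null[THEN iffD1, OF v]]] by simp
  qed (use bound in \<open>simp add: diff[symmetric]\<close>)
  moreover have "f (X n) = 1" for n using X(1) by (simp add: C_def)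
  ultimately have fv: "f v = 1" using LIMSEQ_unique[of "\<lambda>n. f (X n)"] by simp
  have orth: "cinner v x = 0" if "f x = 0" for x
  proof (cases "x = 0")
    case False
    define t where "t = - cnj (cinner v x) / of_real ((norm x)\<^sup>2)"
    have nz: "(norm x)\<^sup>2 > 0" using False by simp
    have "v + t *\<^sub>C x \<in> C" using fv that by (simp add: C_def add scale)
    from m_le[OF this] have "m\<^sup>2 \<le> (norm (v + t *\<^sub>C x))\<^sup>2" using m0 by (intro power_mono) auto
    also have "\<dots> = m\<^sup>2 + 2 * Re (t * cinner v x) + (cmod t)\<^sup>2 * (norm x)\<^sup>2"
      by (simp add: norm_add_square cinner_scaleC_right norm_scaleC_vec power_mult_distrib \<open>norm v = m\<close>)
    also have "t * cinner v x = - of_real ((cmod (cinner v x))\<^sup>2 / (norm x)\<^sup>2)"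
      using complex_norm_square[of "cinner v x"] by (simp add: t_def mult.commute)
    also have "(cmod t)\<^sup>2 * (norm x)\<^sup>2 = (cmod (cinner v x))\<^sup>2 / (norm x)\<^sup>2"
      using nz by (simp add: t_def norm_divide norm_mult power2_eq_square)
    finally have "(cmod (cinner v x))\<^sup>2 / (norm x)\<^sup>2 \<le> 0" by simp
    then show ?thesis using nz by (simp add: divide_le_0_iff)
  qed simp
  have vnz: "cinner v v \<noteq> 0"
    using fv scale[of 0 v] by (auto simp: cinner_self)
  have "f x = cinner (inverse (cinner v v) *\<^sub>C v) x" for x
  proof -
    have "cinner v (x - f x *\<^sub>C v) = 0" by (rule orth) (simp add: diff scale fv)
    then have "cinner v x = f x * cinner v v"
      by (simp add: cinner_diff_right cinner_scaleC_right)
    then show ?thesis using vnz cinner_commute[of v v] by (simp add: cinner_scaleC_left)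
  qed
  then show ?thesis by blast
qed

text \<open>The library's bounded operators are real linear; the algebra of all bounded operators on a
  complex Hilbert space consists of the complex linear ones.\<close>

typedef (overloaded) 'h bop =
  "{T :: 'h::chilbert_space \<Rightarrow>\<^sub>L 'h. \<forall>c x. blinfun_apply T (c *\<^sub>C x) = c *\<^sub>C blinfun_apply T x}"
  by (intro exI[of _ 0]) simp

setup_lifting type_definition_bop

lift_definition bop_apply :: "'h::chilbert_space bop \<Rightarrow> 'h \<Rightarrow> 'h" is blinfun_apply .

lemma bop_eqI: "(\<And>x. bop_apply S x = bop_apply T x) \<Longrightarrow> S = T"
  by transfer (rule blinfun_eqI)

lemma bop_apply_add: "bop_apply T (x + y) = bop_apply T x + bop_apply T y"
  by transfer (simp add: blinfun.add_right)

lemma bop_apply_scaleC: "bop_apply T (c *\<^sub>C x) = c *\<^sub>C bop_apply T x"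
  by transfer simp

lemma bop_apply_bound: "\<exists>K. \<forall>x. norm (bop_apply T x) \<le> K * norm x"
  by transfer (metis norm_blinfun)

lemma bop_exI:
  fixes f :: "'h::chilbert_space \<Rightarrow> 'h"
  assumes add: "\<And>x y. f (x + y) = f x + f y" and scale: "\<And>c x. f (c *\<^sub>C x) = c *\<^sub>C f x"
    and bound: "\<And>x. norm (f x) \<le> K * norm x"
  shows "\<exists>T. \<forall>x. bop_apply T x = f x"
proof -
  have "bounded_linear f"
    by (rule bounded_linear_intro[where K = K])
       (use assms scale[of "of_real _"] in \<open>auto simp: of_real_scaleC_vec mult.commute\<close>)
  then have "\<forall>x. bop_apply (Abs_bop (Blinfun f)) x = f x"
    by (simp add: bop_apply.rep_eq Abs_bop_inverse bounded_linear_Blinfun_apply scale)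
  then show ?thesis by blast
qed

lemma adjoint_exists: "\<exists>S. \<forall>x y. cinner (bop_apply S x) y = cinner x (bop_apply T y)"
proof -
  obtain K where K: "\<And>x. norm (bop_apply T x) \<le> K * norm x" using bop_apply_bound by blast
  have K': "norm (bop_apply T x) \<le> \<bar>K\<bar> * norm x" for x
    using K[of x] by (smt (verit) mult_right_mono norm_ge_zero)
  have "\<exists>z. \<forall>y. cinner x (bop_apply T y) = cinner z y" for x
  proof (rule riesz_representation[where K = "norm x * \<bar>K\<bar>"])
    fix y show "cmod (cinner x (bop_apply T y)) \<le> norm x * \<bar>K\<bar> * norm y"
      using cinner_Cauchy_Schwarz[of x "bop_apply T y"] K'[of y]
      by (smt (verit) mult.assoc mult_left_mono norm_ge_zero)
  qed (simp_all add: bop_apply_add bop_apply_scaleC cinner_add_right cinner_scaleC_right)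
  then obtain g where g: "\<And>x y. cinner x (bop_apply T y) = cinner (g x) y" by metis
  have g': "cinner (bop_apply T y) x = cinner y (g x)" for x y
    using g[of x y] cinner_commute[of "bop_apply T y" x] cinner_commute[of y "g x"] by simp
  have "\<exists>S. \<forall>x. bop_apply S x = g x"
  proof (rule bop_exI[where K = "\<bar>K\<bar>"])
    show "g (x + y) = g x + g y" for x y
      by (rule cinner_eqI) (simp add: g'[symmetric] cinner_add_right)
    show "g (c *\<^sub>C x) = c *\<^sub>C g x" for c x
      by (rule cinner_eqI) (simp add: g'[symmetric] cinner_scaleC_right)
    show "norm (g x) \<le> \<bar>K\<bar> * norm x" for x
    proof (cases "g x = 0")
      case False
      have "(norm (g x))\<^sup>2 = cmod (cinner (g x) (g x))" by (simp add: cinner_self norm_power)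
      also have "\<dots> \<le> norm x * norm (bop_apply T (g x))"
        unfolding g[symmetric] by (rule cinner_Cauchy_Schwarz)
      also have "\<dots> \<le> norm x * (\<bar>K\<bar> * norm (g x))" by (rule mult_left_mono[OF K']) simp
      finally have "norm (g x) * norm (g x) \<le> (\<bar>K\<bar> * norm x) * norm (g x)"
        by (simp add: power2_eq_square mult_ac)
      then show ?thesis using False by simp
    qed simp
  qed
  then show ?thesis using g by metis
qed

instantiation bop :: (chilbert_space) star_algebra
begin

lift_definition zero_bop :: "'a bop" is 0 by simp
lift_definition one_bop :: "'a bop" is id_blinfun by simp
lift_definition plus_bop :: "'a bop \<Rightarrow> 'a bop \<Rightarrow> 'a bop" is "(+)"
  by (simp add: blinfun.add_left scaleC_add_right)
lift_definition minus_bop :: "'a bop \<Rightarrow> 'a bop \<Rightarrow> 'a bop" is "(-)"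
  by (simp add: blinfun.diff_left scaleC_diff_right)
lift_definition uminus_bop :: "'a bop \<Rightarrow> 'a bop" is uminus
  by (simp add: blinfun.minus_left)
lift_definition times_bop :: "'a bop \<Rightarrow> 'a bop \<Rightarrow> 'a bop" is "(o\<^sub>L)" by simp

definition scaleC_bop :: "complex \<Rightarrow> 'a bop \<Rightarrow> 'a bop" where
  "scaleC_bop c T = (THE S. \<forall>x. bop_apply S x = c *\<^sub>C bop_apply T x)"

definition star_bop :: "'a bop \<Rightarrow> 'a bop" where
  "star_bop T = (THE S. \<forall>x y. cinner (bop_apply S x) y = cinner x (bop_apply T y))"

lemma bop_apply_simps [simp]:
  "bop_apply 0 x = 0" "bop_apply 1 x = x" "bop_apply (S + T) x = bop_apply S x + bop_apply T x"
  "bop_apply (S - T) x = bop_apply S x - bop_apply T x" "bop_apply (- T) x = - bop_apply T x"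
  "bop_apply (S * T) x = bop_apply S (bop_apply T x)"
  by (transfer; simp add: blinfun.bilinear_simps)+

lemma bop_apply_scaleC_left [simp]: "bop_apply (c *\<^sub>C T) x = c *\<^sub>C bop_apply T x"
proof -
  obtain K where K: "\<And>x. norm (bop_apply T x) \<le> K * norm x" using bop_apply_bound by blast
  have "\<exists>S. \<forall>x. bop_apply S x = c *\<^sub>C bop_apply T x"
    by (rule bop_exI[where K = "cmod c * K"])
       (simp_all add: bop_apply_add bop_apply_scaleC scaleC_add_right norm_scaleC_vec
         mult.assoc mult_left_mono K mult.commute[of c])
  then have "\<exists>!S. \<forall>x. bop_apply S x = c *\<^sub>C bop_apply T x"
    by (metis bop_eqI)
  from theI'[OF this] show ?thesis unfolding scaleC_bop_def by blast
qed

lemma cinner_star_left: "cinner (bop_apply (star T) x) y = cinner x (bop_apply T y)"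
proof -
  have "\<exists>!S. \<forall>x y. cinner (bop_apply S x) y = cinner x (bop_apply T y)"
    by (rule ex_ex1I[OF adjoint_exists], rule bop_eqI, rule cinner_eqI') simp
  from theI'[OF this] show ?thesis unfolding star_bop_def by blast
qed

lemma cinner_star_right: "cinner x (bop_apply (star T) y) = cinner (bop_apply T x) y"
  using cinner_star_left[of T y x] cinner_commute[of x] cinner_commute[of "bop_apply T x"] by simp

instance
proof
  fix S T R :: "'a bop" and c d :: complex
  note star = cinner_star_right cinner_star_left cinner_add_left cinner_add_right
    cinner_scaleC_left cinner_scaleC_right
  show "star (star T) = T" "star (S + T) = star S + star T"
    "star (c *\<^sub>C T) = cnj c *\<^sub>C star T" "star (S * T) = star T * star S"
    by (rule bop_eqI, rule cinner_eqI, simp add: star)+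
qed (rule bop_eqI, simp add: bop_apply_add bop_apply_scaleC scaleC_add_right scaleC_add_left
      add_ac)+

end

text \<open>A von Neumann algebra is a unital *-subalgebra of the bounded operators that is closed
  in the strong operator topology.\<close>

definition von_neumann_algebra :: "'h::chilbert_space bop set \<Rightarrow> bool" where
  "von_neumann_algebra U \<longleftrightarrow> star_subalgebra U \<and>
     closedin (pullback_topology UNIV Rep_bop strong_operator_topology) U"

definition amenable_on :: "'h::chilbert_space bop set \<Rightarrow> ('h bop \<Rightarrow> complex) \<Rightarrow> bool" where
  "amenable_on U \<tau> \<longleftrightarrow> (\<exists>\<omega>. state_on UNIV \<omega> \<and> (\<forall>a\<in>U. \<omega> a = \<tau> a) \<and>
     (\<forall>T. \<forall>u\<in>U. unitary u \<longrightarrow> \<omega> (u * T * star u) = \<omega> T))"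


section \<open>The universal C*-algebra generated by projections\<close>

text \<open>The free unital *-algebra on self-adjoint generators is the monoid algebra of the free monoid
  of words; the involution reverses words and conjugates coefficients.\<close>

datatype 'g fword = Word (letters: "'g list")

instantiation fword :: (type) monoid_add
begin

definition zero_fword :: "'a fword" where "0 = Word []"

definition plus_fword :: "'a fword \<Rightarrow> 'a fword \<Rightarrow> 'a fword" where
  "v + w = Word (letters v @ letters w)"

instance by standard (simp_all add: zero_fword_def plus_fword_def)

end

type_synonym ('x, 'a) free_alg = "('x \<times> 'a) fword \<Rightarrow>\<^sub>0 complex"

abbreviation free_const :: "complex \<Rightarrow> ('x, 'a) free_alg" where
  "free_const \<equiv> Poly_Mapping.single 0"

definition free_gen :: "'x \<Rightarrow> 'a \<Rightarrow> ('x, 'a) free_alg" where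
  "free_gen x a = Poly_Mapping.single (Word [(x, a)]) 1"

definition word_rev :: "'g fword \<Rightarrow> 'g fword" where
  "word_rev w = Word (rev (letters w))"

definition free_star :: "('x, 'a) free_alg \<Rightarrow> ('x, 'a) free_alg" where
  "free_star z = Poly_Mapping.map cnj (Poly_Mapping.map_key word_rev z)"

text \<open>Each *-homomorphism \<open>\<pi>\<close> from the free algebra to a C*-algebra gives rise to the C*-seminorm
  \<open>z \<mapsto> \<parallel>\<pi> z\<parallel>\<close>, and all C*-seminorms arise in this way.  The images of the generators satisfy the
  relations of a family of projection-valued measures iff the seminorm annihilates these relations.
  (Self-adjointness of the generators is built into the involution.)\<close>

definition pvm_seminorm :: "(('x, 'a::finite) free_alg \<Rightarrow> real) \<Rightarrow> bool" where
  "pvm_seminorm p \<longleftrightarrow>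
     (\<forall>y z. p (y + z) \<le> p y + p z) \<and> (\<forall>c z. p (free_const c * z) = cmod c * p z) \<and>
     (\<forall>y z. p (y * z) \<le> p y * p z) \<and> (\<forall>z. p (free_star z * z) = (p z)\<^sup>2) \<and>
     (\<forall>x a. p (free_gen x a * free_gen x a - free_gen x a) = 0) \<and>
     (\<forall>x. p ((\<Sum>a\<in>UNIV. free_gen x a) - 1) = 0)"

text \<open>The universal C*-algebra is the completion of the free algebra with respect to the largest
  such seminorm, realised as Cauchy sequences modulo null sequences.\<close>

definition unorm :: "('x, 'a::finite) free_alg \<Rightarrow> real" where
  "unorm z = (SUP p\<in>Collect pvm_seminorm. p z)"

definition ucauchy :: "(nat \<Rightarrow> ('x, 'a::finite) free_alg) \<Rightarrow> bool" where
  "ucauchy s \<longleftrightarrow> (\<forall>e>0. \<exists>N. \<forall>m\<ge>N. \<forall>n\<ge>N. unorm (s m - s n) < e)"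

definition urel :: "(nat \<Rightarrow> ('x, 'a::finite) free_alg) \<Rightarrow> (nat \<Rightarrow> ('x, 'a) free_alg) \<Rightarrow> bool" where
  "urel s t \<longleftrightarrow> ucauchy s \<and> ucauchy t \<and> (\<lambda>n. unorm (s n - t n)) \<longlonglongrightarrow> 0"

lemma poly_mapping_decomp:
  "(z :: 'a \<Rightarrow>\<^sub>0 'b::comm_monoid_add) = (\<Sum>w\<in>Poly_Mapping.keys z. Poly_Mapping.single w (Poly_Mapping.lookup z w))"
  by (rule poly_mapping_eqI)
     (auto simp: lookup_sum lookup_single when_def in_keys_iff)

lemma poly_mapping_induct' [case_names zero single add]:
  fixes z :: "'a \<Rightarrow>\<^sub>0 'b::comm_monoid_add"
  assumes "P 0" "\<And>w c. P (Poly_Mapping.single w c)" "\<And>y z. P y \<Longrightarrow> P z \<Longrightarrow> P (y + z)"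
  shows "P z"
proof -
  have "P (\<Sum>w\<in>W. Poly_Mapping.single w (g w))" if "finite W" for W and g
    using that by (induction W rule: finite_induct) (use assms in auto)
  then show ?thesis by (subst poly_mapping_decomp) simp
qed

lemma word_rev_word_rev [simp]: "word_rev (word_rev w) = w"
  by (simp add: word_rev_def)

lemma word_rev_add: "word_rev (v + w) = word_rev w + word_rev v"
  by (simp add: word_rev_def plus_fword_def)

lemma inj_word_rev: "inj word_rev"
  by (rule injI) (metis word_rev_word_rev)

lemma lookup_free_star: "Poly_Mapping.lookup (free_star z) w = cnj (Poly_Mapping.lookup z (word_rev w))"
  by (simp add: free_star_def Poly_Mapping.map.rep_eq map_key.rep_eq[OF inj_word_rev] when_def)

lemma free_star_add: "free_star (y + z) = free_star y + free_star z"
  by (rule poly_mapping_eqI) (simp add: lookup_free_star lookup_add)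

lemma free_star_diff: "free_star (y - z) = free_star y - free_star z"
  by (rule poly_mapping_eqI) (simp add: lookup_free_star lookup_minus)

lemma free_star_star [simp]: "free_star (free_star z) = z"
  by (rule poly_mapping_eqI) (simp add: lookup_free_star)

lemma free_star_zero [simp]: "free_star 0 = 0"
  by (rule poly_mapping_eqI) (simp add: lookup_free_star)

lemma free_star_single: "free_star (Poly_Mapping.single w c) = Poly_Mapping.single (word_rev w) (cnj c)"
  by (rule poly_mapping_eqI) (auto simp: lookup_free_star lookup_single when_def)

lemma free_star_one [simp]: "free_star 1 = 1"
  using free_star_single[of 0 1] by (simp add: word_rev_def zero_fword_def flip: single_one)

lemma free_star_gen: "free_star (free_gen x a) = free_gen x a"
  by (simp add: free_gen_def free_star_single word_rev_def)

lemma free_star_mult: "free_star (y * z) = free_star z * free_star y"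
proof (induction y rule: poly_mapping_induct')
  case (single v c)
  show ?case
    by (induction z rule: poly_mapping_induct')
       (simp_all add: free_star_single mult_single word_rev_add distrib_left distrib_right
         free_star_add mult.commute)
qed (simp_all add: distrib_left distrib_right free_star_add)

lemma free_star_const: "free_star (free_const c * z) = free_const (cnj c) * free_star z"
proof (induction z rule: poly_mapping_induct')
  case (single w d)
  then show ?case by (simp add: free_star_single mult_single)
qed (simp_all add: distrib_left free_star_add)

lemma free_const_commute: "y * (free_const c * z) = free_const c * (y * z)"
proof -
  have "y * free_const c = free_const c * y"
    by (induction y rule: poly_mapping_induct')
       (simp_all add: mult_single distrib_left distrib_right mult.commute[of c])
  then show ?thesis by (simp flip: mult.assoc)
qed

context
  fixes p :: "('x, 'a::finite) free_alg \<Rightarrow> real"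
  assumes p: "pvm_seminorm p"
begin

lemma pvm_seminorm_add: "p (y + z) \<le> p y + p z"
  using p by (simp add: pvm_seminorm_def)

lemma pvm_seminorm_const: "p (free_const c * z) = cmod c * p z"
  using p by (simp add: pvm_seminorm_def)

lemma pvm_seminorm_mult: "p (y * z) \<le> p y * p z"
  using p by (simp add: pvm_seminorm_def)

lemma pvm_seminorm_cstar: "p (free_star z * z) = (p z)\<^sup>2"
  using p by (simp add: pvm_seminorm_def)

lemma pvm_seminorm_gen: "p (free_gen x a * free_gen x a - free_gen x a) = 0"
  using p by (simp add: pvm_seminorm_def)

lemma pvm_seminorm_sum_gen: "p ((\<Sum>a\<in>UNIV. free_gen x a) - 1) = 0"
  using p by (simp add: pvm_seminorm_def)

lemma pvm_seminorm_zero: "p 0 = 0"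
  using pvm_seminorm_const[of 0 0] by simp

lemma pvm_seminorm_minus: "p (- z) = p z"
  using pvm_seminorm_const[of "-1" z] by (simp add: single_uminus)

lemma pvm_seminorm_nonneg: "0 \<le> p z"
  using pvm_seminorm_add[of z "- z"] by (simp add: pvm_seminorm_minus pvm_seminorm_zero)

lemma pvm_seminorm_triangle: "p (x - z) \<le> p (x - y) + p (y - z)"
  using pvm_seminorm_add[of "x - y" "y - z"] by simp

lemma pvm_seminorm_one_le: "p 1 \<le> 1"
proof -
  have "(p 1)\<^sup>2 = p 1"
    using pvm_seminorm_cstar[of 1] by simp
  then show ?thesis by (auto simp: power2_eq_square)
qed

lemma pvm_seminorm_gen_le: "p (free_gen x a) \<le> 1"
proof -
  have "p (free_gen x a * free_gen x a) = p (free_gen x a)"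
    using pvm_seminorm_triangle[of "free_gen x a * free_gen x a" 0 "free_gen x a"]
      pvm_seminorm_triangle[of "free_gen x a" 0 "free_gen x a * free_gen x a"]
      pvm_seminorm_minus[of "free_gen x a * free_gen x a - free_gen x a"] pvm_seminorm_gen[of x a]
    by simp
  then have "(p (free_gen x a))\<^sup>2 = p (free_gen x a)"
    using pvm_seminorm_cstar[of "free_gen x a"] by (simp add: free_star_gen)
  then show ?thesis by (auto simp: power2_eq_square)
qed

lemma pvm_seminorm_word_le: "p (Poly_Mapping.single w 1) \<le> 1"
proof -
  have "p (Poly_Mapping.single (Word ls) 1) \<le> 1" for ls
  proof (induction ls)
    case Nil
    then show ?case using pvm_seminorm_one_le by (simp flip: zero_fword_def)
  next
    case (Cons l ls)
    obtain x a where l: "l = (x, a)" by fastforce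
    have "Poly_Mapping.single (Word (l # ls)) 1 = free_gen x a * Poly_Mapping.single (Word ls) 1"
      by (simp add: free_gen_def mult_single plus_fword_def l)
    then have "p (Poly_Mapping.single (Word (l # ls)) 1)
        \<le> p (free_gen x a) * p (Poly_Mapping.single (Word ls) 1)"
      using pvm_seminorm_mult by simp
    also have "\<dots> \<le> 1 * 1"
      by (intro mult_mono pvm_seminorm_gen_le Cons pvm_seminorm_nonneg) simp
    finally show ?case by simp
  qed
  then show ?thesis by (metis fword.collapse)
qed

lemma pvm_seminorm_le: "p z \<le> (\<Sum>w\<in>Poly_Mapping.keys z. cmod (Poly_Mapping.lookup z w))"
proof -
  have single: "p (Poly_Mapping.single w c) \<le> cmod c" for w c
  proof -
    have "p (Poly_Mapping.single w c) = cmod c * p (Poly_Mapping.single w 1)"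
      using pvm_seminorm_const[of c "Poly_Mapping.single w 1"] by (simp add: mult_single)
    also have "\<dots> \<le> cmod c * 1" by (intro mult_left_mono pvm_seminorm_word_le) simp
    finally show ?thesis by simp
  qed
  have "p (\<Sum>w\<in>W. Poly_Mapping.single w (g w)) \<le> (\<Sum>w\<in>W. cmod (g w))" if "finite W" for W g
    using that
  proof (induction W rule: finite_induct)
    case (insert w W)
    have "p (\<Sum>w\<in>insert w W. Poly_Mapping.single w (g w))
        \<le> p (Poly_Mapping.single w (g w)) + p (\<Sum>w\<in>W. Poly_Mapping.single w (g w))"
      using insert(1,2) by (simp add: pvm_seminorm_add)
    also have "\<dots> \<le> cmod (g w) + (\<Sum>w\<in>W. cmod (g w))"
      by (intro add_mono single insert.IH)
    finally show ?case using insert(1,2) by simp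
  qed (simp add: pvm_seminorm_zero)
  from this[OF finite_keys, of "Poly_Mapping.lookup z" z] show ?thesis
    unfolding poly_mapping_decomp[symmetric] .
qed

end

lemma pvm_seminorm_bdd: "bdd_above ((\<lambda>p. p z) ` Collect pvm_seminorm)"
  by (rule bdd_aboveI2) (use pvm_seminorm_le in auto)

lemma pvm_seminorm_le_unorm: "pvm_seminorm p \<Longrightarrow> p z \<le> unorm z"
  unfolding unorm_def by (rule cSUP_upper[OF _ pvm_seminorm_bdd]) simp

lemma unorm_least: "(\<And>p. pvm_seminorm p \<Longrightarrow> p z \<le> B) \<Longrightarrow> unorm z \<le> B"
  unfolding unorm_def
proof (rule cSUP_least)
  show "Collect pvm_seminorm \<noteq> {}"
    by (auto simp: pvm_seminorm_def intro!: exI[of _ "\<lambda>_. 0"])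
qed simp

lemma pvm_seminorm_unorm: "pvm_seminorm (unorm :: ('x, 'a::finite) free_alg \<Rightarrow> real)"
proof -
  have zero: "pvm_seminorm (\<lambda>_ :: ('x, 'a) free_alg. 0)" by (simp add: pvm_seminorm_def)
  have nonneg: "0 \<le> unorm z" for z :: "('x, 'a) free_alg"
    using pvm_seminorm_le_unorm[OF zero] .
  note le = pvm_seminorm_le_unorm
  show ?thesis
    unfolding pvm_seminorm_def
  proof (intro conjI allI)
    fix y z :: "('x, 'a) free_alg" and c and x :: 'x and a :: 'a
    show "unorm (y + z) \<le> unorm y + unorm z"
      by (rule unorm_least) (smt (verit) le pvm_seminorm_add)
    show "unorm (y * z) \<le> unorm y * unorm z"
    proof (rule unorm_least)
      fix p :: "('x, 'a) free_alg \<Rightarrow> real" assume p: "pvm_seminorm p"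
      have "p (y * z) \<le> p y * p z" by (rule pvm_seminorm_mult[OF p])
      also have "\<dots> \<le> unorm y * unorm z"
        by (intro mult_mono le p nonneg pvm_seminorm_nonneg[OF p])
      finally show "p (y * z) \<le> unorm y * unorm z" .
    qed
    have *: "unorm (free_const c * z) \<le> cmod c * unorm z" for c and z :: "('x, 'a) free_alg"
      by (rule unorm_least) (simp add: pvm_seminorm_const mult_left_mono le)
    show "unorm (free_const c * z) = cmod c * unorm z"
    proof (cases "c = 0")
      case True
      then show ?thesis using *[of 0 z] nonneg[of 0] by simp
    next
      case False
      have "cmod c * unorm z \<le> unorm (free_const c * z)"
        using *[of "inverse c" "free_const c * z"] False
        by (simp add: mult.assoc[symmetric] mult_single norm_inverse norm_divide field_simps)
      with * show ?thesis by (metis order_antisym)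
    qed
    show "unorm (free_star z * z) = (unorm z)\<^sup>2"
    proof (rule order_antisym)
      show "unorm (free_star z * z) \<le> (unorm z)\<^sup>2"
        by (rule unorm_least)
           (simp add: pvm_seminorm_cstar power_mono le pvm_seminorm_nonneg)
      have "unorm z \<le> sqrt (unorm (free_star z * z))"
      proof (rule unorm_least)
        fix p :: "('x, 'a) free_alg \<Rightarrow> real" assume p: "pvm_seminorm p"
        have "(p z)\<^sup>2 \<le> unorm (free_star z * z)"
          using le[OF p, of "free_star z * z"] pvm_seminorm_cstar[OF p] by simp
        then show "p z \<le> sqrt (unorm (free_star z * z))" by (rule real_le_rsqrt)
      qed
      then have "(unorm z)\<^sup>2 \<le> (sqrt (unorm (free_star z * z)))\<^sup>2"
        using nonneg[of z] by (rule power_mono)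
      then show "(unorm z)\<^sup>2 \<le> unorm (free_star z * z)" using nonneg by simp
    qed
    show "unorm (free_gen x a * free_gen x a - free_gen x a) = 0"
      by (intro order_antisym nonneg unorm_least) (simp add: pvm_seminorm_gen)
    show "unorm ((\<Sum>a\<in>UNIV. free_gen x a) - (1 :: ('x, 'a) free_alg)) = 0"
      by (intro order_antisym nonneg unorm_least) (simp add: pvm_seminorm_sum_gen)
  qed
qed

lemmas unorm_add = pvm_seminorm_add[OF pvm_seminorm_unorm]
  and unorm_const = pvm_seminorm_const[OF pvm_seminorm_unorm]
  and unorm_mult = pvm_seminorm_mult[OF pvm_seminorm_unorm]
  and unorm_cstar = pvm_seminorm_cstar[OF pvm_seminorm_unorm]
  and unorm_zero [simp] = pvm_seminorm_zero[OF pvm_seminorm_unorm]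
  and unorm_minus = pvm_seminorm_minus[OF pvm_seminorm_unorm]
  and unorm_nonneg [simp] = pvm_seminorm_nonneg[OF pvm_seminorm_unorm]
  and unorm_triangle = pvm_seminorm_triangle[OF pvm_seminorm_unorm]

lemma unorm_diff_commute: "unorm (y - z) = unorm (z - y)"
  using unorm_minus[of "y - z"] by simp

lemma unorm_star: "unorm (free_star z) = unorm (z :: ('x, 'a::finite) free_alg)"
proof -
  have "unorm z \<le> unorm (free_star z)" for z :: "('x, 'a) free_alg"
  proof (cases "unorm z = 0")
    case False
    then have "unorm z > 0" using unorm_nonneg[of z] by linarith
    moreover have "unorm z * unorm z \<le> unorm (free_star z) * unorm z"
      using unorm_cstar[of z] unorm_mult[of "free_star z" z] by (simp add: power2_eq_square)
    ultimately show ?thesis by simp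
  qed simp
  from this[of z] this[of "free_star z"] show ?thesis by simp
qed

lemma ucauchyI:
  assumes "ucauchy t" "ucauchy r" "K \<ge> 0" "L \<ge> 0"
    and le: "\<And>m n. unorm (s m - s n) \<le> K * unorm (t m - t n) + L * unorm (r m - r n)"
  shows "ucauchy s"
  unfolding ucauchy_def
proof (intro allI impI)
  fix e :: real assume "e > 0"
  define d where "d = e / (K + L + 1)"
  have d: "d > 0" using \<open>e > 0\<close> assms(3,4) by (simp add: d_def)
  obtain M where M: "\<And>m n. m \<ge> M \<Longrightarrow> n \<ge> M \<Longrightarrow> unorm (t m - t n) < d"
    using assms(1) d unfolding ucauchy_def by blast
  obtain N where N: "\<And>m n. m \<ge> N \<Longrightarrow> n \<ge> N \<Longrightarrow> unorm (r m - r n) < d"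
    using assms(2) d unfolding ucauchy_def by blast
  have "unorm (s m - s n) < e" if "m \<ge> max M N" "n \<ge> max M N" for m n
  proof -
    have "unorm (s m - s n) \<le> K * d + L * d"
      using le[of m n] M[of m n] N[of m n] that assms(3,4)
      by (smt (verit) max.bounded_iff mult_left_mono)
    also have "\<dots> < (K + L + 1) * d" using d by (simp add: algebra_simps)
    also have "\<dots> = e" using assms(3,4) by (simp add: d_def)
    finally show ?thesis .
  qed
  then show "\<exists>N. \<forall>m\<ge>N. \<forall>n\<ge>N. unorm (s m - s n) < e" by blast
qed

lemma unullI:
  assumes "(\<lambda>n. unorm (t n)) \<longlonglongrightarrow> 0" "(\<lambda>n. unorm (r n)) \<longlonglongrightarrow> 0"
    and le: "\<And>n. unorm (s n) \<le> K * unorm (t n) + L * unorm (r n)"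
  shows "(\<lambda>n. unorm (s n)) \<longlonglongrightarrow> 0"
proof (rule tendsto_sandwich[of "\<lambda>_. 0"])
  show "(\<lambda>n. K * unorm (t n) + L * unorm (r n)) \<longlonglongrightarrow> 0"
    using tendsto_add[OF tendsto_mult[OF tendsto_const[of K] assms(1)]
        tendsto_mult[OF tendsto_const[of L] assms(2)]] by simp
qed (use le in \<open>auto intro!: tendsto_const\<close>)

lemma ucauchy_const [simp]: "ucauchy (\<lambda>_. z)"
  by (simp add: ucauchy_def)

lemma ucauchy_convergent:
  fixes s :: "nat \<Rightarrow> ('x, 'a::finite) free_alg"
  assumes s: "ucauchy s"
  shows "convergent (\<lambda>n. unorm (s n))"
proof -
  have "\<bar>unorm y - unorm z\<bar> \<le> unorm (y - z)" for y z :: "('x, 'a) free_alg"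
    using unorm_triangle[of y 0 z] unorm_triangle[of z 0 y] unorm_triangle[of y z 0]
      unorm_triangle[of z y 0] unorm_diff_commute[of y z] by simp
  then have "Cauchy (\<lambda>n. unorm (s n))"
    using s unfolding ucauchy_def Cauchy_def dist_real_def by (meson le_less_trans)
  then show ?thesis by (rule Cauchy_convergent)
qed

lemma ucauchy_bounded: "ucauchy s \<Longrightarrow> \<exists>K\<ge>0. \<forall>n. unorm (s n) \<le> K"
  using convergent_imp_Bseq[OF ucauchy_convergent, of s] unfolding Bseq_def
  by (auto intro: less_imp_le)

lemma unorm_mult_diff:
  "unorm (s * t - s' * t') \<le> unorm s * unorm (t - t') + unorm t' * unorm (s - s')"
proof -
  have "s * t - s' * t' = s * (t - t') + (s - s') * t'" by (simp add: algebra_simps)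
  then have "unorm (s * t - s' * t') \<le> unorm (s * (t - t')) + unorm ((s - s') * t')"
    using unorm_add[of "s * (t - t')"] by simp
  also have "\<dots> \<le> unorm s * unorm (t - t') + unorm (s - s') * unorm t'"
    by (intro add_mono unorm_mult)
  finally show ?thesis by (simp add: mult.commute)
qed

lemma unorm_add_diff: "unorm (s + t - (s' + t')) \<le> 1 * unorm (s - s') + 1 * unorm (t - t')"
  using unorm_add[of "s - s'" "t - t'"] by (simp add: algebra_simps)

lemma unorm_minus_diff: "unorm (- s - (- s')) \<le> 1 * unorm (s - s') + 0 * unorm (s - s')"
  using unorm_minus[of "s - s'"] by (simp add: algebra_simps)

lemma unorm_star_diff:
  "unorm (free_star s - free_star s') \<le> 1 * unorm (s - s') + 0 * unorm (s - s')"
  by (simp add: free_star_diff[symmetric] unorm_star)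

lemma ucauchy_add: "ucauchy s \<Longrightarrow> ucauchy t \<Longrightarrow> ucauchy (\<lambda>n. s n + t n)"
  by (rule ucauchyI[where K = 1 and L = 1, OF _ _ _ _ unorm_add_diff]) auto

lemma ucauchy_minus: "ucauchy s \<Longrightarrow> ucauchy (\<lambda>n. - s n)"
  by (rule ucauchyI[where K = 1 and L = 0, OF _ _ _ _ unorm_minus_diff]) auto

lemma ucauchy_diff: "ucauchy s \<Longrightarrow> ucauchy t \<Longrightarrow> ucauchy (\<lambda>n. s n - t n)"
  using ucauchy_add[OF _ ucauchy_minus, of s t] by simp

lemma ucauchy_star: "ucauchy s \<Longrightarrow> ucauchy (\<lambda>n. free_star (s n))"
  by (rule ucauchyI[where K = 1 and L = 0, OF _ _ _ _ unorm_star_diff]) auto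

lemma ucauchy_mult:
  assumes "ucauchy s" "ucauchy t"
  shows "ucauchy (\<lambda>n. s n * t n)"
proof -
  obtain K where K: "K \<ge> 0" "\<And>n. unorm (s n) \<le> K" using ucauchy_bounded[OF assms(1)] by blast
  obtain L where L: "L \<ge> 0" "\<And>n. unorm (t n) \<le> L" using ucauchy_bounded[OF assms(2)] by blast
  show ?thesis
  proof (rule ucauchyI[OF assms(2,1) K(1) L(1)])
    fix m n
    show "unorm (s m * t m - s n * t n) \<le> K * unorm (t m - t n) + L * unorm (s m - s n)"
      using unorm_mult_diff[of "s m" "t m" "s n" "t n"] K(2)[of m] L(2)[of n]
      by (smt (verit) mult_right_mono unorm_nonneg)
  qed
qed

lemmas ucauchy_intros = ucauchy_add ucauchy_minus ucauchy_diff ucauchy_star ucauchy_mult ucauchy_const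

lemma urelD: "urel s t \<Longrightarrow> ucauchy s" "urel s t \<Longrightarrow> ucauchy t"
  "urel s t \<Longrightarrow> (\<lambda>n. unorm (s n - t n)) \<longlonglongrightarrow> 0"
  by (simp_all add: urel_def)

lemma urelI: "ucauchy s \<Longrightarrow> (\<And>n. s n = t n) \<Longrightarrow> urel s t"
  by (simp add: urel_def ext[of s t])

lemma urel_sym: "urel s t \<Longrightarrow> urel t s"
proof -
  have "(\<lambda>n. unorm (t n - s n)) = (\<lambda>n. unorm (s n - t n))"
    by (rule ext) (rule unorm_diff_commute)
  then show "urel s t \<Longrightarrow> urel t s" by (simp add: urel_def)
qed

lemma part_equivp_urel: "part_equivp (urel :: (nat \<Rightarrow> ('x, 'a::finite) free_alg) \<Rightarrow> _)"
proof (rule part_equivpI)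
  show "\<exists>s :: nat \<Rightarrow> ('x, 'a) free_alg. urel s s"
    by (auto simp: urel_def intro!: exI[of _ "\<lambda>_. 0"])
  show "symp (urel :: (nat \<Rightarrow> ('x, 'a) free_alg) \<Rightarrow> _)"
    by (rule sympI) (rule urel_sym)
  show "transp (urel :: (nat \<Rightarrow> ('x, 'a) free_alg) \<Rightarrow> _)"
  proof (rule transpI)
    fix s t r :: "nat \<Rightarrow> ('x, 'a) free_alg" assume st: "urel s t" and tr: "urel t r"
    have "(\<lambda>n. unorm (s n - r n)) \<longlonglongrightarrow> 0"
      by (rule unullI[OF urelD(3)[OF st] urelD(3)[OF tr], of _ 1 1])
         (simp add: unorm_triangle)
    then show "urel s r" using urelD[OF st] urelD[OF tr] by (simp add: urel_def)
  qed
qed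

quotient_type (overloaded) ('x, 'a) univ_cstar = "nat \<Rightarrow> ('x, 'a::finite) free_alg" / partial: urel
  by (rule part_equivp_urel)

instantiation univ_cstar :: (type, finite) star_algebra
begin

lift_definition zero_univ_cstar :: "('a, 'b) univ_cstar" is "\<lambda>_. 0"
  by (simp add: urelI)

lift_definition one_univ_cstar :: "('a, 'b) univ_cstar" is "\<lambda>_. 1"
  by (simp add: urelI)

lift_definition plus_univ_cstar :: "('a, 'b) univ_cstar \<Rightarrow> ('a, 'b) univ_cstar \<Rightarrow> ('a, 'b) univ_cstar"
  is "\<lambda>s t n. s n + t n"
  unfolding urel_def by (auto intro!: ucauchy_intros intro: unullI[OF _ _ unorm_add_diff])

lift_definition uminus_univ_cstar :: "('a, 'b) univ_cstar \<Rightarrow> ('a, 'b) univ_cstar" is "\<lambda>s n. - s n"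
  unfolding urel_def
  by (elim conjE, intro conjI ucauchy_minus unullI[OF _ _ unorm_minus_diff], assumption+)

definition minus_univ_cstar :: "('a, 'b) univ_cstar \<Rightarrow> ('a, 'b) univ_cstar \<Rightarrow> ('a, 'b) univ_cstar" where
  "minus_univ_cstar x y = x + (- y)"

lift_definition times_univ_cstar :: "('a, 'b) univ_cstar \<Rightarrow> ('a, 'b) univ_cstar \<Rightarrow> ('a, 'b) univ_cstar"
  is "\<lambda>s t n. s n * t n"
proof -
  fix s s' t t' :: "nat \<Rightarrow> ('a, 'b) free_alg"
  assume s: "urel s s'" and t: "urel t t'"
  obtain K where K: "K \<ge> 0" "\<And>n. unorm (s n) \<le> K" using ucauchy_bounded[OF urelD(1)[OF s]] by blast
  obtain L where L: "L \<ge> 0" "\<And>n. unorm (t' n) \<le> L" using ucauchy_bounded[OF urelD(2)[OF t]] by blast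
  have "(\<lambda>n. unorm (s n * t n - s' n * t' n)) \<longlonglongrightarrow> 0"
  proof (rule unullI[OF urelD(3)[OF t] urelD(3)[OF s]])
    fix n
    show "unorm (s n * t n - s' n * t' n) \<le> K * unorm (t n - t' n) + L * unorm (s n - s' n)"
      using unorm_mult_diff[of "s n" "t n" "s' n" "t' n"] K(2)[of n] L(2)[of n]
      by (smt (verit) mult_right_mono unorm_nonneg)
  qed
  then show "urel (\<lambda>n. s n * t n) (\<lambda>n. s' n * t' n)"
    using urelD[OF s] urelD[OF t] by (simp add: urel_def ucauchy_mult)
qed

lift_definition star_univ_cstar :: "('a, 'b) univ_cstar \<Rightarrow> ('a, 'b) univ_cstar" is "\<lambda>s n. free_star (s n)"
  unfolding urel_def by (auto intro!: ucauchy_intros intro: unullI[OF _ _ unorm_star_diff])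

lift_definition scaleC_univ_cstar :: "complex \<Rightarrow> ('a, 'b) univ_cstar \<Rightarrow> ('a, 'b) univ_cstar"
  is "\<lambda>c s n. free_const c * s n"
proof -
  fix c and s t :: "nat \<Rightarrow> ('a, 'b) free_alg" assume "urel s t"
  note st = urelD[OF this]
  have "(\<lambda>n. unorm (free_const c * s n - free_const c * t n)) \<longlonglongrightarrow> 0"
    by (rule unullI[OF st(3,3), of _ "cmod c" 0])
       (simp add: unorm_const flip: right_diff_distrib)
  with st show "urel (\<lambda>n. free_const c * s n) (\<lambda>n. free_const c * t n)"
    by (simp add: urel_def ucauchy_intros)
qed

lemma minus_univ_cstar_transfer [transfer_rule]:
  "rel_fun (cr_univ_cstar) (rel_fun (cr_univ_cstar) (cr_univ_cstar))
     (\<lambda>s t n. s n - t n) ((-) :: ('a, 'b) univ_cstar \<Rightarrow> _)"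
  unfolding minus_univ_cstar_def diff_conv_add_uminus by transfer_prover

instance
proof
  fix x y z :: "('a, 'b) univ_cstar" and c d :: complex
  show "x + y + z = x + (y + z)" by transfer (auto intro!: urelI ucauchy_intros dest: urelD simp: add_ac)
  show "x + y = y + x" by transfer (auto intro!: urelI ucauchy_intros dest: urelD simp: add_ac)
  show "0 + x = x" by transfer (auto intro!: urelI ucauchy_intros dest: urelD)
  show "- x + x = 0" by transfer (auto intro!: urelI ucauchy_intros dest: urelD)
  show "x - y = x + - y" by (rule minus_univ_cstar_def)
  show "x * y * z = x * (y * z)"
    by transfer (auto intro!: urelI ucauchy_intros dest: urelD simp: mult.assoc)
  show "(x + y) * z = x * z + y * z"
    by transfer (auto intro!: urelI ucauchy_intros dest: urelD simp: distrib_right)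
  show "x * (y + z) = x * y + x * z"
    by transfer (auto intro!: urelI ucauchy_intros dest: urelD simp: distrib_left)
  show "1 * x = x" "x * 1 = x" by (transfer; auto intro!: urelI ucauchy_intros dest: urelD)+
  show "c *\<^sub>C (x + y) = c *\<^sub>C x + c *\<^sub>C y"
    by transfer (auto intro!: urelI ucauchy_intros dest: urelD simp: distrib_left)
  show "(c + d) *\<^sub>C x = c *\<^sub>C x + d *\<^sub>C x"
    by transfer (auto intro!: urelI ucauchy_intros dest: urelD simp: distrib_right single_add)
  show "c *\<^sub>C d *\<^sub>C x = (c * d) *\<^sub>C x"
    by transfer (auto intro!: urelI ucauchy_intros dest: urelD simp: mult_single simp flip: mult.assoc)
  show "1 *\<^sub>C x = x" by transfer (auto intro!: urelI ucauchy_intros dest: urelD)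
  show "c *\<^sub>C x * y = c *\<^sub>C (x * y)"
    by transfer (auto intro!: urelI ucauchy_intros dest: urelD simp: mult.assoc)
  show "x * c *\<^sub>C y = c *\<^sub>C (x * y)"
    by transfer (auto intro!: urelI ucauchy_intros dest: urelD simp: free_const_commute)
  show "star (star x) = x"
    by transfer (auto intro!: urelI ucauchy_intros dest: urelD)
  show "star (x + y) = star x + star y"
    by transfer (auto intro!: urelI ucauchy_intros dest: urelD simp: free_star_add)
  show "star (c *\<^sub>C x) = cnj c *\<^sub>C star x"
    by transfer (auto intro!: urelI ucauchy_intros dest: urelD simp: free_star_const)
  show "star (x * y) = star y * star x"
    by transfer (auto intro!: urelI ucauchy_intros dest: urelD simp: free_star_mult)
qed

end

lemma norm_lim: "ucauchy s \<Longrightarrow> (\<lambda>n. unorm (s n)) \<longlonglongrightarrow> lim (\<lambda>n. unorm (s n))"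
  using ucauchy_convergent by (simp add: convergent_LIMSEQ_iff)

instantiation univ_cstar :: (type, finite) real_normed_vector
begin

definition scaleR_univ_cstar :: "real \<Rightarrow> ('a, 'b) univ_cstar \<Rightarrow> ('a, 'b) univ_cstar" where
  "scaleR_univ_cstar r x = of_real r *\<^sub>C x"

lift_definition norm_univ_cstar :: "('a, 'b) univ_cstar \<Rightarrow> real" is "\<lambda>s. lim (\<lambda>n. unorm (s n))"
proof -
  fix s t :: "nat \<Rightarrow> ('a, 'b) free_alg" assume "urel s t"
  note st = urelD[OF this]
  have le: "lim (\<lambda>n. unorm (s n)) \<le> lim (\<lambda>n. unorm (t n))"
    if "ucauchy s" "ucauchy t" "(\<lambda>n. unorm (s n - t n)) \<longlonglongrightarrow> 0" for s t :: "nat \<Rightarrow> ('a, 'b) free_alg"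
  proof (rule LIMSEQ_le)
    show "(\<lambda>n. unorm (s n)) \<longlonglongrightarrow> lim (\<lambda>n. unorm (s n))"
      using ucauchy_convergent[OF that(1)] by (simp add: convergent_LIMSEQ_iff)
    show "(\<lambda>n. unorm (s n - t n) + unorm (t n)) \<longlonglongrightarrow> lim (\<lambda>n. unorm (t n))"
      using tendsto_add[OF that(3) convergent_LIMSEQ_iff[THEN iffD1, OF ucauchy_convergent[OF that(2)]]]
      by simp
    show "\<exists>N. \<forall>n\<ge>N. unorm (s n) \<le> unorm (s n - t n) + unorm (t n)"
      using unorm_triangle[of "s _" 0 "t _"] unorm_add[of "s _ - t _" "t _"] by auto
  qed
  show "lim (\<lambda>n. unorm (s n)) = lim (\<lambda>n. unorm (t n))"
    by (rule order_antisym; rule le) (use st in \<open>simp_all add: unorm_diff_commute\<close>)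
qed

definition sgn_univ_cstar :: "('a, 'b) univ_cstar \<Rightarrow> ('a, 'b) univ_cstar" where
  "sgn_univ_cstar x = inverse (norm x) *\<^sub>R x"

definition dist_univ_cstar :: "('a, 'b) univ_cstar \<Rightarrow> ('a, 'b) univ_cstar \<Rightarrow> real" where
  "dist_univ_cstar x y = norm (x - y)"

definition uniformity_univ_cstar :: "(('a, 'b) univ_cstar \<times> ('a, 'b) univ_cstar) filter" where
  "uniformity_univ_cstar = (INF e\<in>{0<..}. principal {(x, y). dist x y < e})"

definition open_univ_cstar :: "('a, 'b) univ_cstar set \<Rightarrow> bool" where
  "open_univ_cstar U \<longleftrightarrow> (\<forall>x\<in>U. eventually (\<lambda>(x', y). x' = x \<longrightarrow> y \<in> U) uniformity)"

lemma norm_univ_scaleC: "norm (c *\<^sub>C x) = cmod c * norm (x :: ('a, 'b) univ_cstar)"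
proof (transfer, goal_cases)
  case (1 c s)
  note s = urelD(1)[OF 1]
  show ?case
    unfolding unorm_const by (rule limI) (intro tendsto_mult tendsto_const norm_lim[OF s])
qed

instance
proof
  fix x y :: "('a, 'b) univ_cstar" and r q :: real
  show "r *\<^sub>R (x + y) = r *\<^sub>R x + r *\<^sub>R y"
    by (simp add: scaleR_univ_cstar_def scaleC_add_right)
  show "(r + q) *\<^sub>R x = r *\<^sub>R x + q *\<^sub>R x"
    by (simp add: scaleR_univ_cstar_def scaleC_add_left)
  show "r *\<^sub>R q *\<^sub>R x = (r * q) *\<^sub>R x" "1 *\<^sub>R x = x"
    by (simp_all add: scaleR_univ_cstar_def)
  show "dist x y = norm (x - y)" by (rule dist_univ_cstar_def)
  show "sgn x = inverse (norm x) *\<^sub>R x" by (rule sgn_univ_cstar_def)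
  show "uniformity = (INF e\<in>{0<..}. principal {(x :: ('a, 'b) univ_cstar, y). dist x y < e})"
    by (rule uniformity_univ_cstar_def)
  show "open U \<longleftrightarrow> (\<forall>x\<in>U. eventually (\<lambda>(x', y). x' = x \<longrightarrow> y \<in> U) uniformity)"
    for U :: "('a, 'b) univ_cstar set" by (rule open_univ_cstar_def)
  show "norm (r *\<^sub>R x) = \<bar>r\<bar> * norm x"
    by (simp add: scaleR_univ_cstar_def norm_univ_scaleC)
  show "norm x = 0 \<longleftrightarrow> x = 0"
  proof (transfer, goal_cases)
    case (1 s)
    note s = urelD(1)[OF 1]
    show ?case
    proof
      assume "lim (\<lambda>n. unorm (s n)) = 0"
      with norm_lim[OF s] s show "urel s (\<lambda>_. 0)" by (simp add: urel_def)
    next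
      assume "urel s (\<lambda>_. 0)"
      from urelD(3)[OF this] show "lim (\<lambda>n. unorm (s n)) = 0" by (intro limI) simp
    qed
  qed
  show "norm (x + y) \<le> norm x + norm y"
  proof (transfer, goal_cases)
    case (1 s t)
    note s = urelD(1)[OF 1(1)] and t = urelD(1)[OF 1(2)]
    show ?case
      by (rule LIMSEQ_le[OF norm_lim[OF ucauchy_add[OF s t]] tendsto_add[OF norm_lim[OF s] norm_lim[OF t]]])
         (use unorm_add in auto)
  qed
qed

end

text \<open>The canonical map from the free algebra.\<close>

definition univ_of :: "('x, 'a::finite) free_alg \<Rightarrow> ('x, 'a) univ_cstar" where
  "univ_of z = abs_univ_cstar (\<lambda>_. z)"

lemma univ_of_transfer [transfer_rule]: "rel_fun (=) cr_univ_cstar (\<lambda>z _. z) univ_of"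
  by (auto simp: rel_fun_def cr_univ_cstar_def univ_of_def urelI)

lemma univ_of_add: "univ_of (y + z) = univ_of y + univ_of z"
  by transfer (simp add: urelI)

lemma univ_of_diff: "univ_of (y - z) = univ_of y - univ_of z"
  by transfer (simp add: urelI)

lemma univ_of_mult: "univ_of (y * z) = univ_of y * univ_of z"
  by transfer (simp add: urelI)

lemma univ_of_zero: "univ_of 0 = 0"
  by transfer (simp add: urelI)

lemma univ_of_one: "univ_of 1 = 1"
  by transfer (simp add: urelI)

lemma univ_of_star: "univ_of (free_star z) = star (univ_of z)"
  by transfer (simp add: urelI)

lemma univ_of_const: "univ_of (free_const c * z) = c *\<^sub>C univ_of z"
  by transfer (simp add: urelI)

lemma univ_of_sum: "univ_of (\<Sum>i\<in>I. f i) = (\<Sum>i\<in>I. univ_of (f i))"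
  by (induction I rule: infinite_finite_induct) (simp_all add: univ_of_zero univ_of_add)

lemma norm_univ_of: "norm (univ_of z) = unorm z"
  by transfer simp

lemma norm_diff_univ_of_le:
  assumes s: "ucauchy s" and le: "\<And>n. n \<ge> N \<Longrightarrow> unorm (s n - z) \<le> e"
  shows "norm (abs_univ_cstar s - univ_of z) \<le> e"
proof -
  have u: "ucauchy (\<lambda>n. s n - z)" using s by (intro ucauchy_intros)
  have "abs_univ_cstar s - univ_of z = abs_univ_cstar (\<lambda>n. s n - z)"
    using s unfolding minus_univ_cstar_def
    by (simp add: univ_of_def uminus_univ_cstar.abs_eq plus_univ_cstar.abs_eq urelI ucauchy_intros)
  also have "norm \<dots> = lim (\<lambda>n. unorm (s n - z))"
    by (rule norm_univ_cstar.abs_eq) (simp add: urelI u)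
  also have "\<dots> \<le> e" by (rule LIMSEQ_le_const2[OF norm_lim[OF u]]) (use le in blast)
  finally show ?thesis .
qed

lemma univ_of_dense: "e > 0 \<Longrightarrow> \<exists>z. norm (x - univ_of z) \<le> e"
proof -
  assume e: "e > 0"
  obtain s where s: "x = abs_univ_cstar s" "ucauchy s"
    by (metis Quotient_univ_cstar Quotient_def urelD(1))
  obtain N where "\<And>m. m \<ge> N \<Longrightarrow> unorm (s m - s N) < e"
    using s(2) e unfolding ucauchy_def by (metis order_refl)
  then show ?thesis using norm_diff_univ_of_le[OF s(2), of N "s N"] s(1) less_imp_le by blast
qed

instance univ_cstar :: (type, finite) banach
proof
  fix X :: "nat \<Rightarrow> ('a, 'b) univ_cstar"
  assume X: "Cauchy X"
  have "\<forall>n. \<exists>z. norm (X n - univ_of z) \<le> inverse (real (Suc n))"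
    by (intro allI univ_of_dense) simp
  then obtain z where z: "\<And>n. norm (X n - univ_of (z n)) \<le> inverse (real (Suc n))"
    by metis
  have lim0: "(\<lambda>n. X n - univ_of (z n)) \<longlonglongrightarrow> 0"
    by (rule Lim_null_comparison[OF _ LIMSEQ_inverse_real_of_nat]) (use z in auto)
  have zc: "ucauchy z"
    unfolding ucauchy_def
  proof (intro allI impI)
    fix e :: real assume e: "e > 0"
    obtain M where M: "\<And>m n. m \<ge> M \<Longrightarrow> n \<ge> M \<Longrightarrow> norm (X m - X n) < e / 3"
      using X e unfolding Cauchy_def dist_norm by (meson divide_pos_pos zero_less_numeral)
    obtain N where N: "\<And>n. n \<ge> N \<Longrightarrow> norm (X n - univ_of (z n)) < e / 3"
      using LIMSEQ_D[OF lim0, of "e / 3"] e by auto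
    have "unorm (z m - z n) < e" if "m \<ge> max M N" "n \<ge> max M N" for m n
    proof -
      have "univ_of (z m - z n) =
          (X m - X n) - (X m - univ_of (z m)) + (X n - univ_of (z n))"
        by (simp add: univ_of_diff)
      then have "unorm (z m - z n)
          \<le> norm ((X m - X n) - (X m - univ_of (z m))) + norm (X n - univ_of (z n))"
        by (metis norm_univ_of norm_triangle_ineq)
      also have "\<dots> \<le> norm (X m - X n) + norm (X m - univ_of (z m)) + norm (X n - univ_of (z n))"
        by (intro add_right_mono norm_triangle_ineq4)
      also have "\<dots> < e / 3 + e / 3 + e / 3"
        using that by (intro add_strict_mono M N) auto
      finally show ?thesis by simp
    qed
    then show "\<exists>N. \<forall>m\<ge>N. \<forall>n\<ge>N. unorm (z m - z n) < e" by blast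
  qed
  have "(\<lambda>n. univ_of (z n)) \<longlonglongrightarrow> abs_univ_cstar z"
  proof (rule LIMSEQ_I)
    fix e :: real assume "e > 0"
    then obtain N where N: "\<And>m n. m \<ge> N \<Longrightarrow> n \<ge> N \<Longrightarrow> unorm (z m - z n) < e / 2"
      using zc unfolding ucauchy_def by (meson half_gt_zero)
    have "norm (univ_of (z n) - abs_univ_cstar z) < e" if "n \<ge> N" for n
      using norm_diff_univ_of_le[OF zc, of N "z n" "e / 2"] N[OF _ that] \<open>e > 0\<close>
      by (subst norm_minus_commute) (smt (verit) field_sum_of_halves)
    then show "\<exists>N. \<forall>n\<ge>N. norm (univ_of (z n) - abs_univ_cstar z) < e" by blast
  qed
  from tendsto_add[OF this lim0] show "convergent X" by (auto simp: convergent_def)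
qed

instance univ_cstar :: (type, finite) cstar_algebra
proof
  fix x y :: "('a, 'b) univ_cstar" and c :: complex and r :: real
  show "complex_of_real r *\<^sub>C x = r *\<^sub>R x" by (simp add: scaleR_univ_cstar_def)
  show "norm (c *\<^sub>C x) = cmod c * norm x" by (rule norm_univ_scaleC)
  show "norm (x * y) \<le> norm x * norm y"
  proof (transfer, goal_cases)
    case (1 s t)
    note s = urelD(1)[OF 1(1)] and t = urelD(1)[OF 1(2)]
    show ?case
      by (rule LIMSEQ_le[OF norm_lim[OF ucauchy_mult[OF s t]] tendsto_mult[OF norm_lim[OF s] norm_lim[OF t]]])
         (use unorm_mult in auto)
  qed
  show "norm (star x * x) = (norm x)\<^sup>2"
  proof (transfer, goal_cases)
    case (1 s)
    note s = urelD(1)[OF 1]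
    show ?case unfolding unorm_cstar by (rule limI) (rule tendsto_power[OF norm_lim[OF s]])
  qed
qed

definition univ_proj :: "'x \<Rightarrow> 'a::finite \<Rightarrow> ('x, 'a) univ_cstar" where
  "univ_proj x a = univ_of (free_gen x a)"

lemma projection_univ_proj: "projection (univ_proj x a)"
proof -
  have "norm (univ_of (free_gen x a * free_gen x a - free_gen x a)) = 0"
    by (simp only: norm_univ_of pvm_seminorm_gen[OF pvm_seminorm_unorm])
  then show ?thesis
    by (simp add: projection_def univ_proj_def univ_of_diff univ_of_mult
        free_star_gen flip: univ_of_star)
qed

lemma sum_univ_proj: "(\<Sum>a\<in>UNIV. univ_proj x a) = 1"
proof -
  have "norm (univ_of ((\<Sum>a\<in>UNIV. free_gen x a) - 1)) = 0"
    by (simp only: norm_univ_of pvm_seminorm_sum_gen[OF pvm_seminorm_unorm])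
  then show ?thesis
    by (simp add: univ_proj_def univ_of_diff univ_of_sum univ_of_one)
qed


text \<open>The universal property: any family of projection-valued measures in any C*-algebra is the image
  of the universal one under a unital *-homomorphism.\<close>

definition is_pvm_family :: "('x \<Rightarrow> 'a::finite \<Rightarrow> 'c::star_algebra) \<Rightarrow> bool" where
  "is_pvm_family g \<longleftrightarrow> (\<forall>x a. projection (g x a)) \<and> (\<forall>x. (\<Sum>a\<in>UNIV. g x a) = 1)"

definition free_eval :: "('x \<Rightarrow> 'a \<Rightarrow> 'c::star_algebra) \<Rightarrow> ('x, 'a) free_alg \<Rightarrow> 'c" where
  "free_eval g z = (\<Sum>w\<in>Poly_Mapping.keys z.
     Poly_Mapping.lookup z w *\<^sub>C prod_list (map (\<lambda>(x, a). g x a) (letters w)))"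

lemma free_eval_add: "free_eval g (y + z) = free_eval g y + free_eval g z"
proof -
  let ?W = "Poly_Mapping.keys y \<union> Poly_Mapping.keys z"
  have eval: "free_eval g u = (\<Sum>w\<in>?W. Poly_Mapping.lookup u w *\<^sub>C
      prod_list (map (\<lambda>(x, a). g x a) (letters w)))" if "Poly_Mapping.keys u \<subseteq> ?W" for u
    unfolding free_eval_def
    by (rule sum.mono_neutral_left) (use that in \<open>auto simp: in_keys_iff\<close>)
  show ?thesis
    by (simp add: eval keys_add lookup_add scaleC_add_left sum.distrib)
qed

lemma free_eval_zero [simp]: "free_eval g 0 = 0"
  by (simp add: free_eval_def)

lemma free_eval_single [simp]: "free_eval g (Poly_Mapping.single w c) =
    c *\<^sub>C prod_list (map (\<lambda>(x, a). g x a) (letters w))"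
  by (simp add: free_eval_def)

lemma free_eval_mult: "free_eval g (y * z) = free_eval g y * free_eval g z"
proof (induction y rule: poly_mapping_induct')
  case (single v c)
  show ?case
    by (induction z rule: poly_mapping_induct')
       (simp_all add: free_eval_add mult_single plus_fword_def distrib_left mult.commute[of c])
qed (simp_all add: free_eval_add distrib_right)

lemma free_eval_const: "free_eval g (free_const c * z) = c *\<^sub>C free_eval g z"
  by (simp add: free_eval_mult zero_fword_def)

lemma free_eval_diff: "free_eval g (y - z) = free_eval g y - free_eval g z"
  using free_eval_add[of g "y - z" z] by simp

lemma free_eval_one: "free_eval g 1 = 1"
  using free_eval_single[of g 0 1] by (simp add: zero_fword_def flip: single_one)

lemma free_eval_gen: "free_eval g (free_gen x a) = g x a"
  by (simp add: free_gen_def)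

lemma free_eval_sum: "free_eval g (\<Sum>i\<in>I. f i) = (\<Sum>i\<in>I. free_eval g (f i))"
  by (induction I rule: infinite_finite_induct) (simp_all add: free_eval_add)

lemma free_eval_star:
  assumes "is_pvm_family g"
  shows "free_eval g (free_star z) = star (free_eval g z)"
proof (induction z rule: poly_mapping_induct')
  case (single w c)
  have "prod_list (map (\<lambda>(x, a). g x a) (rev ls)) = star (prod_list (map (\<lambda>(x, a). g x a) ls))" for ls
    using assms
    by (induction ls) (auto simp: star_mult is_pvm_family_def projection_def)
  then show ?case by (simp add: free_star_single word_rev_def star_scaleC)
qed (simp_all add: free_star_add free_eval_add star_add)

lemma norm_free_eval_le:
  fixes g :: "'x \<Rightarrow> 'a::finite \<Rightarrow> 'c::cstar_algebra"
  assumes "is_pvm_family g"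
  shows "norm (free_eval g z) \<le> unorm z"
proof (rule pvm_seminorm_le_unorm)
  show "pvm_seminorm (\<lambda>z. norm (free_eval g z))"
    using assms
    by (simp add: pvm_seminorm_def free_eval_add free_eval_const free_eval_mult free_eval_diff
        free_eval_star free_eval_gen free_eval_sum free_eval_one norm_triangle_ineq norm_scaleC
        norm_mult_le norm_star_mult is_pvm_family_def projection_def zero_fword_def)
qed

lemma free_eval_convergent:
  fixes g :: "'x \<Rightarrow> 'a::finite \<Rightarrow> 'c::cstar_algebra"
  assumes g: "is_pvm_family g" and s: "ucauchy s"
  shows "(\<lambda>n. free_eval g (s n)) \<longlonglongrightarrow> lim (\<lambda>n. free_eval g (s n))"
proof -
  have "norm (free_eval g (s m) - free_eval g (s n)) \<le> unorm (s m - s n)" for m n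
    using norm_free_eval_le[OF g, of "s m - s n"] by (simp add: free_eval_diff)
  then have "Cauchy (\<lambda>n. free_eval g (s n))"
    using s unfolding Cauchy_def ucauchy_def dist_norm by (meson le_less_trans)
  then show ?thesis by (simp add: Cauchy_convergent_iff convergent_LIMSEQ_iff)
qed

lift_definition univ_hom :: "('x \<Rightarrow> 'a::finite \<Rightarrow> 'c::cstar_algebra) \<Rightarrow> ('x, 'a) univ_cstar \<Rightarrow> 'c"
  is "\<lambda>g s. if is_pvm_family g then lim (\<lambda>n. free_eval g (s n)) else 0"
proof -
  fix g :: "'x \<Rightarrow> 'a \<Rightarrow> 'c" and s t :: "nat \<Rightarrow> ('x, 'a) free_alg"
  assume st: "urel s t"
  have "lim (\<lambda>n. free_eval g (s n)) = lim (\<lambda>n. free_eval g (t n))" if g: "is_pvm_family g"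
  proof (rule LIMSEQ_unique[OF free_eval_convergent[OF g urelD(1)[OF st]]])
    have "(\<lambda>n. free_eval g (s n - t n)) \<longlonglongrightarrow> 0"
      by (rule Lim_null_comparison[OF _ urelD(3)[OF st]])
         (rule always_eventually, rule allI, rule norm_free_eval_le[OF g])
    from tendsto_add[OF this free_eval_convergent[OF g urelD(2)[OF st]]]
    show "(\<lambda>n. free_eval g (s n)) \<longlonglongrightarrow> lim (\<lambda>n. free_eval g (t n))"
      by (simp add: free_eval_diff)
  qed
  then show "(if is_pvm_family g then lim (\<lambda>n. free_eval g (s n)) else 0) =
      (if is_pvm_family g then lim (\<lambda>n. free_eval g (t n)) else 0)" by simp
qed

lemma norm_star: "norm (star x) = norm (x :: 'c::cstar_algebra)"
proof -
  have "norm y \<le> norm (star y)" for y :: 'c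
  proof (cases "norm y = 0")
    case False
    have "norm y * norm y \<le> norm (star y) * norm y"
      using norm_star_mult[of y] norm_mult_le[of "star y" y] by (simp add: power2_eq_square)
    then show ?thesis using False by simp
  qed simp
  from this[of x] this[of "star x"] show ?thesis by simp
qed

lemma univ_hom_univ_proj: "is_pvm_family g \<Longrightarrow> univ_hom g (univ_proj x a) = g x a"
  unfolding univ_proj_def by transfer (simp add: free_eval_gen)

lemma univ_hom_one: "is_pvm_family g \<Longrightarrow> univ_hom g 1 = 1"
  by transfer (simp add: free_eval_one)

lemma star_hom_univ_hom:
  fixes g :: "'x \<Rightarrow> 'a::finite \<Rightarrow> 'c::cstar_algebra"
  assumes g: "is_pvm_family g"
  shows "star_hom (univ_hom g)"
  unfolding star_hom_def
proof (intro conjI allI)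
  fix x y :: "('x, 'a) univ_cstar" and c :: complex
  show "univ_hom g (x + y) = univ_hom g x + univ_hom g y"
    using g
  proof (transfer, goal_cases)
    case (1 g s t)
    then show ?case
      by (simp add: free_eval_add) (intro limI tendsto_add free_eval_convergent urelD(1))
  qed
  show "univ_hom g (x * y) = univ_hom g x * univ_hom g y"
    using g
  proof (transfer, goal_cases)
    case (1 g s t)
    then show ?case
      by (simp add: free_eval_mult) (intro limI tendsto_mult free_eval_convergent urelD(1))
  qed
  show "univ_hom g (c *\<^sub>C x) = c *\<^sub>C univ_hom g x"
    using g
  proof (transfer, goal_cases)
    case (1 g c s)
    note s = free_eval_convergent[OF 1(1) urelD(1)[OF 1(2)]]
    have "(\<lambda>n. c *\<^sub>C free_eval g (s n)) \<longlonglongrightarrow> c *\<^sub>C lim (\<lambda>n. free_eval g (s n))"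
      using tendsto_mult[OF tendsto_const[of "c *\<^sub>C 1"] s] by simp
    then show ?case using 1(1) by (simp add: free_eval_const limI)
  qed
  show "univ_hom g (star x) = star (univ_hom g x)"
    using g
  proof (transfer, goal_cases)
    case (1 g s)
    note s = free_eval_convergent[OF 1(1) urelD(1)[OF 1(2)]]
    let ?L = "lim (\<lambda>n. free_eval g (s n))"
    have diff: "star a - star b = star (a - b)" for a b :: 'c
      using star_add[of a "- b"] by (simp add: star_minus)
    have "(\<lambda>n. norm (star (free_eval g (s n)) - star ?L)) \<longlonglongrightarrow> 0"
      unfolding diff norm_star using s by (simp add: tendsto_norm_zero LIM_zero)
    then have "(\<lambda>n. star (free_eval g (s n))) \<longlonglongrightarrow> star ?L"
      by (simp add: tendsto_norm_zero_iff LIM_zero_iff)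
    then show ?case using 1(1) by (simp add: free_eval_star limI)
  qed
qed


section \<open>The algebra generated by the projections\<close>

inductive_set generated_subalgebra :: "'a::star_algebra set \<Rightarrow> 'a set" for G where
  base: "x \<in> G \<Longrightarrow> x \<in> generated_subalgebra G"
| one: "1 \<in> generated_subalgebra G"
| add: "x \<in> generated_subalgebra G \<Longrightarrow> y \<in> generated_subalgebra G \<Longrightarrow> x + y \<in> generated_subalgebra G"
| mult: "x \<in> generated_subalgebra G \<Longrightarrow> y \<in> generated_subalgebra G \<Longrightarrow> x * y \<in> generated_subalgebra G"
| scaleC: "x \<in> generated_subalgebra G \<Longrightarrow> c *\<^sub>C x \<in> generated_subalgebra G"

lemma generated_subalgebra_zero: "0 \<in> generated_subalgebra G"
  using generated_subalgebra.scaleC[OF generated_subalgebra.one, of 0] by simp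

lemma generated_subalgebra_minus: "x \<in> generated_subalgebra G \<Longrightarrow> - x \<in> generated_subalgebra G"
  using generated_subalgebra.scaleC[of x G "-1"] by simp

lemma generated_subalgebra_diff:
  "x \<in> generated_subalgebra G \<Longrightarrow> y \<in> generated_subalgebra G \<Longrightarrow> x - y \<in> generated_subalgebra G"
  using generated_subalgebra.add[OF _ generated_subalgebra_minus, of x G y] by simp

lemma generated_subalgebra_star:
  assumes "\<And>g. g \<in> G \<Longrightarrow> star g = g" and "x \<in> generated_subalgebra G"
  shows "star x \<in> generated_subalgebra G"
  using assms(2)
  by induction (auto simp: assms(1) star_add star_mult star_scaleC intro: generated_subalgebra.intros)

typedef ('x, 'a) proj_alg =
  "generated_subalgebra {univ_proj x a | (x :: 'x) (a :: 'a::finite). True}"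
  by (rule exI, rule generated_subalgebra.one)

setup_lifting type_definition_proj_alg

instantiation proj_alg :: (type, finite) star_algebra
begin

lift_definition zero_proj_alg :: "('a, 'b) proj_alg" is 0 by (rule generated_subalgebra_zero)
lift_definition one_proj_alg :: "('a, 'b) proj_alg" is 1 by (rule generated_subalgebra.one)
lift_definition plus_proj_alg :: "('a, 'b) proj_alg \<Rightarrow> ('a, 'b) proj_alg \<Rightarrow> ('a, 'b) proj_alg"
  is "(+)" by (rule generated_subalgebra.add)
lift_definition minus_proj_alg :: "('a, 'b) proj_alg \<Rightarrow> ('a, 'b) proj_alg \<Rightarrow> ('a, 'b) proj_alg"
  is "(-)" by (rule generated_subalgebra_diff)
lift_definition uminus_proj_alg :: "('a, 'b) proj_alg \<Rightarrow> ('a, 'b) proj_alg"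
  is uminus by (rule generated_subalgebra_minus)
lift_definition times_proj_alg :: "('a, 'b) proj_alg \<Rightarrow> ('a, 'b) proj_alg \<Rightarrow> ('a, 'b) proj_alg"
  is "(*)" by (rule generated_subalgebra.mult)
lift_definition scaleC_proj_alg :: "complex \<Rightarrow> ('a, 'b) proj_alg \<Rightarrow> ('a, 'b) proj_alg"
  is "(*\<^sub>C)" by (rule generated_subalgebra.scaleC)
lift_definition star_proj_alg :: "('a, 'b) proj_alg \<Rightarrow> ('a, 'b) proj_alg" is star
  by (rule generated_subalgebra_star) (auto simp: projection_univ_proj[unfolded projection_def])

instance
  by standard
     (transfer; simp add: algebra_simps scaleC_add_left scaleC_add_right star_add star_mult star_scaleC)+

end

lift_definition proj_gen :: "'x \<Rightarrow> 'a::finite \<Rightarrow> ('x, 'a) proj_alg" is univ_proj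
  by (auto intro: generated_subalgebra.base)


section \<open>The algebraic tensor product of *-algebras\<close>

text \<open>Tensors are formal sums of elementary tensors, represented as lists of pairs, modulo the
  congruence generated by bilinearity.\<close>

inductive tensor_eq ::
  "('u::star_algebra \<times> 'v::star_algebra) list \<Rightarrow> ('u \<times> 'v) list \<Rightarrow> bool" where
  refl: "tensor_eq xs xs"
| sym: "tensor_eq xs ys \<Longrightarrow> tensor_eq ys xs"
| trans: "tensor_eq xs ys \<Longrightarrow> tensor_eq ys zs \<Longrightarrow> tensor_eq xs zs"
| append: "tensor_eq xs xs' \<Longrightarrow> tensor_eq ys ys' \<Longrightarrow> tensor_eq (xs @ ys) (xs' @ ys')"
| commute: "tensor_eq (xs @ ys) (ys @ xs)"
| zero: "tensor_eq [(0, v)] []"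
| add_left: "tensor_eq [(u + u', v)] [(u, v), (u', v)]"
| add_right: "tensor_eq [(u, v + v')] [(u, v), (u, v')]"
| scale: "tensor_eq [(c *\<^sub>C u, v)] [(u, c *\<^sub>C v)]"

definition tensor_mult_list ::
  "('u::star_algebra \<times> 'v::star_algebra) list \<Rightarrow> ('u \<times> 'v) list \<Rightarrow> ('u \<times> 'v) list" where
  "tensor_mult_list xs ys = map (\<lambda>((a, b), (c, d)). (a * c, b * d)) (List.product xs ys)"

lemma tensor_mult_list_simps [simp]:
  "tensor_mult_list [] ys = []"
  "tensor_mult_list (x # xs) ys =
     map (\<lambda>y. (fst x * fst y, snd x * snd y)) ys @ tensor_mult_list xs ys"
  by (auto simp: tensor_mult_list_def split_beta)

lemma tensor_mult_list_append [simp]: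
  "tensor_mult_list (xs @ ys) zs = tensor_mult_list xs zs @ tensor_mult_list ys zs"
  by (induction xs) auto

lemma tensor_eq_mset: "mset xs = mset ys \<Longrightarrow> tensor_eq xs ys"
proof (induction xs arbitrary: ys)
  case (Cons x xs)
  then have "x \<in> set ys" by (metis list.set_intros(1) set_mset_mset)
  then obtain l r where ys: "ys = l @ x # r" by (meson split_list)
  with Cons have "tensor_eq xs (l @ r)" by simp
  from tensor_eq.append[OF tensor_eq.refl[of "[x]"] this]
  have "tensor_eq (x # xs) (([x] @ l) @ r)" by simp
  moreover have "tensor_eq (([x] @ l) @ r) ((l @ [x]) @ r)"
    by (intro tensor_eq.append tensor_eq.commute tensor_eq.refl)
  ultimately show ?case using tensor_eq.trans ys by fastforce
qed (simp add: tensor_eq.refl)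

lemma tensor_eq_Cons: "tensor_eq [x] zs \<Longrightarrow> tensor_eq xs ys \<Longrightarrow> tensor_eq (x # xs) (zs @ ys)"
  using tensor_eq.append[of "[x]" zs xs ys] by simp

lemma tensor_eq_map2:
  assumes "\<And>x. tensor_eq [f x] [g x, h x]"
  shows "tensor_eq (map f xs) (map g xs @ map h xs)"
proof (induction xs)
  case (Cons x xs)
  have "tensor_eq (map f (x # xs)) ([g x, h x] @ (map g xs @ map h xs))"
    using tensor_eq_Cons[OF assms Cons] by simp
  moreover have "tensor_eq \<dots> (map g (x # xs) @ map h (x # xs))"
    by (rule tensor_eq_mset) simp
  ultimately show ?case by (rule tensor_eq.trans)
qed (simp add: tensor_eq.refl)

lemma tensor_eq_map1:
  assumes "\<And>x. tensor_eq [f x] [g x]"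
  shows "tensor_eq (map f xs) (map g xs)"
proof (induction xs)
  case (Cons x xs)
  then show ?case using tensor_eq_Cons[OF assms Cons] by simp
qed (simp add: tensor_eq.refl)

lemma tensor_eq_map0:
  assumes "\<And>x. tensor_eq [f x] []"
  shows "tensor_eq (map f xs) []"
proof (induction xs)
  case (Cons x xs)
  then show ?case using tensor_eq_Cons[OF assms Cons] by simp
qed (simp add: tensor_eq.refl)

lemma mset_tensor_mult_list_Cons:
  "mset (tensor_mult_list xs (y # ys)) =
     mset (map (\<lambda>x. (fst x * fst y, snd x * snd y)) xs @ tensor_mult_list xs ys)"
  by (induction xs) auto

lemma mset_tensor_mult_list_append:
  "mset (tensor_mult_list xs (ys @ zs)) = mset (tensor_mult_list xs ys @ tensor_mult_list xs zs)"
  by (induction xs) auto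

lemma tensor_eq_mult_left: "tensor_eq xs xs' \<Longrightarrow> tensor_eq (tensor_mult_list xs ys) (tensor_mult_list xs' ys)"
proof (induction rule: tensor_eq.induct)
  case (zero v)
  show ?case using tensor_eq_map0[of "\<lambda>y. (0, v * snd y)" ys] by (simp add: tensor_eq.zero)
next
  case (add_left u u' v)
  show ?case by (simp add: tensor_eq_map2 distrib_right tensor_eq.add_left)
next
  case (add_right u v v')
  show ?case by (simp add: tensor_eq_map2 distrib_right tensor_eq.add_right)
next
  case (scale c u v)
  show ?case by (simp add: tensor_eq_map1 tensor_eq.scale)
qed (auto intro: tensor_eq.intros)

lemma tensor_eq_mult_right: "tensor_eq ys ys' \<Longrightarrow> tensor_eq (tensor_mult_list xs ys) (tensor_mult_list xs ys')"
proof (induction rule: tensor_eq.induct)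
  case (append ys ys' zs zs')
  have "tensor_eq (tensor_mult_list xs (ys @ zs)) (tensor_mult_list xs ys @ tensor_mult_list xs zs)"
    by (rule tensor_eq_mset) (rule mset_tensor_mult_list_append)
  moreover have "tensor_eq \<dots> (tensor_mult_list xs ys' @ tensor_mult_list xs zs')"
    by (rule tensor_eq.append[OF append.IH])
  moreover have "tensor_eq \<dots> (tensor_mult_list xs (ys' @ zs'))"
    by (rule tensor_eq_mset) (simp only: mset_tensor_mult_list_append)
  ultimately show ?case by (meson tensor_eq.trans)
next
  case (commute ys zs)
  show ?case
    by (rule tensor_eq_mset) (simp add: mset_tensor_mult_list_append add.commute)
next
  case (zero v)
  have "tensor_mult_list xs [] = []" by (induction xs) auto
  moreover have "tensor_mult_list xs [(0, v)] = map (\<lambda>x. (0, snd x * v)) xs"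
    by (induction xs) auto
  ultimately show ?case by (simp add: tensor_eq_map0 tensor_eq.zero)
next
  case (add_left u u' v)
  have *: "tensor_mult_list xs [(u, v)] = map (\<lambda>x. (fst x * u, snd x * v)) xs" for u v
    by (induction xs) auto
  have "tensor_eq (tensor_mult_list xs [(u + u', v)])
      (tensor_mult_list xs [(u, v)] @ tensor_mult_list xs [(u', v)])"
    unfolding * by (rule tensor_eq_map2) (simp add: distrib_left tensor_eq.add_left)
  moreover have "tensor_eq \<dots> (tensor_mult_list xs [(u, v), (u', v)])"
    using mset_tensor_mult_list_append[of xs "[(u, v)]" "[(u', v)]"] by (intro tensor_eq_mset) simp
  ultimately show ?case by (rule tensor_eq.trans)
next
  case (add_right u v v')
  have *: "tensor_mult_list xs [(u, v)] = map (\<lambda>x. (fst x * u, snd x * v)) xs" for u v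
    by (induction xs) auto
  have "tensor_eq (tensor_mult_list xs [(u, v + v')])
      (tensor_mult_list xs [(u, v)] @ tensor_mult_list xs [(u, v')])"
    unfolding * by (rule tensor_eq_map2) (simp add: distrib_left tensor_eq.add_right)
  moreover have "tensor_eq \<dots> (tensor_mult_list xs [(u, v), (u, v')])"
    using mset_tensor_mult_list_append[of xs "[(u, v)]" "[(u, v')]"] by (intro tensor_eq_mset) simp
  ultimately show ?case by (rule tensor_eq.trans)
next
  case (scale c u v)
  have *: "tensor_mult_list xs [(u, v)] = map (\<lambda>x. (fst x * u, snd x * v)) xs" for u v
    by (induction xs) auto
  show ?case unfolding * by (rule tensor_eq_map1) (simp add: tensor_eq.scale)
qed (auto intro: tensor_eq.intros)

lemma tensor_eq_map:
  assumes "tensor_eq xs ys"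
    and "\<And>v. tensor_eq [f (0, v)] []"
    and "\<And>u u' v. tensor_eq [f (u + u', v)] [f (u, v), f (u', v)]"
    and "\<And>u v v'. tensor_eq [f (u, v + v')] [f (u, v), f (u, v')]"
    and "\<And>c u v. tensor_eq [f (c *\<^sub>C u, v)] [f (u, c *\<^sub>C v)]"
  shows "tensor_eq (map f xs) (map f ys)"
  using assms(1) by induction (auto intro: tensor_eq.intros assms(2-))

lemma equivp_tensor_eq: "equivp tensor_eq"
  by (rule equivpI) (auto intro!: reflpI sympI transpI intro: tensor_eq.intros)

quotient_type (overloaded) ('u, 'v) alg_tensor = "('u::star_algebra \<times> 'v::star_algebra) list" / tensor_eq
  by (rule equivp_tensor_eq)

instantiation alg_tensor :: (star_algebra, star_algebra) star_algebra
begin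

lift_definition zero_alg_tensor :: "('a, 'b) alg_tensor" is "[]" .

lift_definition one_alg_tensor :: "('a, 'b) alg_tensor" is "[(1, 1)]" .

lift_definition plus_alg_tensor :: "('a, 'b) alg_tensor \<Rightarrow> ('a, 'b) alg_tensor \<Rightarrow> ('a, 'b) alg_tensor"
  is "(@)" by (rule tensor_eq.append)

lift_definition scaleC_alg_tensor :: "complex \<Rightarrow> ('a, 'b) alg_tensor \<Rightarrow> ('a, 'b) alg_tensor"
  is "\<lambda>c. map (\<lambda>(u, v). (c *\<^sub>C u, v))"
proof (erule tensor_eq_map, goal_cases)
  case (4 c xs ys d u v)
  then show ?case using tensor_eq.scale[of d "c *\<^sub>C u" v] by (simp add: mult.commute)
qed (auto simp: scaleC_add_right intro: tensor_eq.intros)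

definition uminus_alg_tensor :: "('a, 'b) alg_tensor \<Rightarrow> ('a, 'b) alg_tensor" where
  "uminus_alg_tensor t = (-1) *\<^sub>C t"

definition minus_alg_tensor :: "('a, 'b) alg_tensor \<Rightarrow> ('a, 'b) alg_tensor \<Rightarrow> ('a, 'b) alg_tensor" where
  "minus_alg_tensor s t = s + - t"

lift_definition times_alg_tensor :: "('a, 'b) alg_tensor \<Rightarrow> ('a, 'b) alg_tensor \<Rightarrow> ('a, 'b) alg_tensor"
  is tensor_mult_list by (meson tensor_eq_mult_left tensor_eq_mult_right tensor_eq.trans)

lift_definition star_alg_tensor :: "('a, 'b) alg_tensor \<Rightarrow> ('a, 'b) alg_tensor"
  is "map (\<lambda>(u, v). (star u, star v))"
  by (erule tensor_eq_map) (auto simp: star_add star_scaleC intro: tensor_eq.intros)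

instance
proof
  fix s t r :: "('a, 'b) alg_tensor" and c d :: complex
  show "s + t + r = s + (t + r)" by transfer (simp add: tensor_eq.refl)
  show "s + t = t + s" by transfer (rule tensor_eq.commute)
  show "0 + t = t" by transfer (simp add: tensor_eq.refl)
  have add: "(c + d) *\<^sub>C t = c *\<^sub>C t + d *\<^sub>C t" for c d and t :: "('a, 'b) alg_tensor"
    by transfer (rule tensor_eq_map2, auto simp: scaleC_add_left intro: tensor_eq.intros)
  then show "(c + d) *\<^sub>C t = c *\<^sub>C t + d *\<^sub>C t" .
  have one: "1 *\<^sub>C t = t" for t :: "('a, 'b) alg_tensor"
    by transfer (simp add: tensor_eq.refl)
  then show "1 *\<^sub>C t = t" .
  have zero: "0 *\<^sub>C t = 0" for t :: "('a, 'b) alg_tensor"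
    by transfer (rule tensor_eq_map0, auto intro: tensor_eq.intros)
  show "- t + t = 0"
    using add[of "-1" 1 t] one[of t] zero[of t] by (simp add: uminus_alg_tensor_def)
  show "s - t = s + - t" by (rule minus_alg_tensor_def)
  show "c *\<^sub>C (s + t) = c *\<^sub>C s + c *\<^sub>C t" by transfer (simp add: tensor_eq.refl)
  show "c *\<^sub>C d *\<^sub>C t = (c * d) *\<^sub>C t" by transfer (simp add: tensor_eq.refl case_prod_unfold comp_def)
  show "s * t * r = s * (t * r)"
  proof (transfer, goal_cases)
    case (1 s t r)
    have *: "tensor_mult_list (map (\<lambda>y. (a * fst y, b * snd y)) t) r =
        map (\<lambda>y. (a * fst y, b * snd y)) (tensor_mult_list t r)" for a b
      by (induction t) (auto simp: mult.assoc)
    have "tensor_mult_list (tensor_mult_list s t) r = tensor_mult_list s (tensor_mult_list t r)"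
      by (induction s) (auto simp: *)
    then show ?case by (simp add: tensor_eq.refl)
  qed
  show "(s + t) * r = s * r + t * r" by transfer (simp add: tensor_eq.refl)
  show "s * (t + r) = s * t + s * r"
    by transfer (rule tensor_eq_mset, rule mset_tensor_mult_list_append)
  show "1 * t = t" by transfer (simp add: tensor_eq.refl)
  show "t * 1 = t"
  proof (transfer, goal_cases)
    case (1 t)
    have "tensor_mult_list t [(1, 1)] = t" by (induction t) auto
    then show ?case by (simp add: tensor_eq.refl)
  qed
  show "c *\<^sub>C s * t = c *\<^sub>C (s * t)"
  proof (transfer, goal_cases)
    case (1 c s t)
    have "tensor_mult_list (map (\<lambda>(u, v). (c *\<^sub>C u, v)) s) t =
        map (\<lambda>(u, v). (c *\<^sub>C u, v)) (tensor_mult_list s t)"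
      by (induction s) auto
    then show ?case by (simp add: tensor_eq.refl)
  qed
  show "s * c *\<^sub>C t = c *\<^sub>C (s * t)"
  proof (transfer, goal_cases)
    case (1 s c t)
    have "tensor_mult_list s (map (\<lambda>(u, v). (c *\<^sub>C u, v)) t) =
        map (\<lambda>(u, v). (c *\<^sub>C u, v)) (tensor_mult_list s t)"
      by (induction s) auto
    then show ?case by (simp add: tensor_eq.refl)
  qed
  show "star (star t) = t" by transfer (simp add: tensor_eq.refl case_prod_unfold comp_def)
  show "star (s + t) = star s + star t" by transfer (simp add: tensor_eq.refl)
  show "star (c *\<^sub>C t) = cnj c *\<^sub>C star t"
    by transfer (simp add: tensor_eq.refl case_prod_unfold comp_def star_scaleC)
  show "star (s * t) = star t * star s"
  proof (transfer, rule tensor_eq_mset, goal_cases)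
    case (1 s t)
    show ?case
    proof (induction s)
      case Nil
      show ?case by (induction t) auto
    next
      case (Cons x s)
      then show ?case
        by (simp add: mset_tensor_mult_list_Cons star_mult case_prod_unfold comp_def)
    qed
  qed
qed

end

lift_definition elementary_tensor ::
  "'u::star_algebra \<Rightarrow> 'v::star_algebra \<Rightarrow> ('u, 'v) alg_tensor" (infixr \<open>\<otimes>\<close> 70)
  is "\<lambda>u v. [(u, v)]" .


section \<open>Non-local games and correlations\<close>

text \<open>The finite question and answer sets are finite types, and \<open>\<mu>\<close> is the scoring function.
  \<open>p x y a b\<close> stands for \<open>p(a, b | x, y)\<close>.\<close>

definition nonlocal_game ::
  "('x::finite \<Rightarrow> 'y::finite \<Rightarrow> 'a::finite \<Rightarrow> 'b::finite \<Rightarrow> nat) \<Rightarrow> bool" where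
  "nonlocal_game \<mu> \<longleftrightarrow> (\<forall>x y a b. \<mu> x y a b \<in> {0, 1})"

definition imitation_game ::
  "('x::finite \<Rightarrow> 'y::finite \<Rightarrow> 'a::finite \<Rightarrow> 'b::finite \<Rightarrow> nat) \<Rightarrow> bool" where
  "imitation_game \<mu> \<longleftrightarrow> nonlocal_game \<mu> \<and>
     (\<forall>x a a'. a \<noteq> a' \<longrightarrow> (\<exists>y. (\<Sum>b\<in>UNIV. \<mu> x y a b * \<mu> x y a' b) = 0)) \<and>
     (\<forall>y b b'. b \<noteq> b' \<longrightarrow> (\<exists>x. (\<Sum>a\<in>UNIV. \<mu> x y a b * \<mu> x y a b') = 0))"

definition C_ns :: "('x::finite \<Rightarrow> 'y::finite \<Rightarrow> 'a::finite \<Rightarrow> 'b::finite \<Rightarrow> real) set" where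
  "C_ns = {p. (\<forall>x y a b. 0 \<le> p x y a b \<and> p x y a b \<le> 1) \<and>
     (\<forall>x y y' a. (\<Sum>b\<in>UNIV. p x y a b) = (\<Sum>b\<in>UNIV. p x y' a b)) \<and>
     (\<forall>x x' y b. (\<Sum>a\<in>UNIV. p x y a b) = (\<Sum>a\<in>UNIV. p x' y a b)) \<and>
     (\<forall>x y. (\<Sum>(a, b)\<in>UNIV. p x y a b) = 1)}"

definition C_ns_game ::
  "('x::finite \<Rightarrow> 'y::finite \<Rightarrow> 'a::finite \<Rightarrow> 'b::finite \<Rightarrow> nat) \<Rightarrow> ('x \<Rightarrow> 'y \<Rightarrow> 'a \<Rightarrow> 'b \<Rightarrow> real) set" where
  "C_ns_game \<mu> = {p \<in> C_ns. \<forall>x y a b. \<mu> x y a b = 0 \<longrightarrow> p x y a b = 0}"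

text \<open>Up to unitary equivalence, the finite-dimensional Hilbert spaces are the spaces \<open>\<complex>\<^sup>n\<close>, whose
  operators are \<open>n \<times> n\<close> matrices with indices below \<open>n\<close>.  Vectors of \<open>\<complex>\<^sup>n \<otimes> \<complex>\<^sup>m\<close> are then functions on
  pairs of indices, and \<open>P \<otimes> Q\<close> has the entries \<open>P i k * Q j l\<close>.\<close>

type_synonym cmat = "nat \<Rightarrow> nat \<Rightarrow> complex"

definition mat_projection :: "nat \<Rightarrow> cmat \<Rightarrow> bool" where
  "mat_projection n P \<longleftrightarrow> (\<forall>i<n. \<forall>j<n. cnj (P j i) = P i j) \<and>
     (\<forall>i<n. \<forall>j<n. (\<Sum>k<n. P i k * P k j) = P i j)"

definition mat_pvm :: "nat \<Rightarrow> ('a::finite \<Rightarrow> cmat) \<Rightarrow> bool" where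
  "mat_pvm n P \<longleftrightarrow> (\<forall>a. mat_projection n (P a)) \<and>
     (\<forall>i<n. \<forall>j<n. (\<Sum>a\<in>UNIV. P a i j) = (if i = j then 1 else 0))"

definition tensor_expectation :: "nat \<Rightarrow> nat \<Rightarrow> (nat \<Rightarrow> nat \<Rightarrow> complex) \<Rightarrow> cmat \<Rightarrow> cmat \<Rightarrow> complex" where
  "tensor_expectation n m \<psi> P Q =
     (\<Sum>i<n. \<Sum>j<m. cnj (\<psi> i j) * (\<Sum>k<n. \<Sum>l<m. P i k * Q j l * \<psi> k l))"

definition C_q :: "('x::finite \<Rightarrow> 'y::finite \<Rightarrow> 'a::finite \<Rightarrow> 'b::finite \<Rightarrow> real) set" where
  "C_q = {p \<in> C_ns. \<exists>n m \<psi> P Q.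
     (\<Sum>i<n. \<Sum>j<m. (cmod (\<psi> i j))\<^sup>2) = 1 \<and> (\<forall>x. mat_pvm n (P x)) \<and> (\<forall>y. mat_pvm m (Q y)) \<and>
     (\<forall>x y a b. complex_of_real (p x y a b) = tensor_expectation n m \<psi> (P x a) (Q y b))}"

text \<open>On functions between finite types, the library's product topology is the Euclidean one.\<close>

definition C_qa :: "('x::finite \<Rightarrow> 'y::finite \<Rightarrow> 'a::finite \<Rightarrow> 'b::finite \<Rightarrow> real) set" where
  "C_qa = closure C_q"

definition C_qa_game ::
  "('x::finite \<Rightarrow> 'y::finite \<Rightarrow> 'a::finite \<Rightarrow> 'b::finite \<Rightarrow> nat) \<Rightarrow> ('x \<Rightarrow> 'y \<Rightarrow> 'a \<Rightarrow> 'b \<Rightarrow> real) set" where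
  "C_qa_game \<mu> = C_ns_game \<mu> \<inter> C_qa"

end

theory Submission
  imports Defs
begin

text \<open>Amenability provides a state \<open>\<omega>\<close> on all bounded operators of \<open>H\<close> that extends \<open>\<tau>\<close> and is
invariant under the unitaries of \<open>U\<close>.  The images of the generators are, up to a correction of one
outcome, projection-valued measures \<open>E x a = \<rho> (e \<otimes> 1)\<close> and \<open>F y b = \<rho> (1 \<otimes> f)\<close> in \<open>U\<close>, and
\<open>p(a, b | x, y) = \<omega> (E x a * F y b)\<close>.  Invariance gives \<open>\<omega> (F y b * T) = \<omega> (T * F y b)\<close> for every bounded
\<open>T\<close>, hence \<open>\<phi> y b T = \<omega> (T * F y b) = \<omega> (F y b * T * F y b)\<close> is a positive functional on all bounded
operators.  For each \<open>y\<close> the sum of these over \<open>b\<close> is \<open>\<omega>\<close>.  So Bob's measurements split one state \<open>\<omega>\<close>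
in several ways, and \<open>p\<close> is obtained by evaluating the pieces at Alice's projections.

If \<open>\<omega>\<close> were given by a density operator of finite rank, \<open>p\<close> would be a quantum correlation: different
decompositions of one density operator are realised by measurements on a purification.  This is
\<open>ensemble_correlation_in_C_q\<close>; it rests on the fact that vector families with the same Gram matrix
are related by a unitary (\<open>unitary_of_equal_gram\<close>, \<open>gram_assemblage_dilation\<close>).

It remains to approximate \<open>p\<close> by the correlations of such finite-rank decompositions.  They form a
convex set in a finite-dimensional space, so it suffices that no linear functional separates \<open>p\<close> from
it.  A functional that is at most \<open>\<gamma>\<close> on this set is the objective of a semidefinite program, with
operators \<open>G y b\<close> as coefficients.  By \<open>ensemble_duality\<close>, a consequence of the Hahn-Banach theorem, the
program has a dual solution: bounded operators \<open>Z y \<ge> G y b\<close> with \<open>\<Sum> Z y \<le> \<gamma>\<close>.  The dual solution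
bounds the value of every decomposition into positive functionals, also of non-normal ones; applied
to \<open>\<phi>\<close> it shows that the value at \<open>p\<close> is at most \<open>\<gamma>\<close> (\<open>hypertrace_correlation_in_C_qa\<close>).\<close>

section \<open>A Hahn-Banach theorem for sublinear functionals\<close>

lemma le_INF_add:
  fixes f :: "'i \<Rightarrow> real" and g :: "'j \<Rightarrow> real"
  assumes "S \<noteq> {}" "T \<noteq> {}" and "\<And>s t. s \<in> S \<Longrightarrow> t \<in> T \<Longrightarrow> a \<le> f s + g t"
  shows "a \<le> (INF s\<in>S. f s) + (INF t\<in>T. g t)"
proof -
  have "a - (INF t\<in>T. g t) \<le> f s" if s: "s \<in> S" for s
  proof -
    have "a - f s \<le> (INF t\<in>T. g t)"
      by (rule cINF_greatest[OF assms(2)]) (use assms(3)[OF s] in \<open>simp add: algebra_simps\<close>)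
    then show ?thesis by simp
  qed
  then have "a - (INF t\<in>T. g t) \<le> (INF s\<in>S. f s)"
    by (intro cINF_greatest[OF assms(1)])
  then show ?thesis by simp
qed

text \<open>The inequality for \<open>c > 0\<close> is inherited by infima; applied to \<open>1 / c\<close> as well, it gives equality.\<close>

definition sublinear_on :: "'v::real_vector set \<Rightarrow> ('v \<Rightarrow> real) \<Rightarrow> bool" where
  "sublinear_on S q \<longleftrightarrow> (\<forall>x\<in>S. \<forall>y\<in>S. q (x + y) \<le> q x + q y) \<and>
     (\<forall>x\<in>S. \<forall>c>0. q (c *\<^sub>R x) \<le> c * q x)"

lemma sublinear_on_add: "sublinear_on S q \<Longrightarrow> x \<in> S \<Longrightarrow> y \<in> S \<Longrightarrow> q (x + y) \<le> q x + q y"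
  and sublinear_on_scale_le: "sublinear_on S q \<Longrightarrow> x \<in> S \<Longrightarrow> c > 0 \<Longrightarrow> q (c *\<^sub>R x) \<le> c * q x"
  by (simp_all add: sublinear_on_def)

lemma sublinear_on_scale:
  assumes S: "subspace S" and q: "sublinear_on S q" and x: "x \<in> S" and c: "c > 0"
  shows "q (c *\<^sub>R x) = c * q x"
proof (rule order_antisym)
  show "q (c *\<^sub>R x) \<le> c * q x" using sublinear_on_scale_le[OF q x c] .
  have "q (inverse c *\<^sub>R c *\<^sub>R x) \<le> inverse c * q (c *\<^sub>R x)"
    by (rule sublinear_on_scale_le[OF q]) (use x c S in \<open>auto simp: subspace_scale\<close>)
  then show "c * q x \<le> q (c *\<^sub>R x)" using c by (simp add: field_simps)
qed

lemma sublinear_on_zero: "subspace S \<Longrightarrow> sublinear_on S q \<Longrightarrow> q 0 = 0"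
  using sublinear_on_scale[of S q 0 2] by (simp add: subspace_0)

lemma sublinear_on_minus:
  assumes S: "subspace S" and q: "sublinear_on S q" and x: "x \<in> S"
  shows "- q (- x) \<le> q x"
  using sublinear_on_add[OF q x, of "- x"] sublinear_on_zero[OF S q] x S by (simp add: subspace_neg)

text \<open>For a direction \<open>y\<close>, the functional \<open>x \<mapsto> inf\<^sub>t\<^sub>\<ge>\<^sub>0 (m (x + t y) - t m y)\<close> is again sublinear and lies below
\<open>m\<close> (take \<open>t = 0\<close>).  Minimality makes it equal to \<open>m\<close>, and \<open>t = 1\<close> then gives
\<open>m x \<le> m (x + y) - m y\<close>, the half of additivity that sublinearity leaves open.\<close>

lemma minimal_sublinear_additive:
  assumes S: "subspace S" and m: "sublinear_on S m"
    and min: "\<And>q. sublinear_on S q \<Longrightarrow> (\<And>x. x \<in> S \<Longrightarrow> q x \<le> m x) \<Longrightarrow> (\<And>x. x \<in> S \<Longrightarrow> q x = m x)"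
    and x: "x \<in> S" and y: "y \<in> S"
  shows "m (x + y) = m x + m y"
proof (rule order_antisym)
  define f where "f t x = m (x + t *\<^sub>R y) - t * m y" for t x
  define q where "q x = (INF t\<in>{0..}. f t x)" for x
  have in_S: "x + t *\<^sub>R y \<in> S" if "x \<in> S" for t x
    using that y S by (simp add: subspace_add subspace_scale)
  have low: "- m (- x) \<le> f t x" if "x \<in> S" "t \<ge> 0" for t x
  proof -
    have "t * m y = m (t *\<^sub>R y)"
      using sublinear_on_scale[OF S m y] sublinear_on_zero[OF S m] that by (cases "t = 0") auto
    also have "\<dots> \<le> m (x + t *\<^sub>R y) + m (- x)"
      using sublinear_on_add[OF m in_S[of x t] subspace_neg[OF S]] that by fastforce
    finally show ?thesis by (simp add: f_def)
  qed
  have q_le: "q x \<le> f t x" if "x \<in> S" "t \<ge> 0" for t x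
    unfolding q_def by (rule cINF_lower) (use low that in \<open>auto intro!: bdd_belowI2\<close>)
  have "sublinear_on S q"
    unfolding sublinear_on_def
  proof (intro conjI ballI allI impI)
    fix x z assume xz: "x \<in> S" "z \<in> S"
    show "q (x + z) \<le> q x + q z"
      unfolding q_def[of x] q_def[of z]
    proof (rule le_INF_add)
      fix s t :: real assume st: "s \<in> {0..}" "t \<in> {0..}"
      have "q (x + z) \<le> f (s + t) (x + z)" using xz st S by (intro q_le) (auto simp: subspace_add)
      also have "\<dots> \<le> f s x + f t z"
        using sublinear_on_add[OF m in_S[OF xz(1)] in_S[OF xz(2)], of s t]
        by (simp add: f_def algebra_simps)
      finally show "q (x + z) \<le> f s x + f t z" .
    qed simp_all
  next
    fix x and c :: real assume x: "x \<in> S" and c: "c > 0"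
    have "q (c *\<^sub>R x) / c \<le> f t x" if "t \<in> {0..}" for t
    proof -
      have "q (c *\<^sub>R x) \<le> f (c * t) (c *\<^sub>R x)" using x c that S by (intro q_le) (auto simp: subspace_scale)
      also have "\<dots> = m (c *\<^sub>R (x + t *\<^sub>R y)) - c * t * m y" by (simp add: f_def algebra_simps)
      also have "\<dots> \<le> c * f t x"
        using sublinear_on_scale_le[OF m in_S[OF x] c, of t] by (simp add: f_def algebra_simps)
      finally show ?thesis using c by (simp add: field_simps)
    qed
    then have "q (c *\<^sub>R x) / c \<le> q x" unfolding q_def[of x] by (intro cINF_greatest) auto
    then show "q (c *\<^sub>R x) \<le> c * q x" using c by (simp add: field_simps)
  qed
  moreover have "q x \<le> m x" if "x \<in> S" for x using q_le[OF that, of 0] by (simp add: f_def)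
  ultimately have "m x = q x" using min x by metis
  then show "m x + m y \<le> m (x + y)" using q_le[OF x, of 1] by (simp add: f_def)
qed (rule sublinear_on_add[OF m x y])

text \<open>A minimal sublinear functional below \<open>p\<close> exists by Zorn's lemma, and it is linear by
\<open>minimal_sublinear_additive\<close>.  The pointwise infimum of a chain is finite because every sublinear
\<open>q \<le> p\<close> satisfies \<open>q x \<ge> - q (- x) \<ge> - p (- x)\<close>.\<close>

theorem hahn_banach_sublinear:
  fixes p :: "'v::real_vector \<Rightarrow> real"
  assumes S: "subspace S" and p: "sublinear_on S p"
  shows "\<exists>l. (\<forall>x\<in>S. \<forall>y\<in>S. l (x + y) = l x + l y) \<and> (\<forall>x\<in>S. \<forall>c. l (c *\<^sub>R x) = c * l x) \<and>
    (\<forall>x\<in>S. l x \<le> p x)"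
proof -
  \<comment> \<open>Off \<open>S\<close> the competitors are normalised to \<open>0\<close>, so that the pointwise order is antisymmetric.\<close>
  define A where "A = {q. sublinear_on S q \<and> (\<forall>x\<in>S. q x \<le> p x) \<and> (\<forall>x. x \<notin> S \<longrightarrow> q x = 0)}"
  define P :: "('v \<Rightarrow> real) \<Rightarrow> ('v \<Rightarrow> real) \<Rightarrow> bool" where "P q r \<longleftrightarrow> (\<forall>x. r x \<le> q x)" for q r
  have low: "- p (- x) \<le> q x" if "q \<in> A" "x \<in> S" for q x
  proof -
    have "- p (- x) \<le> - q (- x)" using that S by (simp add: A_def subspace_neg)
    also have "\<dots> \<le> q x" using that S by (intro sublinear_on_minus) (auto simp: A_def)
    finally show ?thesis .
  qed
  have "\<exists>m\<in>A. \<forall>a\<in>A. P m a \<longrightarrow> a = m"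
  proof (rule predicate_Zorn)
    show "partial_order_on A (relation_of P A)"
      by (rule partial_order_on_relation_ofI) (auto simp: P_def fun_eq_iff intro: order_trans order_antisym)
  next
    fix C assume "C \<in> Chains (relation_of P A)"
    then have CA: "C \<subseteq> A" and tot: "\<And>q r. q \<in> C \<Longrightarrow> r \<in> C \<Longrightarrow> P q r \<or> P r q"
      by (auto simp: Chains_def relation_of_def)
    show "\<exists>u\<in>A. \<forall>a\<in>C. P a u"
    proof (cases "C = {}")
      case True
      have "(\<lambda>x. if x \<in> S then p x else 0) \<in> A"
        using p S by (auto simp: A_def sublinear_on_def subspace_add subspace_scale)
      with True show ?thesis by blast
    next
      case False
      define u where "u x = (INF q\<in>C. q x)" for x
      have u_le: "u x \<le> q x" if "q \<in> C" for q x
      proof (cases "x \<in> S")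
        case True
        show ?thesis unfolding u_def
          by (rule cINF_lower[OF _ that]) (use low CA True in \<open>auto intro!: bdd_belowI2\<close>)
      next
        case False
        have "u x = (INF q\<in>C. 0)" unfolding u_def
          by (rule INF_cong) (use CA False in \<open>auto simp: A_def\<close>)
        then show ?thesis using CA False that \<open>C \<noteq> {}\<close> by (auto simp: A_def)
      qed
      have "sublinear_on S u"
        unfolding sublinear_on_def
      proof (intro conjI ballI allI impI)
        fix x z assume xz: "x \<in> S" "z \<in> S"
        show "u (x + z) \<le> u x + u z"
          unfolding u_def[of x] u_def[of z]
        proof (rule le_INF_add[OF False False])
          fix q r assume qr: "q \<in> C" "r \<in> C"
          then obtain s where s: "s \<in> C" "s x \<le> q x" "s z \<le> r z"
            using tot[OF qr] by (auto simp: P_def)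
          have "u (x + z) \<le> s (x + z)" by (rule u_le[OF s(1)])
          also have "\<dots> \<le> s x + s z" using s(1) CA xz by (auto simp: A_def sublinear_on_def)
          finally show "u (x + z) \<le> q x + r z" using s by simp
        qed
      next
        fix x and c :: real assume x: "x \<in> S" and c: "c > 0"
        have "u (c *\<^sub>R x) / c \<le> q x" if q: "q \<in> C" for q
        proof -
          have "u (c *\<^sub>R x) \<le> q (c *\<^sub>R x)" by (rule u_le[OF q])
          also have "\<dots> \<le> c * q x" using q CA x c by (auto simp: A_def sublinear_on_def)
          finally show ?thesis using c by (simp add: field_simps)
        qed
        then have "u (c *\<^sub>R x) / c \<le> u x" unfolding u_def[of x] by (intro cINF_greatest[OF False])
        then show "u (c *\<^sub>R x) \<le> c * u x" using c by (simp add: field_simps)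
      qed
      moreover have "u x \<le> p x" if "x \<in> S" for x
      proof -
        obtain q where q: "q \<in> C" using False by blast
        have "u x \<le> q x" by (rule u_le[OF q])
        also have "\<dots> \<le> p x" using q CA that by (auto simp: A_def)
        finally show ?thesis .
      qed
      moreover have "u x = 0" if "x \<notin> S" for x
      proof -
        have "u x = (INF q\<in>C. 0)" unfolding u_def
          by (rule INF_cong) (use CA that in \<open>auto simp: A_def\<close>)
        then show ?thesis using False by simp
      qed
      ultimately show ?thesis using u_le by (auto simp: A_def P_def)
    qed
  qed
  then obtain m where mA: "m \<in> A" and max: "\<And>a. a \<in> A \<Longrightarrow> P m a \<Longrightarrow> a = m" by blast
  have m: "sublinear_on S m" and m_le: "\<And>x. x \<in> S \<Longrightarrow> m x \<le> p x" using mA by (auto simp: A_def)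
  have min: "q x = m x" if q: "sublinear_on S q" "\<And>x. x \<in> S \<Longrightarrow> q x \<le> m x" and x: "x \<in> S" for q x
  proof -
    let ?q = "\<lambda>x. if x \<in> S then q x else 0"
    have "?q = m"
    proof (rule max)
      show "?q \<in> A"
        using q m_le S by (auto simp: A_def sublinear_on_def subspace_add subspace_scale intro: order_trans)
      show "P m ?q" using q(2) mA by (auto simp: P_def A_def)
    qed
    from fun_cong[OF this, of x] show ?thesis using x by simp
  qed
  have add: "m (x + y) = m x + m y" if "x \<in> S" "y \<in> S" for x y
    by (rule minimal_sublinear_additive[OF S m _ that]) (rule min)
  have scale: "m (c *\<^sub>R x) = c * m x" if x: "x \<in> S" for c x
  proof -
    consider "c > 0" | "c = 0" | "c < 0" by linarith
    then show ?thesis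
    proof cases
      case 3
      have "m (c *\<^sub>R x) + m ((- c) *\<^sub>R x) = 0"
        using add[of "c *\<^sub>R x" "(- c) *\<^sub>R x"] x S sublinear_on_zero[OF S m]
        by (simp add: subspace_scale subspace_neg)
      moreover have "m ((- c) *\<^sub>R x) = (- c) * m x" by (rule sublinear_on_scale[OF S m x]) (use 3 in simp)
      ultimately show ?thesis by simp
    qed (use sublinear_on_scale[OF S m x] sublinear_on_zero[OF S m] in auto)
  qed
  show ?thesis using add scale m_le by (intro exI[of _ m]) blast
qed

section \<open>Unitary matrices and dilation of Gram matrices\<close>

abbreviation kronecker :: "nat \<Rightarrow> nat \<Rightarrow> complex" where
  "kronecker i j \<equiv> (if i = j then 1 else 0)"

text \<open>Vectors of \<open>\<complex>\<^sup>d\<close> are functions on \<open>nat\<close> of which only the values below \<open>d\<close> matter, as for the matrices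
in the definition of quantum correlations.\<close>

definition dot :: "nat \<Rightarrow> (nat \<Rightarrow> complex) \<Rightarrow> (nat \<Rightarrow> complex) \<Rightarrow> complex" where
  "dot d u v = (\<Sum>i<d. cnj (u i) * v i)"

definition mat_vec :: "nat \<Rightarrow> cmat \<Rightarrow> (nat \<Rightarrow> complex) \<Rightarrow> nat \<Rightarrow> complex" where
  "mat_vec d F u = (\<lambda>i. \<Sum>k<d. F i k * u k)"

definition unitary_mat :: "nat \<Rightarrow> cmat \<Rightarrow> bool" where
  "unitary_mat d F \<longleftrightarrow>
     (\<forall>i<d. \<forall>j<d. (\<Sum>k<d. F i k * cnj (F j k)) = kronecker i j) \<and>
     (\<forall>i<d. \<forall>j<d. (\<Sum>k<d. cnj (F k i) * F k j) = kronecker i j)"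

lemma sum_kronecker [simp]:
  "i < d \<Longrightarrow> (\<Sum>k<d. kronecker i k * f k) = f i"
  "i < d \<Longrightarrow> (\<Sum>k<d. kronecker k i * f k) = f i"
  "i < d \<Longrightarrow> (\<Sum>k<d. f k * kronecker i k) = f i"
  "i < d \<Longrightarrow> (\<Sum>k<d. f k * kronecker k i) = f i"
  by (simp_all add: if_distrib if_distribR sum.delta sum.delta' cong: if_cong)

lemma cnj_dot: "cnj (dot d u v) = dot d v u"
  by (simp add: dot_def mult.commute)

lemma dot_cong: "(\<And>i. i < d \<Longrightarrow> u i = u' i) \<Longrightarrow> (\<And>i. i < d \<Longrightarrow> v i = v' i) \<Longrightarrow> dot d u v = dot d u' v'"
  by (simp add: dot_def)

lemma dot_diff_left: "dot d (\<lambda>i. u i - w i) v = dot d u v - dot d w v"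
  by (simp add: dot_def algebra_simps sum_subtractf)

lemma dot_diff_right: "dot d v (\<lambda>i. u i - w i) = dot d v u - dot d v w"
  by (simp add: dot_def algebra_simps sum_subtractf)

lemma dot_self: "dot d u u = of_real (\<Sum>i<d. (cmod (u i))\<^sup>2)"
  by (simp add: dot_def complex_norm_square mult.commute del: of_real_power)

lemma dot_self_eq_0: "dot d u u = 0 \<Longrightarrow> i < d \<Longrightarrow> u i = 0"
  by (simp add: dot_self sum_nonneg_eq_0_iff del: of_real_sum)

lemma dot_mat_vec:
  assumes F: "unitary_mat d F"
  shows "dot d (mat_vec d F u) (mat_vec d F v) = dot d u v"
proof -
  have "dot d (mat_vec d F u) (mat_vec d F v)
      = (\<Sum>i<d. \<Sum>k<d. \<Sum>l<d. cnj (u k) * v l * (cnj (F i k) * F i l))"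
    by (simp only: dot_def mat_vec_def sum_product cnj_sum) (simp add: mult_ac)
  also have "\<dots> = (\<Sum>k<d. \<Sum>l<d. \<Sum>i<d. cnj (u k) * v l * (cnj (F i k) * F i l))"
    by (subst sum.swap, rule sum.cong[OF HOL.refl], rule sum.swap)
  also have "\<dots> = (\<Sum>k<d. \<Sum>l<d. cnj (u k) * v l * kronecker k l)"
    using F by (intro sum.cong HOL.refl) (simp add: unitary_mat_def flip: sum_distrib_left)
  also have "\<dots> = dot d u v" by (simp add: dot_def)
  finally show ?thesis .
qed

lemma unitary_mat_mult:
  assumes F: "unitary_mat d F" and G: "unitary_mat d G"
  shows "unitary_mat d (\<lambda>i j. \<Sum>k<d. F i k * G k j)"
proof -
  have 1: "(\<Sum>k<d. (\<Sum>l<d. A i l * B l k) * (\<Sum>l<d. A' l j * B' k l)) = kronecker i j"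
    if B: "\<And>l m. l < d \<Longrightarrow> m < d \<Longrightarrow> (\<Sum>k<d. B l k * B' k m) = kronecker l m"
      and A: "(\<Sum>l<d. A i l * A' l j) = kronecker i j" for A A' B B' :: cmat and i j
  proof -
    have "(\<Sum>k<d. (\<Sum>l<d. A i l * B l k) * (\<Sum>m<d. A' m j * B' k m))
       = (\<Sum>k<d. \<Sum>l<d. \<Sum>m<d. A i l * A' m j * (B l k * B' k m))"
      by (simp only: sum_product) (simp add: mult_ac)
    also have "\<dots> = (\<Sum>l<d. \<Sum>m<d. \<Sum>k<d. A i l * A' m j * (B l k * B' k m))"
      by (subst sum.swap, rule sum.cong[OF HOL.refl], rule sum.swap)
    also have "\<dots> = (\<Sum>l<d. \<Sum>m<d. A i l * A' m j * kronecker l m)"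
      using B by (intro sum.cong HOL.refl) (simp flip: sum_distrib_left)
    also have "\<dots> = kronecker i j" using A by simp
    finally show ?thesis .
  qed
  show ?thesis
    unfolding unitary_mat_def
  proof (intro conjI allI impI)
    fix i j assume ij: "i < d" "j < d"
    have "(\<Sum>k<d. (\<Sum>l<d. F i l * G l k) * (\<Sum>l<d. cnj (F j l) * cnj (G l k))) = kronecker i j"
      by (rule 1[of G "\<lambda>k l. cnj (G l k)" F i "\<lambda>l j. cnj (F j l)"]) (use F G ij in \<open>simp_all add: unitary_mat_def\<close>)
    then show "(\<Sum>k<d. (\<Sum>l<d. F i l * G l k) * cnj (\<Sum>l<d. F j l * G l k)) = kronecker i j" by simp
    have "(\<Sum>k<d. (\<Sum>l<d. cnj (G l i) * cnj (F k l)) * (\<Sum>l<d. G l j * F k l)) = kronecker i j"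
      by (rule 1[of "\<lambda>l k. cnj (F k l)" F "\<lambda>i l. cnj (G l i)" i "G"]) (use F G ij in \<open>simp_all add: unitary_mat_def\<close>)
    then show "(\<Sum>k<d. cnj (\<Sum>l<d. F k l * G l i) * (\<Sum>l<d. F k l * G l j)) = kronecker i j"
      by (simp add: mult.commute)
  qed
qed

lemma mat_vec_mult: "mat_vec d (\<lambda>i j. \<Sum>k<d. F i k * G k j) u = mat_vec d F (mat_vec d G u)"
proof -
  have "(\<Sum>l<d. \<Sum>k<d. F i k * G k l * u l) = (\<Sum>k<d. \<Sum>l<d. F i k * (G k l * u l))" for i
    by (subst sum.swap) (simp add: mult.assoc)
  then show ?thesis by (simp add: mat_vec_def sum_distrib_left sum_distrib_right)
qed

lemma unitary_mat_kronecker: "unitary_mat d kronecker"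
  unfolding unitary_mat_def
proof (intro conjI allI impI)
  fix i j assume ij: "i < d" "j < d"
  show "(\<Sum>k<d. kronecker i k * cnj (kronecker j k)) = kronecker i j"
    using sum_kronecker(1)[OF ij(1), of "\<lambda>k. cnj (kronecker j k)"] by auto
  show "(\<Sum>k<d. cnj (kronecker k i) * kronecker k j) = kronecker i j"
    using sum_kronecker(4)[OF ij(2), of "\<lambda>k. cnj (kronecker k i)"] by auto
qed

text \<open>For \<open>z = u - w\<close> the matrix \<open>R = 1 - z z\<^sup>* / \<langle>z, u\<rangle>\<close> sends \<open>u\<close> to \<open>u - z = w\<close> and fixes the vectors
orthogonal to \<open>z\<close>.  It multiplies \<open>z\<close> by \<open>1 - \<langle>z, z\<rangle> / \<langle>z, u\<rangle>\<close>; as \<open>u\<close> and \<open>w\<close> have the same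
length, \<open>\<langle>z, z\<rangle> = \<langle>z, u\<rangle> + cnj \<langle>z, u\<rangle>\<close>, so this factor is \<open>- cnj \<langle>z, u\<rangle> / \<langle>z, u\<rangle>\<close>, a phase, and \<open>R\<close> is
unitary.  It is the complex analogue of a Householder reflection.\<close>

lemma unitary_reflection:
  assumes uw: "dot d u u = dot d w w"
  shows "\<exists>R. unitary_mat d R \<and> (\<forall>i<d. mat_vec d R u i = w i) \<and>
    (\<forall>v. dot d u v = dot d w v \<longrightarrow> (\<forall>i<d. mat_vec d R v i = v i))"
proof -
  define z where "z = (\<lambda>i. u i - w i)"
  define s where "s = dot d z u"
  define R where "R i k = kronecker i k - z i * cnj (z k) / s" for i k
  have R: "mat_vec d R v i = v i - z i * (dot d z v / s)" if "i < d" for v i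
  proof -
    have "mat_vec d R v i = (\<Sum>k<d. kronecker i k * v k) - (\<Sum>k<d. z i / s * (cnj (z k) * v k))"
      by (simp add: mat_vec_def R_def algebra_simps sum_subtractf)
    also have "\<dots> = v i - z i / s * dot d z v" using that by (simp add: dot_def sum_distrib_left)
    finally show ?thesis by simp
  qed
  have zz: "dot d z z = s + cnj s"
    using uw by (simp add: s_def z_def dot_diff_left dot_diff_right cnj_dot)
  show ?thesis
  proof (cases "s = 0")
    case True
    then have "u i = w i" if "i < d" for i using dot_self_eq_0[of d z i] zz that by (simp add: z_def)
    then show ?thesis
      using unitary_mat_kronecker[of d] by (intro exI[of _ kronecker]) (simp add: mat_vec_def)
  next
    case False
    \<comment> \<open>The cross terms of \<open>R R\<^sup>*\<close> cancel against the quadratic one by this identity.\<close>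
    have key: "1 / s + 1 / cnj s = dot d z z / (s * cnj s)" using False zz by (simp add: field_simps)
    \<comment> \<open>Both \<open>R R\<^sup>*\<close> and \<open>R\<^sup>* R\<close> are instances: \<open>(a, b)\<close> is \<open>(s, cnj s)\<close> or \<open>(cnj s, s)\<close>.\<close>
    have *: "(\<Sum>k<d. (kronecker i k - z i * cnj (z k) / a) * (kronecker j k - cnj (z j) * z k / b)) = kronecker i j"
      if "a * b = s * cnj s" "1 / a + 1 / b = 1 / s + 1 / cnj s" and ij: "i < d" "j < d" for i j a b
    proof -
      have "(\<Sum>k<d. (kronecker i k - z i * cnj (z k) / a) * (kronecker j k - cnj (z j) * z k / b))
        = (\<Sum>k<d. kronecker i k * kronecker j k) - (\<Sum>k<d. kronecker i k * (cnj (z j) * z k / b))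
          - (\<Sum>k<d. kronecker j k * (z i * cnj (z k) / a))
          + (\<Sum>k<d. z i * cnj (z j) / (a * b) * (cnj (z k) * z k))"
        by (simp add: algebra_simps sum_subtractf sum.distrib)
      also have "\<dots> = kronecker j i - cnj (z j) * z i / b - z i * cnj (z j) / a
          + z i * cnj (z j) / (a * b) * dot d z z"
        unfolding sum_kronecker(1)[OF ij(1)] sum_kronecker(1)[OF ij(2)] by (simp add: dot_def sum_distrib_left)
      also have "\<dots> = kronecker i j - z i * cnj (z j) * (1 / a + 1 / b - dot d z z / (a * b))"
        by (simp add: algebra_simps)
      also have "\<dots> = kronecker i j" using that key by simp
      finally show ?thesis .
    qed
    have cnj_R: "cnj (R i k) = kronecker i k - cnj (z i) * z k / cnj s" for i k
      by (simp add: R_def)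
    have "unitary_mat d R"
      unfolding unitary_mat_def
    proof (intro conjI allI impI)
      fix i j assume ij: "i < d" "j < d"
      show "(\<Sum>k<d. R i k * cnj (R j k)) = kronecker i j"
        unfolding cnj_R unfolding R_def by (rule *[OF _ _ ij]) simp_all
      have "(\<Sum>k<d. cnj (R k i) * R k j) = (\<Sum>k<d. (kronecker i k - z i * cnj (z k) / cnj s) * (kronecker j k - cnj (z j) * z k / s))"
        unfolding cnj_R unfolding R_def
        by (intro sum.cong HOL.refl arg_cong2[of _ _ _ _ times]) (auto simp: mult.commute)
      also have "\<dots> = kronecker i j" by (rule *[OF _ _ ij]) simp_all
      finally show "(\<Sum>k<d. cnj (R k i) * R k j) = kronecker i j" .
    qed
    moreover have "mat_vec d R u i = w i" if "i < d" for i
      using R[OF that, of u] False by (simp add: s_def[symmetric]) (simp add: z_def)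
    moreover have "mat_vec d R v i = v i" if "dot d u v = dot d w v" "i < d" for v i
      using R[OF that(2), of v] that(1) by (simp add: z_def dot_diff_left)
    ultimately show ?thesis by blast
  qed
qed

text \<open>Witt's extension theorem for \<open>\<complex>\<^sup>d\<close>.  Once a unitary matches the first \<open>m\<close> vectors, a reflection moves
the image of the next one to its target; since the Gram matrices agree, the difference of the two is
orthogonal to the vectors that are already in place, so the reflection fixes them.\<close>

lemma unitary_of_equal_gram:
  fixes m :: nat
  assumes "\<And>i j. i < m \<Longrightarrow> j < m \<Longrightarrow> dot d (c i) (c j) = dot d (g i) (g j)"
  shows "\<exists>F. unitary_mat d F \<and> (\<forall>i<m. \<forall>k<d. mat_vec d F (c i) k = g i k)"
  using assms
proof (induction m)
  case 0
  show ?case using unitary_mat_kronecker by auto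
next
  case (Suc m)
  from Suc.IH Suc.prems obtain F where F: "unitary_mat d F" "\<And>i k. i < m \<Longrightarrow> k < d \<Longrightarrow> mat_vec d F (c i) k = g i k"
    by (metis less_SucI)
  let ?u = "mat_vec d F (c m)"
  have gram: "dot d ?u (g i) = dot d (g m) (g i)" if "i < m" for i
  proof -
    have "dot d ?u (g i) = dot d ?u (mat_vec d F (c i))" by (rule dot_cong) (use F(2) that in auto)
    also have "\<dots> = dot d (g m) (g i)" using that by (simp add: dot_mat_vec[OF F(1)] Suc.prems)
    finally show ?thesis .
  qed
  have "dot d ?u ?u = dot d (g m) (g m)" by (simp add: dot_mat_vec[OF F(1)] Suc.prems)
  from unitary_reflection[OF this] obtain R where R: "unitary_mat d R" "\<And>i. i < d \<Longrightarrow> mat_vec d R ?u i = g m i"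
    "\<And>v i. dot d ?u v = dot d (g m) v \<Longrightarrow> i < d \<Longrightarrow> mat_vec d R v i = v i" by blast
  have "mat_vec d R (mat_vec d F (c i)) k = g i k" if "i < Suc m" "k < d" for i k
  proof (cases "i = m")
    case False
    then have i: "i < m" using that by simp
    have "mat_vec d R (mat_vec d F (c i)) k = mat_vec d R (g i) k"
      unfolding mat_vec_def[of d R] by (rule sum.cong) (use F(2)[OF i] in auto)
    also have "\<dots> = g i k" by (rule R(3)[OF gram[OF i] that(2)])
    finally show ?thesis .
  qed (use R(2) that in simp)
  with unitary_mat_mult[OF R(1) F(1)] show ?case
    by (intro exI[of _ "\<lambda>i j. \<Sum>k<d. R i k * F k j"]) (simp add: mat_vec_mult)
qed

text \<open>Naimark dilation and the purification of an assemblage in one statement.  For each setting \<open>x\<close> the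
positive matrices \<open>M\<^sub>a = dot L (G x a r) (G x a s)\<close> are cut out of the single vector family
\<open>(G x a r)\<^sub>a \<in> \<complex>\<^sup>A \<otimes> \<complex>\<^sup>L\<close> by the coordinate projections onto the blocks \<open>a\<close>.  That family has the Gram
matrix \<open>\<Gamma>\<close> for every \<open>x\<close>, so unitaries carry all these families to one common family \<open>c\<close>, and the
coordinate projections to projection-valued measures.\<close>

lemma gram_assemblage_dilation:
  fixes G :: "'x \<Rightarrow> 'a::finite \<Rightarrow> nat \<Rightarrow> nat \<Rightarrow> complex"
  assumes eq: "\<And>x r s. r < m \<Longrightarrow> s < m \<Longrightarrow> (\<Sum>a\<in>UNIV. dot L (G x a r) (G x a s)) = \<Gamma> r s"
  shows "\<exists>n c P. (\<forall>x. mat_pvm n (P x)) \<and>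
    (\<forall>x a. \<forall>r<m. \<forall>s<m. (\<Sum>i<n. \<Sum>j<n. cnj (c r i) * P x a i j * c s j) = dot L (G x a r) (G x a s))"
proof -
  define n where "n = card (UNIV \<times> {..<L} :: ('a \<times> nat) set)"
  \<comment> \<open>The coordinate \<open>i < n\<close> lies in the block \<open>fst (h i)\<close>.\<close>
  obtain h where h: "bij_betw h {..<n} (UNIV \<times> {..<L} :: ('a \<times> nat) set)"
    using ex_bij_betw_nat_finite[of "UNIV \<times> {..<L} :: ('a \<times> nat) set"]
    by (auto simp: n_def atLeast0LessThan)
  define g where "g x r i = G x (fst (h i)) r (snd (h i))" for x r i
  have block: "(\<Sum>i<n. if fst (h i) = a then cnj (g x r i) * g x s i else 0) = dot L (G x a r) (G x a s)" for x a r s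
  proof -
    let ?f = "\<lambda>z. if fst z = a then cnj (G x (fst z) r (snd z)) * G x (fst z) s (snd z) else 0"
    have "(\<Sum>i<n. if fst (h i) = a then cnj (g x r i) * g x s i else 0) = (\<Sum>i<n. ?f (h i))"
      by (rule sum.cong) (auto simp: g_def)
    also have "\<dots> = (\<Sum>z\<in>UNIV \<times> {..<L}. ?f z)"
      by (rule sum.reindex_bij_betw[OF h])
    also have "\<dots> = (\<Sum>a'\<in>UNIV. \<Sum>l<L. ?f (a', l))" unfolding sum.cartesian_product by (rule sum.cong) auto
    also have "\<dots> = (\<Sum>a'\<in>UNIV. if a' = a then dot L (G x a r) (G x a s) else 0)"
      by (rule sum.cong) (auto simp: dot_def)
    finally show ?thesis by simp
  qed
  have gram: "dot n (g x r) (g x s) = \<Gamma> r s" if "r < m" "s < m" for x r s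
  proof -
    have "dot n (g x r) (g x s) = (\<Sum>i<n. \<Sum>a\<in>UNIV. if fst (h i) = a then cnj (g x r i) * g x s i else 0)"
      by (simp add: dot_def)
    also have "\<dots> = \<Gamma> r s" by (subst sum.swap) (simp only: block eq[OF that])
    finally show ?thesis .
  qed
  \<comment> \<open>The family of any one setting can serve as the common one.\<close>
  define c where "c = g undefined"
  have "\<exists>F. unitary_mat n F \<and> (\<forall>r<m. \<forall>k<n. mat_vec n F (c r) k = g x r k)" for x
    by (rule unitary_of_equal_gram) (simp add: c_def gram)
  then obtain F where F: "\<And>x. unitary_mat n (F x)" "\<And>x r k. r < m \<Longrightarrow> k < n \<Longrightarrow> mat_vec n (F x) (c r) k = g x r k"
    by metis
  define P where "P x a i j = (\<Sum>k<n. if fst (h k) = a then cnj (F x k i) * F x k j else 0)" for x a i j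
  have "mat_pvm n (P x)" for x
    unfolding mat_pvm_def mat_projection_def
  proof (intro conjI allI impI)
    fix a i j assume ij: "i < n" "j < n"
    show "cnj (P x a j i) = P x a i j"
      by (simp add: P_def if_distrib mult.commute cong: if_cong)
    let ?t = "\<lambda>k::nat. if fst (h k) = a then (1::complex) else 0"
    have P': "P x a i j = (\<Sum>k<n. ?t k * cnj (F x k i) * F x k j)" for i j
      unfolding P_def by (rule sum.cong) auto
    have "(\<Sum>k<n. P x a i k * P x a k j)
      = (\<Sum>k<n. \<Sum>l<n. \<Sum>l'<n. ?t l * ?t l' * cnj (F x l i) * F x l' j * (F x l k * cnj (F x l' k)))"
      unfolding P' sum_product by (simp add: mult_ac del: mult_if_delta cong: if_cong)
    also have "\<dots> = (\<Sum>l<n. \<Sum>l'<n. \<Sum>k<n. ?t l * ?t l' * cnj (F x l i) * F x l' j * (F x l k * cnj (F x l' k)))"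
      by (subst sum.swap, rule sum.cong[OF HOL.refl], rule sum.swap)
    also have "\<dots> = (\<Sum>l<n. \<Sum>l'<n. (?t l * ?t l' * cnj (F x l i) * F x l' j) * kronecker l l')"
    proof (intro sum.cong HOL.refl)
      fix l l' assume "l \<in> {..<n}" "l' \<in> {..<n}"
      then have "(\<Sum>k<n. F x l k * cnj (F x l' k)) = kronecker l l'"
        using F(1)[of x] unfolding unitary_mat_def by blast
      then show "(\<Sum>k<n. ?t l * ?t l' * cnj (F x l i) * F x l' j * (F x l k * cnj (F x l' k)))
          = (?t l * ?t l' * cnj (F x l i) * F x l' j) * kronecker l l'"
        by (simp only: flip: sum_distrib_left)
    qed
    also have "\<dots> = (\<Sum>l<n. ?t l * ?t l * cnj (F x l i) * F x l j)"
      by (intro sum.cong HOL.refl sum_kronecker) simp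
    also have "\<dots> = P x a i j" unfolding P' by (rule sum.cong) auto
    finally show "(\<Sum>k<n. P x a i k * P x a k j) = P x a i j" .
  next
    fix i j assume ij: "i < n" "j < n"
    have "(\<Sum>a\<in>UNIV. P x a i j) = (\<Sum>k<n. cnj (F x k i) * F x k j)"
      unfolding P_def by (subst sum.swap) simp
    then show "(\<Sum>a\<in>UNIV. P x a i j) = kronecker i j" using F(1)[of x] ij by (simp add: unitary_mat_def)
  qed
  moreover have "(\<Sum>i<n. \<Sum>j<n. cnj (c r i) * P x a i j * c s j) = dot L (G x a r) (G x a s)"
    if rs: "r < m" "s < m" for x a r s
  proof -
    let ?t = "\<lambda>k::nat. if fst (h k) = a then (1::complex) else 0"
    have "(\<Sum>i<n. \<Sum>j<n. cnj (c r i) * P x a i j * c s j)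
      = (\<Sum>i<n. \<Sum>j<n. \<Sum>k<n. ?t k * (cnj (F x k i) * cnj (c r i) * (F x k j * c s j)))"
      unfolding P_def sum_distrib_left sum_distrib_right by (intro sum.cong HOL.refl) auto
    also have "\<dots> = (\<Sum>i<n. \<Sum>k<n. \<Sum>j<n. ?t k * (cnj (F x k i) * cnj (c r i) * (F x k j * c s j)))"
      by (rule sum.cong[OF HOL.refl], rule sum.swap)
    also have "\<dots> = (\<Sum>k<n. \<Sum>i<n. \<Sum>j<n. ?t k * (cnj (F x k i) * cnj (c r i) * (F x k j * c s j)))"
      by (rule sum.swap)
    also have "\<dots> = (\<Sum>k<n. ?t k * (cnj (mat_vec n (F x) (c r) k) * mat_vec n (F x) (c s) k))"
      by (simp only: mat_vec_def sum_product cnj_sum complex_cnj_mult flip: sum_distrib_left)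
    also have "\<dots> = (\<Sum>k<n. if fst (h k) = a then cnj (g x r k) * g x s k else 0)"
      by (rule sum.cong) (use F(2) rs in auto)
    finally show ?thesis by (simp only: block)
  qed
  ultimately show ?thesis by blast
qed

section \<open>Ensembles of vectors and the quantum correlations they define\<close>

lemma bounded_bilinear_cinner:
  "bounded_bilinear (cinner :: 'h::chilbert_space \<Rightarrow> 'h \<Rightarrow> complex)"
proof
  fix u v w :: 'h and r :: real
  show "cinner (r *\<^sub>R u) v = r *\<^sub>R cinner u v" "cinner u (r *\<^sub>R v) = r *\<^sub>R cinner u v"
    by (simp_all add: cinner_scaleC_left cinner_scaleC_right scaleR_conv_of_real flip: of_real_scaleC_vec)
  show "\<exists>K. \<forall>u v :: 'h. norm (cinner u v) \<le> norm u * norm v * K"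
    by (intro exI[of _ 1]) (simp add: cinner_Cauchy_Schwarz)
qed (rule cinner_add_left cinner_add_right)+

interpretation cinner: bounded_bilinear "cinner :: 'h::chilbert_space \<Rightarrow> 'h \<Rightarrow> complex"
  by (rule bounded_bilinear_cinner)

lemma bounded_bilinear_scaleC:
  "bounded_bilinear (scaleC :: complex \<Rightarrow> 'h \<Rightarrow> 'h::chilbert_space)"
proof
  fix u :: 'h and c :: complex and r :: real
  show "(r *\<^sub>R c) *\<^sub>C u = r *\<^sub>R (c *\<^sub>C u)" "c *\<^sub>C (r *\<^sub>R u) = r *\<^sub>R (c *\<^sub>C u)"
    by (simp_all add: scaleR_conv_of_real mult.commute flip: of_real_scaleC_vec)
  show "\<exists>K. \<forall>c. \<forall>u :: 'h. norm (c *\<^sub>C u) \<le> norm c * norm u * K"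
    by (intro exI[of _ 1]) (simp add: norm_scaleC_vec)
qed (rule scaleC_add_left scaleC_add_right)+

interpretation scaleC: bounded_bilinear "scaleC :: complex \<Rightarrow> 'h \<Rightarrow> 'h::chilbert_space"
  by (rule bounded_bilinear_scaleC)

lemma Re_cinner_self: "Re (cinner v v) = (norm v)\<^sup>2"
  by (simp add: cinner_self)

text \<open>The Gram-Schmidt process, which provides finite coordinates for finitely many vectors of a Hilbert
space.\<close>

lemma finite_orthonormal_expansion:
  fixes V :: "'h::chilbert_space set"
  assumes "finite V"
  shows "\<exists>m e. (\<forall>r<m. \<forall>s<m. cinner (e r) (e s) = kronecker r s) \<and>
    (\<forall>v\<in>V. v = (\<Sum>r<m. cinner (e r) v *\<^sub>C e r))"
  using assms
proof (induction V rule: finite_induct)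
  case empty
  show ?case by (intro exI[of _ 0]) simp
next
  case (insert v V)
  then obtain m and e :: "nat \<Rightarrow> 'h" where on: "\<And>r s. r < m \<Longrightarrow> s < m \<Longrightarrow> cinner (e r) (e s) = kronecker r s"
    and ex: "\<And>v. v \<in> V \<Longrightarrow> v = (\<Sum>r<m. cinner (e r) v *\<^sub>C e r)" by blast
  define w where "w = v - (\<Sum>r<m. cinner (e r) v *\<^sub>C e r)"
  have orth: "cinner (e s) w = 0" if "s < m" for s
  proof -
    have "cinner (e s) w = cinner (e s) v - (\<Sum>r<m. cinner (e r) v * cinner (e s) (e r))"
      by (simp add: w_def cinner_diff_right cinner.sum_right cinner_scaleC_right)
    also have "(\<Sum>r<m. cinner (e r) v * cinner (e s) (e r)) = (\<Sum>r<m. cinner (e r) v * kronecker s r)"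
      by (rule sum.cong) (use on that in auto)
    finally show ?thesis using that by simp
  qed
  then have orth': "cinner w (e s) = 0" if "s < m" for s
    using that cinner_commute[of w "e s"] by simp
  have span: "cinner w (\<Sum>r<m. f r *\<^sub>C e r) = 0" for f
    by (simp add: cinner.sum_right cinner_scaleC_right orth')
  show ?case
  proof (cases "w = 0")
    case True
    then have "v = (\<Sum>r<m. cinner (e r) v *\<^sub>C e r)" by (simp add: w_def)
    then show ?thesis using on ex by (intro exI[of _ m] exI[of _ e]) blast
  next
    case False
    define k where "k = complex_of_real (inverse (norm w))"
    define e' where "e' = e(m := k *\<^sub>C w)"
    have e'_old: "e' r = e r" if "r < m" for r using that by (simp add: e'_def)
    have k: "k * k * cinner w w = 1" "cnj k = k"
      using False by (simp_all add: k_def cinner_self power2_eq_square field_simps)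
    have "cinner (e' r) (e' s) = kronecker r s" if "r < Suc m" "s < Suc m" for r s
      using that on[of r s] orth[of r] orth'[of s] k
      by (auto simp: e'_def less_Suc_eq cinner_scaleC_left cinner_scaleC_right mult_ac)
    moreover have sum: "(\<Sum>r<Suc m. cinner (e' r) u *\<^sub>C e' r) = (\<Sum>r<m. cinner (e r) u *\<^sub>C e r) + (k * k * cinner w u) *\<^sub>C w" for u
      using k by (simp add: e'_old) (simp add: e'_def cinner_scaleC_left mult_ac)
    moreover have "u = (\<Sum>r<Suc m. cinner (e' r) u *\<^sub>C e' r)" if "u \<in> V" for u
      using ex[OF that] span[of "\<lambda>r. cinner (e r) u"] unfolding sum by simp
    moreover have "v = (\<Sum>r<Suc m. cinner (e' r) v *\<^sub>C e' r)"
    proof -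
      have v: "v = w + (\<Sum>r<m. cinner (e r) v *\<^sub>C e r)" by (simp add: w_def)
      have "cinner w v = cinner w w" by (subst v) (simp add: cinner_add_right span)
      then have "k * k * cinner w v = 1" using k by simp
      then show ?thesis unfolding sum using v by (metis add.commute scaleC_one)
    qed
    ultimately show ?thesis by (intro exI[of _ "Suc m"] exI[of _ e']) blast
  qed
qed

lemma cinner_coordinates:
  assumes "v = (\<Sum>r<m. cinner (e r) v *\<^sub>C e r)"
  shows "cinner u v = dot m (\<lambda>r. cinner (e r) u) (\<lambda>r. cinner (e r) v)"
proof -
  have "cinner u v = cinner u (\<Sum>r<m. cinner (e r) v *\<^sub>C e r)" using assms by simp
  also have "\<dots> = (\<Sum>r<m. cinner (e r) v * cinner u (e r))"
    by (simp add: cinner.sum_right cinner_scaleC_right)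
  also have "\<dots> = (\<Sum>r<m. cnj (cinner (e r) u) * cinner (e r) v)"
    by (simp add: mult.commute flip: cinner_commute)
  finally show ?thesis by (simp add: dot_def)
qed

text \<open>The operator written \<open>|v\<rangle>\<langle>w|\<close> in physics.\<close>

definition rank_one :: "'h::chilbert_space \<Rightarrow> 'h \<Rightarrow> 'h \<Rightarrow>\<^sub>L 'h" where
  "rank_one v w = Blinfun (\<lambda>x. cinner w x *\<^sub>C v)"

lemma rank_one_apply [simp]: "blinfun_apply (rank_one v w) x = cinner w x *\<^sub>C v"
  unfolding rank_one_def
  by (intro bounded_linear_Blinfun_apply[THEN fun_cong])
    (rule bounded_linear_compose[OF scaleC.bounded_linear_left cinner.bounded_linear_right])

text \<open>A list of vectors stands for the positive finite-rank operator \<open>\<Sum> |v\<rangle>\<langle>v|\<close>; concatenation of lists is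
addition of operators.  \<open>ensemble_exp \<sigma> T\<close> is the real part of the trace of this operator times \<open>T\<close>.
Working with the list instead of the operator spares a theory of the trace.\<close>

definition ensemble_op :: "'h::chilbert_space list \<Rightarrow> 'h \<Rightarrow>\<^sub>L 'h" where
  "ensemble_op \<sigma> = (\<Sum>v\<leftarrow>\<sigma>. rank_one v v)"

definition ensemble_exp :: "'h::chilbert_space list \<Rightarrow> 'h bop \<Rightarrow> real" where
  "ensemble_exp \<sigma> T = (\<Sum>v\<leftarrow>\<sigma>. Re (cinner v (bop_apply T v)))"

lemma ensemble_op_apply: "blinfun_apply (ensemble_op \<sigma>) u = (\<Sum>v\<leftarrow>\<sigma>. cinner v u *\<^sub>C v)"
  by (induction \<sigma>) (auto simp: ensemble_op_def blinfun.add_left)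

lemma sum_two_tensor_contraction:
  fixes u w :: "nat \<Rightarrow> 'c::comm_semiring_0"
  shows "(\<Sum>i<n. \<Sum>j<m. u i * w j * (\<Sum>s<t. x s i * y s j))
    = (\<Sum>s<t. (\<Sum>i<n. u i * x s i) * (\<Sum>j<m. w j * y s j))"
proof -
  have "(\<Sum>i<n. \<Sum>j<m. u i * w j * (\<Sum>s<t. x s i * y s j))
    = (\<Sum>i<n. \<Sum>j<m. \<Sum>s<t. (u i * x s i) * (w j * y s j))"
    by (simp add: sum_distrib_left mult_ac)
  also have "\<dots> = (\<Sum>i<n. \<Sum>s<t. \<Sum>j<m. (u i * x s i) * (w j * y s j))"
    by (rule sum.cong[OF HOL.refl], rule sum.swap)
  also have "\<dots> = (\<Sum>s<t. \<Sum>i<n. \<Sum>j<m. (u i * x s i) * (w j * y s j))"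
    by (rule sum.swap)
  finally show ?thesis by (simp only: sum_product)
qed

lemma tensor_expectation_sum_of_products:
  "tensor_expectation n m (\<lambda>i j. \<Sum>r<t. c r i * d r j) P Q =
    (\<Sum>r<t. \<Sum>s<t. (\<Sum>i<n. \<Sum>k<n. cnj (c r i) * P i k * c s k) * (\<Sum>j<m. \<Sum>l<m. cnj (d r j) * Q j l * d s l))"
proof -
  have "tensor_expectation n m (\<lambda>i j. \<Sum>r<t. c r i * d r j) P Q
    = (\<Sum>i<n. \<Sum>j<m. \<Sum>r<t. cnj (c r i) * cnj (d r j) * (\<Sum>s<t. (\<Sum>k<n. P i k * c s k) * (\<Sum>l<m. Q j l * d s l)))"
    unfolding tensor_expectation_def sum_two_tensor_contraction by (simp add: sum_distrib_right)
  also have "\<dots> = (\<Sum>i<n. \<Sum>r<t. \<Sum>j<m. cnj (c r i) * cnj (d r j) * (\<Sum>s<t. (\<Sum>k<n. P i k * c s k) * (\<Sum>l<m. Q j l * d s l)))"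
    by (rule sum.cong[OF HOL.refl], rule sum.swap)
  also have "\<dots> = (\<Sum>r<t. \<Sum>i<n. \<Sum>j<m. cnj (c r i) * cnj (d r j) * (\<Sum>s<t. (\<Sum>k<n. P i k * c s k) * (\<Sum>l<m. Q j l * d s l)))"
    by (rule sum.swap)
  finally show ?thesis
    unfolding sum_two_tensor_contraction by (simp add: sum_distrib_left mult.assoc)
qed

lemma sum_list_sum_swap: "(\<Sum>x\<leftarrow>xs. \<Sum>i\<in>I. f x i) = (\<Sum>i\<in>I. \<Sum>x\<leftarrow>xs. f x i)"
  by (induction xs) (simp_all add: sum.distrib)

lemma sum_list_padded:
  fixes f :: "'i \<Rightarrow> 'c::comm_monoid_add"
  assumes "length xs \<le> L"
  shows "(\<Sum>j<L. if j < length xs then f (xs ! j) else 0) = (\<Sum>x\<leftarrow>xs. f x)"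
proof -
  have "(\<Sum>j<L. if j < length xs then f (xs ! j) else 0) = (\<Sum>j<length xs. f (xs ! j))"
    by (rule sum.mono_neutral_cong_right) (use assms in auto)
  then show ?thesis by (simp add: sum_list_sum_nth atLeast0LessThan)
qed

text \<open>The Schroedinger-HJW theorem: the ensembles \<open>\<sigma> y b\<close> average to the same density operator for all \<open>y\<close>,
hence they arise from one entangled vector by measurements on the second factor.  In coordinates
with respect to an orthonormal family \<open>e\<close> that spans all vectors involved, the correlation is
\<open>\<Sum>\<^sub>r\<^sub>s M r s * N r s\<close> with \<open>M r s = \<langle>e r, E x a (e s)\<rangle>\<close> and \<open>N r s = \<Sum>\<^sub>v \<langle>v, e r\<rangle> \<langle>e s, v\<rangle>\<close>.  Both are
Gram matrices whose sums over the outcomes do not depend on the setting, so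
\<open>gram_assemblage_dilation\<close> applies to either factor and yields measurements and vectors \<open>c r\<close>, \<open>d r\<close>
with the joint state \<open>\<psi> = \<Sum>\<^sub>r c r \<otimes> d r\<close>.\<close>

theorem ensemble_correlation_in_C_q:
  fixes E :: "'x::finite \<Rightarrow> 'a::finite \<Rightarrow> 'h::chilbert_space bop"
    and \<sigma> :: "'y::finite \<Rightarrow> 'b::finite \<Rightarrow> 'h list"
  assumes E: "is_pvm_family E"
    and eq: "\<And>y. (\<Sum>b\<in>UNIV. ensemble_op (\<sigma> y b)) = ensemble_op \<rho>"
    and norm: "(\<Sum>v\<leftarrow>\<rho>. (norm v)\<^sup>2) = 1"
  shows "(\<lambda>x y a b. ensemble_exp (\<sigma> y b) (E x a)) \<in> C_q"
proof -
  have EE: "cinner u (bop_apply (E x a) v) = cinner (bop_apply (E x a) u) (bop_apply (E x a) v)" for u v x a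
    using E by (metis bop_apply_simps(6) cinner_star_left is_pvm_family_def projection_def)
  have Esum: "(\<Sum>a\<in>UNIV. bop_apply (E x a) v) = v" for x v
  proof -
    have "(\<Sum>a\<in>A. bop_apply (E x a) v) = bop_apply (\<Sum>a\<in>A. E x a) v" for A
      by (induction A rule: infinite_finite_induct) auto
    then show ?thesis using E by (simp add: is_pvm_family_def)
  qed
  define q where "q x y a b = ensemble_exp (\<sigma> y b) (E x a)" for x y a b
  let ?V = "(\<Union>y b. set (\<sigma> y b)) \<union> set \<rho>"
  have fin: "finite ?V" by simp
  obtain m and e :: "nat \<Rightarrow> 'h" where e: "(\<forall>r<m. \<forall>s<m. cinner (e r) (e s) = kronecker r s) \<and>
      (\<forall>v\<in>?V. v = (\<Sum>r<m. cinner (e r) v *\<^sub>C e r))"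
    using finite_orthonormal_expansion[OF fin] by blast
  have on: "cinner (e r) (e s) = kronecker r s" if "r < m" "s < m" for r s
    using e that by blast
  have ex: "v = (\<Sum>r<m. cinner (e r) v *\<^sub>C e r)" if "v \<in> ?V" for v
    using e that by blast
  let ?W = "\<Union>x a. (\<lambda>r. bop_apply (E x a) (e r)) ` {..<m}"
  have fin': "finite ?W" by simp
  obtain L and e' :: "nat \<Rightarrow> 'h" where e': "(\<forall>r<L. \<forall>s<L. cinner (e' r) (e' s) = kronecker r s) \<and>
      (\<forall>w\<in>?W. w = (\<Sum>r<L. cinner (e' r) w *\<^sub>C e' r))"
    using finite_orthonormal_expansion[OF fin'] by blast
  have ex': "w = (\<Sum>r<L. cinner (e' r) w *\<^sub>C e' r)" if "w \<in> ?W" for w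
    using e' that by blast
  define G where "G x a r l = cinner (e' l) (bop_apply (E x a) (e r))" for x a r l
  have G: "dot L (G x a r) (G x a s) = cinner (e r) (bop_apply (E x a) (e s))" if "s < m" for x a r s
    unfolding EE[of "e r"] G_def by (rule cinner_coordinates[symmetric], rule ex') (use that in auto)
  have Gsum: "(\<Sum>a\<in>UNIV. dot L (G x a r) (G x a s)) = kronecker r s" if "r < m" "s < m" for x r s
    using that by (simp add: G Esum on flip: cinner.sum_right)
  define L' where "L' = (\<Sum>y\<in>UNIV. \<Sum>b\<in>UNIV. length (\<sigma> y b))"
  have len: "length (\<sigma> y b) \<le> L'" for y b
  proof -
    have "length (\<sigma> y b) \<le> (\<Sum>b\<in>UNIV. length (\<sigma> y b))" by (rule member_le_sum) auto
    also have "\<dots> \<le> L'" unfolding L'_def by (rule member_le_sum) auto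
    finally show ?thesis .
  qed
  \<comment> \<open>Lists of different lengths are padded with zeros to a common length \<open>L'\<close>.\<close>
  define H where "H y b r j = (if j < length (\<sigma> y b) then cinner (e r) (\<sigma> y b ! j) else 0)" for y b r j
  have H: "dot L' (H y b r) (H y b s) = (\<Sum>v\<leftarrow>\<sigma> y b. cnj (cinner (e r) v) * cinner (e s) v)" for y b r s
  proof -
    have "dot L' (H y b r) (H y b s)
      = (\<Sum>j<L'. if j < length (\<sigma> y b) then cnj (cinner (e r) (\<sigma> y b ! j)) * cinner (e s) (\<sigma> y b ! j) else 0)"
      unfolding dot_def H_def by (rule sum.cong) auto
    also have "\<dots> = (\<Sum>v\<leftarrow>\<sigma> y b. cnj (cinner (e r) v) * cinner (e s) v)"
      by (rule sum_list_padded[OF len, where f = "\<lambda>v. cnj (cinner (e r) v) * cinner (e s) v"])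
    finally show ?thesis .
  qed
  define \<Gamma> where "\<Gamma> r s = cinner (e s) (blinfun_apply (ensemble_op \<rho>) (e r))" for r s
  have op: "cinner (e s) (blinfun_apply (ensemble_op \<tau>) (e r)) = (\<Sum>v\<leftarrow>\<tau>. cnj (cinner (e r) v) * cinner (e s) v)" for r s \<tau>
    unfolding ensemble_op_apply
    by (induction \<tau>) (simp_all add: cinner_add_right cinner_scaleC_right flip: cinner_commute)
  have Hsum: "(\<Sum>b\<in>UNIV. dot L' (H y b r) (H y b s)) = \<Gamma> r s" for y r s
  proof -
    have "(\<Sum>b\<in>UNIV. dot L' (H y b r) (H y b s)) = cinner (e s) (blinfun_apply (\<Sum>b\<in>UNIV. ensemble_op (\<sigma> y b)) (e r))"
      by (simp only: H op[symmetric] cinner.sum_right blinfun.sum_left)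
    then show ?thesis by (simp only: eq \<Gamma>_def)
  qed
  obtain n c P where P: "\<And>x. mat_pvm n (P x)"
    and Pc: "\<And>x a r s. r < m \<Longrightarrow> s < m \<Longrightarrow> (\<Sum>i<n. \<Sum>j<n. cnj (c r i) * P x a i j * c s j) = dot L (G x a r) (G x a s)"
    using gram_assemblage_dilation[of m L G, OF Gsum] by blast
  obtain n' d Q where Q: "\<And>y. mat_pvm n' (Q y)"
    and Qd: "\<And>y b r s. r < m \<Longrightarrow> s < m \<Longrightarrow> (\<Sum>i<n'. \<Sum>j<n'. cnj (d r i) * Q y b i j * d s j) = dot L' (H y b r) (H y b s)"
    using gram_assemblage_dilation[of m L' H, OF Hsum] by blast
  define \<psi> where "\<psi> = (\<lambda>i j. \<Sum>r<m. c r i * d r j)"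
  have q: "complex_of_real (q x y a b) = (\<Sum>r<m. \<Sum>s<m. dot L (G x a r) (G x a s) * dot L' (H y b r) (H y b s))" for x y a b
  proof -
    have v: "cinner v (bop_apply (E x a) v) = (\<Sum>r<m. \<Sum>s<m. cinner (e r) (bop_apply (E x a) (e s)) * (cnj (cinner (e r) v) * cinner (e s) v))"
      if "v \<in> set (\<sigma> y b)" for v
    proof -
      have lin: "bop_apply T (\<Sum>s<k. f s *\<^sub>C e s) = (\<Sum>s<k. f s *\<^sub>C bop_apply T (e s))" for T :: "'h bop" and f and k :: nat
      proof (induction k)
        case 0
        show ?case using bop_apply_scaleC[of T 0 0] by simp
      qed (simp add: bop_apply_add bop_apply_scaleC)
      let ?s = "\<Sum>r<m. cinner (e r) v *\<^sub>C e r"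
      have "v = ?s" by (rule ex) (use that in auto)
      then have "cinner v (bop_apply (E x a) v) = cinner ?s (bop_apply (E x a) ?s)" by simp
      also have "\<dots> = (\<Sum>r<m. \<Sum>s<m. cnj (cinner (e r) v) * (cinner (e s) v * cinner (e r) (bop_apply (E x a) (e s))))"
        unfolding lin cinner.sum_left cinner_scaleC_left
        by (simp only: cinner.sum_right cinner_scaleC_right sum_distrib_left)
      finally show ?thesis by (simp add: mult_ac)
    qed
    have real: "complex_of_real (Re (cinner v (bop_apply (E x a) v))) = cinner v (bop_apply (E x a) v)" for v
      unfolding EE[of v] cinner_self by simp
    have "complex_of_real (q x y a b) = (\<Sum>v\<leftarrow>\<sigma> y b. cinner v (bop_apply (E x a) v))"
      unfolding q_def ensemble_exp_def by (simp only: sum_list_of_real[symmetric] map_map comp_def real)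
    also have "\<dots> = (\<Sum>v\<leftarrow>\<sigma> y b. \<Sum>r<m. \<Sum>s<m. cinner (e r) (bop_apply (E x a) (e s)) * (cnj (cinner (e r) v) * cinner (e s) v))"
      by (intro arg_cong[of _ _ sum_list] map_cong HOL.refl v)
    also have "\<dots> = (\<Sum>r<m. \<Sum>s<m. \<Sum>v\<leftarrow>\<sigma> y b. cinner (e r) (bop_apply (E x a) (e s)) * (cnj (cinner (e r) v) * cinner (e s) v))"
      by (simp only: sum_list_sum_swap)
    also have "\<dots> = (\<Sum>r<m. \<Sum>s<m. dot L (G x a r) (G x a s) * dot L' (H y b r) (H y b s))"
      by (simp add: G H sum_list_const_mult)
    finally show ?thesis .
  qed
  have total: "(\<Sum>r<m. \<Sum>s<m. kronecker r s * \<Gamma> r s) = 1"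
  proof -
    have "(\<Sum>r<m. \<Sum>s<m. kronecker r s * \<Gamma> r s) = (\<Sum>r<m. \<Gamma> r r)" by (rule sum.cong) auto
    also have "\<dots> = (\<Sum>v\<leftarrow>\<rho>. dot m (\<lambda>r. cinner (e r) v) (\<lambda>r. cinner (e r) v))"
      unfolding \<Gamma>_def op dot_def by (simp only: sum_list_sum_swap)
    also have "\<dots> = (\<Sum>v\<leftarrow>\<rho>. cinner v v)"
      by (intro arg_cong[of _ _ sum_list] map_cong HOL.refl cinner_coordinates[symmetric] ex) auto
    also have "\<dots> = complex_of_real (\<Sum>v\<leftarrow>\<rho>. (norm v)\<^sup>2)"
      unfolding cinner_self by (induction \<rho>) auto
    finally show ?thesis unfolding norm by simp
  qed
  have "0 \<le> Re (cinner v (bop_apply (E x a) v))" for v x a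
    by (subst EE) (simp add: Re_cinner_self)
  then have q0: "0 \<le> q x y a b" for x y a b
    unfolding q_def ensemble_exp_def by (intro sum_list_nonneg) auto
  have qa: "(\<Sum>a\<in>UNIV. q x y a b) = (\<Sum>v\<leftarrow>\<sigma> y b. (norm v)\<^sup>2)" for x y b
  proof -
    have "(\<Sum>a\<in>UNIV. q x y a b) = (\<Sum>v\<leftarrow>\<sigma> y b. \<Sum>a\<in>UNIV. Re (cinner v (bop_apply (E x a) v)))"
      unfolding q_def ensemble_exp_def by (simp only: sum_list_sum_swap)
    also have "\<dots> = (\<Sum>v\<leftarrow>\<sigma> y b. (norm v)\<^sup>2)"
      by (simp add: Esum Re_cinner_self flip: cinner.sum_right Re_sum)
    finally show ?thesis .
  qed
  have qb: "complex_of_real (\<Sum>b\<in>UNIV. q x y a b) = (\<Sum>r<m. \<Sum>s<m. dot L (G x a r) (G x a s) * \<Gamma> r s)" for x y a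
  proof -
    have "(\<Sum>b\<in>UNIV. complex_of_real (q x y a b)) = (\<Sum>r<m. \<Sum>s<m. \<Sum>b\<in>UNIV. dot L (G x a r) (G x a s) * dot L' (H y b r) (H y b s))"
      unfolding q by (subst sum.swap, rule sum.cong[OF HOL.refl], rule sum.swap)
    then show ?thesis by (simp add: Hsum flip: sum_distrib_left)
  qed
  have qab: "(\<Sum>a\<in>UNIV. \<Sum>b\<in>UNIV. q x y a b) = 1" for x y
  proof -
    have "complex_of_real (\<Sum>a\<in>UNIV. \<Sum>b\<in>UNIV. q x y a b) = (\<Sum>a\<in>UNIV. complex_of_real (\<Sum>b\<in>UNIV. q x y a b))"
      by (rule of_real_sum)
    also have "\<dots> = (\<Sum>a\<in>UNIV. \<Sum>r<m. \<Sum>s<m. dot L (G x a r) (G x a s) * \<Gamma> r s)"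
      by (simp only: qb)
    also have "\<dots> = (\<Sum>r<m. \<Sum>s<m. \<Sum>a\<in>UNIV. dot L (G x a r) (G x a s) * \<Gamma> r s)"
      by (subst sum.swap, rule sum.cong[OF HOL.refl], rule sum.swap)
    also have "\<dots> = (\<Sum>r<m. \<Sum>s<m. kronecker r s * \<Gamma> r s)"
      by (intro sum.cong HOL.refl) (simp only: Gsum lessThan_iff flip: sum_distrib_right)
    finally show ?thesis using total by (simp only: of_real_eq_1_iff)
  qed
  have "q \<in> C_ns"
    unfolding C_ns_def
  proof (intro CollectI conjI allI)
    fix x x' :: 'x and y y' :: 'y and a b
    show "0 \<le> q x y a b" by (rule q0)
    have "q x y a b \<le> (\<Sum>b\<in>UNIV. q x y a b)" by (rule member_le_sum) (auto simp: q0)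
    also have "\<dots> \<le> (\<Sum>a\<in>UNIV. \<Sum>b\<in>UNIV. q x y a b)" by (rule member_le_sum) (auto simp: q0 sum_nonneg)
    finally show "q x y a b \<le> 1" by (simp add: qab)
    have "complex_of_real (\<Sum>b\<in>UNIV. q x y a b) = complex_of_real (\<Sum>b\<in>UNIV. q x y' a b)"
      by (simp only: qb)
    then show "(\<Sum>b\<in>UNIV. q x y a b) = (\<Sum>b\<in>UNIV. q x y' a b)"
      by (simp only: of_real_eq_iff)
    show "(\<Sum>a\<in>UNIV. q x y a b) = (\<Sum>a\<in>UNIV. q x' y a b)" by (simp add: qa)
    show "(\<Sum>(a, b)\<in>UNIV. q x y a b) = 1"
      using qab[of x y] by (simp add: sum.cartesian_product)
  qed
  moreover have "complex_of_real (q x y a b) = tensor_expectation n n' \<psi> (P x a) (Q y b)" for x y a b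
    unfolding q \<psi>_def tensor_expectation_sum_of_products
    by (intro sum.cong HOL.refl) (simp only: Pc Qd lessThan_iff)
  moreover have "(\<Sum>i<n. \<Sum>j<n'. (cmod (\<psi> i j))\<^sup>2) = 1"
  proof -
    have marg: "(\<Sum>i<k. \<Sum>j<k. cnj (u i) * kronecker i j * w j) = (\<Sum>a\<in>UNIV. \<Sum>i<k. \<Sum>j<k. cnj (u i) * R a i j * w j)"
      if "mat_pvm k R" for k u w and R :: "'z::finite \<Rightarrow> cmat"
    proof -
      have "(\<Sum>a\<in>UNIV. \<Sum>i<k. \<Sum>j<k. cnj (u i) * R a i j * w j) = (\<Sum>i<k. \<Sum>j<k. \<Sum>a\<in>UNIV. cnj (u i) * R a i j * w j)"
        by (subst sum.swap, rule sum.cong[OF HOL.refl], rule sum.swap)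
      also have "\<dots> = (\<Sum>i<k. \<Sum>j<k. cnj (u i) * (\<Sum>a\<in>UNIV. R a i j) * w j)"
        by (simp only: sum_distrib_left sum_distrib_right)
      also have "\<dots> = (\<Sum>i<k. \<Sum>j<k. cnj (u i) * kronecker i j * w j)"
        by (intro sum.cong HOL.refl) (use that in \<open>simp add: mat_pvm_def\<close>)
      finally show ?thesis by simp
    qed
    have "complex_of_real (\<Sum>i<n. \<Sum>j<n'. (cmod (\<psi> i j))\<^sup>2) = (\<Sum>i<n. \<Sum>j<n'. cnj (\<psi> i j) * \<psi> i j)"
      by (simp add: complex_norm_square mult.commute del: of_real_power)
    also have "\<dots> = tensor_expectation n n' \<psi> kronecker kronecker"
    proof -
      have "(\<Sum>k<n. \<Sum>l<n'. kronecker i k * kronecker j l * \<psi> k l) = \<psi> i j" if "i < n" "j < n'" for i j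
        using that by (simp add: mult.assoc flip: sum_distrib_left)
      then show ?thesis unfolding tensor_expectation_def by (intro sum.cong HOL.refl) simp
    qed
    also have "\<dots> = (\<Sum>r<m. \<Sum>s<m. (\<Sum>a\<in>UNIV. dot L (G undefined a r) (G undefined a s)) * (\<Sum>b\<in>UNIV. dot L' (H undefined b r) (H undefined b s)))"
      unfolding \<psi>_def tensor_expectation_sum_of_products marg[OF P[of undefined]] marg[OF Q[of undefined]]
      by (intro sum.cong HOL.refl arg_cong2[of _ _ _ _ "(*)"]) (simp_all only: Pc Qd lessThan_iff)
    also have "\<dots> = (\<Sum>r<m. \<Sum>s<m. kronecker r s * \<Gamma> r s)"
      by (intro sum.cong HOL.refl) (simp only: Gsum Hsum lessThan_iff)
    finally show ?thesis using total by (simp only: of_real_eq_1_iff)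
  qed
  ultimately have "q \<in> C_q"
    using P Q unfolding C_q_def by blast
  then show ?thesis by (simp only: q_def[abs_def])
qed

section \<open>Positive operators and states\<close>

definition pos_bop :: "'h::chilbert_space bop \<Rightarrow> bool" where
  "pos_bop A \<longleftrightarrow> star A = A \<and> (\<forall>v. 0 \<le> Re (cinner v (bop_apply A v)))"

lemma bop_bound_nonneg:
  fixes A :: "'h::chilbert_space bop"
  obtains K where "K \<ge> 0" and "\<And>v. norm (bop_apply A v) \<le> K * norm v"
    and "\<And>v. \<bar>Re (cinner v (bop_apply A v))\<bar> \<le> K * (norm v)\<^sup>2"
proof -
  obtain K where K: "\<And>v. norm (bop_apply A v) \<le> K * norm v" using bop_apply_bound[of A] by blast
  have K': "norm (bop_apply A v) \<le> \<bar>K\<bar> * norm v" for v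
    using K[of v] by (smt (verit) mult_right_mono norm_ge_zero)
  have K'': "\<bar>Re (cinner v (bop_apply A v))\<bar> \<le> \<bar>K\<bar> * (norm v)\<^sup>2" for v
  proof -
    have "\<bar>Re (cinner v (bop_apply A v))\<bar> \<le> norm v * norm (bop_apply A v)"
      using abs_Re_le_cmod cinner_Cauchy_Schwarz order_trans by blast
    also have "\<dots> \<le> norm v * (\<bar>K\<bar> * norm v)" by (rule mult_left_mono[OF K']) simp
    finally show ?thesis by (simp add: power2_eq_square mult_ac)
  qed
  show ?thesis by (rule that[OF _ K' K'']) simp
qed

lemma star_eq_self_iff: "star A = A \<longleftrightarrow> (\<forall>u v. cinner (bop_apply A u) v = cinner u (bop_apply A v))"
  (is "_ \<longleftrightarrow> ?R")
proof
  show ?R if "star A = A" using cinner_star_left[of A] by (simp add: that)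
  show "star A = A" if ?R
    by (rule bop_eqI, rule cinner_eqI') (simp add: cinner_star_left that)
qed

text \<open>Polarization writes \<open>4 R v w\<close> as \<open>R (v + w) (v + w) - R (v - w) (v - w)\<close>, and the parallelogram law bounds
this by \<open>4 M\<close> for unit vectors; hence no constant is lost.\<close>

lemma real_form_polarization:
  fixes R :: "'h::chilbert_space \<Rightarrow> 'h \<Rightarrow> real"
  assumes add: "\<And>v w w'. R v (w + w') = R v w + R v w'"
    and scale: "\<And>v w r. R v (r *\<^sub>R w) = r * R v w"
    and sym: "\<And>v w. R v w = R w v"
    and bound: "\<And>v. \<bar>R v v\<bar> \<le> M * (norm v)\<^sup>2"
  shows "\<bar>R v w\<bar> \<le> M * norm v * norm w"
proof -
  have zero: "R v 0 = 0" for v using scale[of v 0 0] by simp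
  have minus: "R v (- w) = - R v w" for v w using scale[of v "-1" w] by simp
  have unit: "\<bar>R v w\<bar> \<le> M" if "norm v = 1" "norm w = 1" for v w
  proof -
    have "4 * R v w = R (v + w) (v + w) - R (v - w) (v - w)"
    proof -
      have "R (v + w) (v + w) = R v v + 2 * R v w + R w w"
        using add[of "v + w" v w] sym[of "v + w" v] sym[of "v + w" w] add[of v v w] add[of w v w] sym[of w v] by simp
      moreover have "R (v - w) (v - w) = R v v - 2 * R v w + R w w"
        using add[of "v - w" v "- w"] sym[of "v - w" v] sym[of "v - w" w] add[of v v "- w"] add[of w v "- w"] sym[of w v]
          minus[of "v - w" w] minus[of v w] minus[of w w] by simp
      ultimately show ?thesis by simp
    qed
    moreover have "(norm (v + w))\<^sup>2 + (norm (v - w))\<^sup>2 = 4"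
      using norm_add_square[of v w] norm_add_square[of v "- w"] that by (simp add: cinner_minus_right)
    then have "M * (norm (v + w))\<^sup>2 + M * (norm (v - w))\<^sup>2 = 4 * M"
      by (simp flip: distrib_left)
    ultimately show ?thesis using bound[of "v + w"] bound[of "v - w"] by linarith
  qed
  show ?thesis
  proof (cases "v = 0 \<or> w = 0")
    case True
    then show ?thesis using zero[of v] zero[of w] sym[of v w] by auto
  next
    case False
    define v' w' where "v' = inverse (norm v) *\<^sub>R v" and "w' = inverse (norm w) *\<^sub>R w"
    have v: "v = norm v *\<^sub>R v'" and w: "w = norm w *\<^sub>R w'" and n: "norm v' = 1" "norm w' = 1"
      using False by (auto simp: v'_def w'_def)
    have "R v w = norm w * R v w'" using scale[of v "norm w" w'] w by simp
    also have "R v w' = norm v * R v' w'"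
      using scale[of w' "norm v" v'] v sym[of v w'] sym[of v' w'] by simp
    finally have "\<bar>R v w\<bar> = norm v * norm w * \<bar>R v' w'\<bar>" by (simp add: abs_mult)
    also have "\<dots> \<le> norm v * norm w * M" by (intro mult_left_mono unit n) simp
    finally show ?thesis by (simp add: mult_ac)
  qed
qed

text \<open>A quadratic form that is only known through its real polar form \<open>R\<close> is that of a bounded self-adjoint
operator: invariance under multiplication of both arguments by \<open>\<i>\<close> makes
\<open>s v w = R v w - \<i> R v (\<i> w)\<close> a sesquilinear hermitian form, which the Riesz theorem represents.\<close>

lemma bop_of_bounded_real_form:
  fixes R :: "'h::chilbert_space \<Rightarrow> 'h \<Rightarrow> real"
  assumes add: "\<And>v w w'. R v (w + w') = R v w + R v w'"
    and scale: "\<And>v w r. R v (r *\<^sub>R w) = r * R v w"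
    and sym: "\<And>v w. R v w = R w v"
    and rot: "\<And>v w. R (\<i> *\<^sub>C v) (\<i> *\<^sub>C w) = R v w"
    and bound: "\<And>v. \<bar>R v v\<bar> \<le> M * (norm v)\<^sup>2"
  shows "\<exists>T. star T = T \<and> (\<forall>v. Re (cinner v (bop_apply T v)) = R v v)"
proof -
  have minus: "R v (- w) = - R v w" for v w using scale[of v "-1" w] by simp
  have ii: "\<i> *\<^sub>C \<i> *\<^sub>C w = - w" for w :: 'h by simp
  have rot': "R (\<i> *\<^sub>C v) w = - R v (\<i> *\<^sub>C w)" for v w
    using rot[of v "\<i> *\<^sub>C w"] minus[of "\<i> *\<^sub>C v" w] by (simp only: ii)
  define s where "s v w = Complex (R v w) (- R v (\<i> *\<^sub>C w))" for v w
  have decomp: "c *\<^sub>C w = Re c *\<^sub>R w + Im c *\<^sub>R (\<i> *\<^sub>C w)" for c and w :: 'h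
    by (subst complex_eq[of c]) (simp add: scaleC_add_left mult.commute flip: of_real_scaleC_vec)
  have s_add: "s v (w + w') = s v w + s v w'" for v w w'
    by (simp add: s_def add scaleC_add_right complex_eq_iff)
  have s_scale: "s v (c *\<^sub>C w) = c * s v w" for v w c
  proof -
    have 1: "R v (c *\<^sub>C w) = Re c * R v w + Im c * R v (\<i> *\<^sub>C w)"
      by (subst decomp) (simp only: add scale)
    have "\<i> *\<^sub>C (c *\<^sub>C w) = Re c *\<^sub>R (\<i> *\<^sub>C w) + Im c *\<^sub>R (- w)"
      by (subst decomp[of c w]) (simp add: scaleC_add_right scaleC.scaleR_right)
    then have 2: "R v (\<i> *\<^sub>C (c *\<^sub>C w)) = Re c * R v (\<i> *\<^sub>C w) - Im c * R v w"
      by (simp only: add scale minus)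
    show ?thesis unfolding s_def 1 2 by (simp add: complex_eq_iff)
  qed
  have s_cnj: "s w v = cnj (s v w)" for v w
    using rot'[of v w] by (simp add: s_def complex_eq_iff sym[of w])
  have s_bound: "cmod (s v w) \<le> (2 * \<bar>M\<bar> * norm v) * norm w" for v w
  proof -
    have M: "M * a \<le> \<bar>M\<bar> * a" if "a \<ge> 0" for a :: real using that by (simp add: mult_right_mono)
    have b: "\<bar>R v w\<bar> \<le> \<bar>M\<bar> * norm v * norm w" for v w
      by (rule real_form_polarization[OF add scale sym]) (rule order_trans[OF bound M], simp)
    have "cmod (s v w) \<le> \<bar>R v w\<bar> + \<bar>R v (\<i> *\<^sub>C w)\<bar>"
      using cmod_le[of "s v w"] by (simp add: s_def)
    also have "\<dots> \<le> \<bar>M\<bar> * norm v * norm w + \<bar>M\<bar> * norm v * norm w"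
      using b[of v w] b[of v "\<i> *\<^sub>C w"] by (simp add: norm_scaleC_vec)
    finally show ?thesis by simp
  qed
  have "\<exists>z. \<forall>w. s v w = cinner z w" for v
    by (rule riesz_representation[OF s_add s_scale s_bound])
  then obtain g where g: "\<And>v w. s v w = cinner (g v) w" by metis
  have "\<exists>T. \<forall>v. bop_apply T v = g v"
  proof (rule bop_exI[where K = "2 * \<bar>M\<bar>"])
    show "g (v + w) = g v + g w" for v w
    proof (rule cinner_eqI')
      show "cinner (g (v + w)) u = cinner (g v + g w) u" for u
        using s_cnj[of "v + w" u] s_cnj[of v u] s_cnj[of w u] s_add[of u v w]
        by (simp add: cinner_add_left flip: g)
    qed
    show "g (c *\<^sub>C v) = c *\<^sub>C g v" for c v
    proof (rule cinner_eqI')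
      show "cinner (g (c *\<^sub>C v)) u = cinner (c *\<^sub>C g v) u" for u
        using s_cnj[of "c *\<^sub>C v" u] s_cnj[of v u] s_scale[of u c v]
        by (simp add: cinner_scaleC_left flip: g)
    qed
    show "norm (g v) \<le> 2 * \<bar>M\<bar> * norm v" for v
    proof (cases "g v = 0")
      case False
      have "norm (g v) * norm (g v) = cmod (s v (g v))"
        unfolding g by (simp add: cinner_self norm_power power2_eq_square norm_mult)
      also have "\<dots> \<le> (2 * \<bar>M\<bar> * norm v) * norm (g v)" by (rule s_bound)
      finally show ?thesis using False by simp
    qed simp
  qed
  then obtain T where T: "\<And>v. bop_apply T v = g v" by blast
  have T': "cinner (bop_apply T v) w = s v w" "cinner v (bop_apply T w) = s v w" for v w
    using s_cnj[of v w] g[of w v] cinner_commute[of v "g w"] by (simp_all add: T g)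
  have "star T = T" by (simp add: star_eq_self_iff T')
  moreover have "Re (cinner v (bop_apply T v)) = R v v" for v by (simp add: T') (simp add: s_def)
  ultimately show ?thesis by blast
qed

lemma norm_le_numerical_radius:
  assumes A: "star A = A" and q: "\<And>v. \<bar>Re (cinner v (bop_apply A v))\<bar> \<le> q * (norm v)\<^sup>2"
  shows "norm (bop_apply A v) \<le> q * norm v"
proof (cases "bop_apply A v = 0")
  case True
  have "0 \<le> q * (norm v)\<^sup>2" using q[of v] abs_ge_zero order_trans by blast
  then show ?thesis using True by (cases "v = 0") (auto simp: zero_le_mult_iff)
next
  case False
  let ?R = "\<lambda>u v. Re (cinner u (bop_apply A v))"
  have "\<bar>?R (bop_apply A v) v\<bar> \<le> q * norm (bop_apply A v) * norm v"
  proof (rule real_form_polarization[where R = ?R])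
    show "?R u w = ?R w u" for u w
      using A cinner_commute[of u "bop_apply A w"] by (simp add: star_eq_self_iff)
    show "?R u (w + w') = ?R u w + ?R u w'" for u w w' by (simp add: bop_apply_add cinner_add_right)
    show "?R u (r *\<^sub>R w) = r * ?R u w" for u w r
      by (simp add: bop_apply_scaleC cinner_scaleC_right flip: of_real_scaleC_vec)
  qed (rule q)
  then show ?thesis using False by (simp add: Re_cinner_self power2_eq_square mult_ac)
qed

text \<open>A self-adjoint \<open>C = 1 - Y\<close> with \<open>C\<^sup>2 = 1 - X\<close> is a solution of \<open>Y = (X + Y\<^sup>2) / 2\<close>.  For \<open>\<parallel>X\<parallel> \<le> q < 1\<close> the
right-hand side is a contraction with constant \<open>q\<close> on the symmetric operators of norm at most \<open>q\<close>.\<close>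

lemma sqrt_one_minus:
  fixes X :: "'h::chilbert_space bop"
  assumes X: "star X = X" and q: "0 \<le> q" "q < 1"
    and le: "\<And>v. \<bar>Re (cinner v (bop_apply X v))\<bar> \<le> q * (norm v)\<^sup>2"
  shows "\<exists>C. star C * C = 1 - X"
proof -
  define S :: "('h \<Rightarrow>\<^sub>L 'h) set" where
    "S = {Y. norm Y \<le> q \<and> (\<forall>u v. cinner (blinfun_apply Y u) v = cinner u (blinfun_apply Y v))}"
  define f where "f Y = (1/2) *\<^sub>R (Rep_bop X + (Y o\<^sub>L Y))" for Y
  have X_norm: "norm (Rep_bop X) \<le> q"
    by (rule norm_blinfun_bound[OF q(1)]) (rule norm_le_numerical_radius[OF X le, unfolded bop_apply.rep_eq])
  \<comment> \<open>Symmetry is a closed condition; it also enforces complex linearity of the fixed point.\<close>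
  have "S = cball 0 q \<inter> (\<Inter>u v. {Y. cinner (blinfun_apply Y u) v = cinner u (blinfun_apply Y v)})"
    by (auto simp: S_def)
  also have "closed \<dots>"
    by (intro closed_Int closed_cball closed_INT ballI closed_Collect_eq linear_continuous_on
        bounded_linear_compose[OF cinner.bounded_linear_left blinfun.bounded_linear_left]
        bounded_linear_compose[OF cinner.bounded_linear_right blinfun.bounded_linear_left])
  finally have "complete S" by (simp add: complete_eq_closed)
  moreover have "S \<noteq> {}" using q by (auto simp: S_def intro!: exI[of _ 0])
  moreover have "f ` S \<subseteq> S"
  proof safe
    fix Y assume Y: "Y \<in> S"
    have YY: "norm (Y o\<^sub>L Y) \<le> q * q"
      using norm_blinfun_compose[of Y Y] Y by (smt (verit, best) S_def mem_Collect_eq mult_mono norm_ge_zero)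
    have "norm (f Y) \<le> (q + q * q) / 2"
      using norm_triangle_ineq[of "Rep_bop X" "Y o\<^sub>L Y"] X_norm YY by (simp add: f_def)
    also have "\<dots> \<le> q" using q mult_left_le[of q q] by simp
    finally have "norm (f Y) \<le> q" .
    moreover have "cinner (blinfun_apply (f Y) u) v = cinner u (blinfun_apply (f Y) v)" for u v
      using Y X by (simp add: S_def f_def star_eq_self_iff bop_apply.rep_eq blinfun.bilinear_simps
          cinner.bilinear_simps)
    ultimately show "f Y \<in> S" by (simp add: S_def)
  qed
  moreover have "\<forall>Y\<in>S. \<forall>Z\<in>S. dist (f Y) (f Z) \<le> q * dist Y Z"
  proof (intro ballI)
    fix Y Z assume YZ: "Y \<in> S" "Z \<in> S"
    have "f Y - f Z = (1/2) *\<^sub>R ((Y o\<^sub>L (Y - Z)) + ((Y - Z) o\<^sub>L Z))"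
      by (rule blinfun_eqI) (simp add: f_def blinfun.bilinear_simps algebra_simps)
    then have "norm (f Y - f Z) = norm ((Y o\<^sub>L (Y - Z)) + ((Y - Z) o\<^sub>L Z)) / 2" by simp
    also have "\<dots> \<le> (norm Y * norm (Y - Z) + norm (Y - Z) * norm Z) / 2"
      using norm_triangle_ineq[of "Y o\<^sub>L (Y - Z)" "(Y - Z) o\<^sub>L Z"] norm_blinfun_compose[of Y "Y - Z"]
        norm_blinfun_compose[of "Y - Z" Z] by simp
    also have "\<dots> \<le> (q * norm (Y - Z) + norm (Y - Z) * q) / 2"
      using YZ by (intro divide_right_mono add_mono mult_left_mono mult_right_mono) (auto simp: S_def)
    finally show "dist (f Y) (f Z) \<le> q * dist Y Z" by (simp add: dist_norm mult.commute)
  qed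
  ultimately obtain Y where Y: "Y \<in> S" "f Y = Y" using Banach_fix[of S q f] q by blast
  have sym: "cinner (blinfun_apply Y u) v = cinner u (blinfun_apply Y v)" for u v
    using Y by (simp add: S_def)
  have "blinfun_apply Y (c *\<^sub>C u) = c *\<^sub>C blinfun_apply Y u" for c u
    by (rule cinner_eqI') (simp add: sym cinner_scaleC_left)
  then have T: "bop_apply (Abs_bop Y) = blinfun_apply Y" by (simp add: bop_apply.rep_eq Abs_bop_inverse)
  define C where "C = 1 - Abs_bop Y"
  have "star C = C"
    by (simp add: star_eq_self_iff C_def T sym cinner_diff_left cinner_diff_right)
  moreover have "C * C = 1 - X"
  proof (rule bop_eqI)
    fix v
    have "blinfun_apply (2 *\<^sub>R f Y) v = bop_apply X v + blinfun_apply Y (blinfun_apply Y v)"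
      by (simp add: f_def bop_apply.rep_eq blinfun.bilinear_simps)
    then have "2 *\<^sub>R blinfun_apply Y v = bop_apply X v + blinfun_apply Y (blinfun_apply Y v)"
      by (simp add: Y blinfun.bilinear_simps)
    then show "bop_apply (C * C) v = bop_apply (1 - X) v"
      by (simp add: C_def T blinfun.bilinear_simps scaleR_2 algebra_simps)
  qed
  ultimately show ?thesis by metis
qed

text \<open>Positivity of a state is stated for elements \<open>x\<^sup>* x\<close>.  For a positive form it follows from a square
root of \<open>A + e\<close> with \<open>e > 0\<close>: after division by a bound \<open>c\<close> this operator is \<open>1 - X\<close> with
\<open>\<parallel>X\<parallel> < 1\<close>.\<close>

lemma state_pos_bop:
  fixes \<omega> :: "'h::chilbert_space bop \<Rightarrow> complex"
  assumes \<omega>: "state_on UNIV \<omega>" and A: "pos_bop A"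
  shows "\<omega> A \<in> \<real>\<^sub>\<ge>\<^sub>0"
proof -
  obtain K where K: "K \<ge> 0" "\<And>v. \<bar>Re (cinner v (bop_apply A v))\<bar> \<le> K * (norm v)\<^sup>2"
    by (rule bop_bound_nonneg[of A]) blast
  have eps: "\<omega> A + of_real e \<in> \<real>\<^sub>\<ge>\<^sub>0" if e: "e > 0" for e
  proof -
    define c where "c = K + e"
    have c: "c > 0" using K(1) e by (simp add: c_def)
    define X where "X = 1 - of_real (inverse c) *\<^sub>C (A + of_real e *\<^sub>C 1)"
    have "\<exists>C. star C * C = 1 - X"
    proof (rule sqrt_one_minus[where q = "K / c"])
      show "star X = X" using A
        by (simp add: X_def pos_bop_def star_eq_self_iff cinner.bilinear_simps
            cinner_scaleC_left cinner_scaleC_right)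
      show "0 \<le> K / c" "K / c < 1" using K(1) e c by (auto simp: c_def)
      fix v
      define a where "a = Re (cinner v (bop_apply A v))"
      have a: "0 \<le> a" "a \<le> K * (norm v)\<^sup>2" using A K(2)[of v] by (auto simp: a_def pos_bop_def)
      have "Re (cinner v (bop_apply X v)) = (norm v)\<^sup>2 - (a + e * (norm v)\<^sup>2) / c"
        by (simp add: X_def a_def cinner.bilinear_simps cinner_scaleC_right Re_cinner_self divide_inverse mult.commute
            del: of_real_inverse) (simp add: algebra_simps)
      also have "\<dots> = (K * (norm v)\<^sup>2 - a) / c"
        using c by (simp add: field_simps) (simp add: c_def algebra_simps)
      finally show "\<bar>Re (cinner v (bop_apply X v))\<bar> \<le> K / c * (norm v)\<^sup>2"
        using a c by (simp add: divide_right_mono)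
    qed
    then obtain C where "star C * C = 1 - X" by blast
    then have C: "of_real c *\<^sub>C (star C * C) = A + of_real e *\<^sub>C 1"
      using c by (simp add: X_def flip: of_real_mult)
    have "of_real c * \<omega> (star C * C) = \<omega> A + of_real e"
      using \<omega> C unfolding state_on_def by (metis UNIV_I mult.right_neutral)
    moreover have "of_real c * \<omega> (star C * C) \<in> \<real>\<^sub>\<ge>\<^sub>0"
      using \<omega> c by (intro nonneg_Reals_mult_I) (auto simp: state_on_def)
    ultimately show ?thesis by simp
  qed
  have "Im (\<omega> A) = 0" using eps[of 1] by (simp add: complex_nonneg_Reals_iff)
  moreover have "0 \<le> Re (\<omega> A)"
  proof (rule field_le_epsilon)
    show "0 \<le> Re (\<omega> A) + e" if "e > 0" for e using eps[OF that] by (simp add: complex_nonneg_Reals_iff)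
  qed
  ultimately show ?thesis by (simp add: complex_nonneg_Reals_iff)
qed

section \<open>Duality for assemblages of ensembles\<close>

lemma ensemble_op_simps [simp]:
  "ensemble_op [] = 0" "ensemble_op (\<sigma> @ \<tau>) = ensemble_op \<sigma> + ensemble_op \<tau>"
  "ensemble_op [v] = rank_one v v"
  by (simp_all add: ensemble_op_def)

lemma ensemble_exp_simps [simp]:
  "ensemble_exp [] T = 0" "ensemble_exp (\<sigma> @ \<tau>) T = ensemble_exp \<sigma> T + ensemble_exp \<tau> T"
  "ensemble_exp [v] T = Re (cinner v (bop_apply T v))"
  by (simp_all add: ensemble_exp_def)

lemma rank_one_scaleR: "rank_one (r *\<^sub>R v) (r *\<^sub>R v) = (r * r) *\<^sub>R rank_one v v"
  by (rule blinfun_eqI) (simp add: blinfun.bilinear_simps cinner.scaleR_left scaleC.scaleR_left scaleC.scaleR_right)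

lemma rank_one_add_left: "rank_one (v + v') w = rank_one v w + rank_one v' w"
  by (rule blinfun_eqI) (simp add: blinfun.bilinear_simps scaleC_add_right)

lemma rank_one_add_right: "rank_one v (w + w') = rank_one v w + rank_one v w'"
  by (rule blinfun_eqI) (simp add: blinfun.bilinear_simps cinner_add_left scaleC_add_left)

lemma rank_one_scaleR_left: "rank_one (r *\<^sub>R v) w = r *\<^sub>R rank_one v w"
  by (rule blinfun_eqI) (simp add: blinfun.bilinear_simps scaleC.scaleR_right)

lemma rank_one_scaleR_right: "rank_one v (r *\<^sub>R w) = r *\<^sub>R rank_one v w"
  by (rule blinfun_eqI) (simp add: blinfun.bilinear_simps cinner.scaleR_left scaleC.scaleR_left)

lemma rank_one_rotate: "rank_one (\<i> *\<^sub>C v) (\<i> *\<^sub>C w) = rank_one v w"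
proof (rule blinfun_eqI)
  fix u
  have "cnj \<i> * cinner w u * \<i> = cinner w u" by (simp add: complex_eq_iff)
  then show "blinfun_apply (rank_one (\<i> *\<^sub>C v) (\<i> *\<^sub>C w)) u = blinfun_apply (rank_one v w) u"
    by (simp only: rank_one_apply cinner_scaleC_left scaleC_scaleC)
qed

definition scale_ensemble :: "real \<Rightarrow> 'h::chilbert_space list \<Rightarrow> 'h list" where
  "scale_ensemble c \<sigma> = map (\<lambda>v. sqrt c *\<^sub>R v) \<sigma>"

lemma scale_ensemble:
  assumes "c \<ge> 0"
  shows "ensemble_op (scale_ensemble c \<sigma>) = c *\<^sub>R ensemble_op \<sigma>"
    and "ensemble_exp (scale_ensemble c \<sigma>) T = c * ensemble_exp \<sigma> T"
proof -
  show "ensemble_op (scale_ensemble c \<sigma>) = c *\<^sub>R ensemble_op \<sigma>"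
    using assms by (induction \<sigma>) (simp_all add: scale_ensemble_def ensemble_op_def rank_one_scaleR scaleR_add_right)
  have "bop_apply T (sqrt c *\<^sub>R v) = sqrt c *\<^sub>R bop_apply T v" for v
    by (simp add: bop_apply_scaleC flip: of_real_scaleC_vec)
  then have "Re (cinner (sqrt c *\<^sub>R v) (bop_apply T (sqrt c *\<^sub>R v))) = c * Re (cinner v (bop_apply T v))" for v
    using assms by (simp add: cinner.scaleR_left cinner.scaleR_right)
  then show "ensemble_exp (scale_ensemble c \<sigma>) T = c * ensemble_exp \<sigma> T"
    by (induction \<sigma>) (simp_all add: scale_ensemble_def ensemble_exp_def distrib_left)
qed

lemma ensemble_exp_one: "ensemble_exp \<sigma> 1 = (\<Sum>v\<leftarrow>\<sigma>. (norm v)\<^sup>2)"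
  by (simp add: ensemble_exp_def Re_cinner_self)

lemma sum_indicator_ensemble:
  fixes b0 :: "'b::finite"
  shows "(\<Sum>b\<in>UNIV. ensemble_op (if Q \<and> b = b0 then [v] else [])) = (if Q then rank_one v v else 0)"
    and "(\<Sum>b\<in>UNIV. ensemble_exp (if Q \<and> b = b0 then [v] else []) (T b)) =
      (if Q then Re (cinner v (bop_apply (T b0) v)) else 0)"
proof -
  have "(\<Sum>b\<in>UNIV. ensemble_op (if Q \<and> b = b0 then [v] else [])) = (\<Sum>b\<in>UNIV. if b = b0 then if Q then rank_one v v else 0 else 0)"
    by (rule sum.cong) auto
  then show "(\<Sum>b\<in>UNIV. ensemble_op (if Q \<and> b = b0 then [v] else [])) = (if Q then rank_one v v else 0)"
    by simp
  have "(\<Sum>b\<in>UNIV. ensemble_exp (if Q \<and> b = b0 then [v] else []) (T b))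
      = (\<Sum>b\<in>UNIV. if b = b0 then if Q then Re (cinner v (bop_apply (T b) v)) else 0 else 0)"
    by (rule sum.cong) auto
  then show "(\<Sum>b\<in>UNIV. ensemble_exp (if Q \<and> b = b0 then [v] else []) (T b)) =
      (if Q then Re (cinner v (bop_apply (T b0) v)) else 0)"
    by simp
qed

text \<open>Strong duality for the semidefinite program that maximises \<open>\<Sum>\<^sub>y\<^sub>b tr (\<sigma> y b) (G y b)\<close> over the
assemblages \<open>\<Sum>\<^sub>b \<sigma> y b = \<rho>\<close> with \<open>tr \<rho> = 1\<close>.  The dual variables \<open>Z y\<close> dominate the \<open>G y b\<close>, and the dual
value is the supremum of the quadratic form of \<open>\<Sum> Z y\<close>.

Let the constraint be violated by \<open>D y = \<Sum>\<^sub>b \<sigma> y b - \<rho>\<close> and let \<open>p D\<close> be the infimum of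
\<open>\<gamma> tr \<rho> - \<Sum> tr (\<sigma> y b) (G y b)\<close> for the given violation.  Then \<open>p\<close> is sublinear, and finite since
\<open>p 0 \<ge> 0\<close> is the hypothesis.  A linear \<open>l \<le> p\<close> has the form \<open>- \<Sum>\<^sub>y tr (Z y) (D y)\<close>: the assemblage with
the single entry \<open>\<sigma> y b = |v\<rangle>\<langle>v|\<close> gives \<open>\<langle>v, Z y v\<rangle> \<ge> \<langle>v, G y b v\<rangle>\<close>, and \<open>\<rho> = |v\<rangle>\<langle>v|\<close> alone gives
\<open>\<Sum> \<langle>v, Z y v\<rangle> \<le> \<gamma> \<langle>v, v\<rangle>\<close>.  These two bounds make the forms bounded, hence operators.\<close>

theorem ensemble_duality:
  fixes G :: "'y::finite \<Rightarrow> 'b::finite \<Rightarrow> 'h::chilbert_space bop"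
  assumes G: "\<And>y b. star (G y b) = G y b"
    and le: "\<And>\<sigma> \<rho>. (\<And>y. (\<Sum>b\<in>UNIV. ensemble_op (\<sigma> y b)) = ensemble_op \<rho>) \<Longrightarrow>
      (\<Sum>y\<in>UNIV. \<Sum>b\<in>UNIV. ensemble_exp (\<sigma> y b) (G y b)) \<le> \<gamma> * ensemble_exp \<rho> 1"
  shows "\<exists>Z. (\<forall>y b. pos_bop (Z y - G y b)) \<and> pos_bop (of_real \<gamma> *\<^sub>C 1 - (\<Sum>y\<in>UNIV. Z y))"
proof -
  define F :: "('h \<Rightarrow>\<^sub>L 'h) ^ 'y \<Rightarrow> ('h list \<times> ('y \<Rightarrow> 'b \<Rightarrow> 'h list)) set" where
    "F D = {(\<rho>, \<sigma>). \<forall>y. (\<Sum>b\<in>UNIV. ensemble_op (\<sigma> y b)) - ensemble_op \<rho> = D $ y}" for D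
  define val :: "'h list \<times> ('y \<Rightarrow> 'b \<Rightarrow> 'h list) \<Rightarrow> real" where
    "val = (\<lambda>(\<rho>, \<sigma>). \<gamma> * ensemble_exp \<rho> 1 - (\<Sum>y\<in>UNIV. \<Sum>b\<in>UNIV. ensemble_exp (\<sigma> y b) (G y b)))"
  define join :: "'h list \<times> ('y \<Rightarrow> 'b \<Rightarrow> 'h list) \<Rightarrow> _ \<Rightarrow> 'h list \<times> ('y \<Rightarrow> 'b \<Rightarrow> 'h list)" where
    "join = (\<lambda>(\<rho>, \<sigma>) (\<rho>', \<sigma>'). (\<rho> @ \<rho>', \<lambda>y b. \<sigma> y b @ \<sigma>' y b))"
  define scal :: "real \<Rightarrow> _ \<Rightarrow> 'h list \<times> ('y \<Rightarrow> 'b \<Rightarrow> 'h list)" where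
    "scal c = (\<lambda>(\<rho>, \<sigma>). (scale_ensemble c \<rho>, \<lambda>y b. scale_ensemble c (\<sigma> y b)))" for c
  define S where "S = span {axis y (rank_one v v) | (y :: 'y) (v :: 'h). True}"
  define p where "p D = (INF t\<in>F D. val t)" for D
  have join: "join t t' \<in> F (D + D')" "val (join t t') = val t + val t'" if "t \<in> F D" "t' \<in> F D'" for t t' D D'
    using that by (auto simp: F_def join_def val_def sum.distrib algebra_simps split: prod.splits)
  have scal: "scal c t \<in> F (c *\<^sub>R D)" "val (scal c t) = c * val t" if "t \<in> F D" "c \<ge> 0" for t c D
    using that by (auto simp: F_def scal_def val_def scale_ensemble algebra_simps scaleR_diff_right[symmetric]
        simp flip: scaleR_sum_right sum_distrib_left split: prod.splits)
  \<comment> \<open>Some outcome, used where a violation has to be attributed to one.\<close>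
  obtain b0 :: 'b where True by blast
  have S: "subspace S" unfolding S_def by (rule subspace_span)
  have ne: "F D \<noteq> {}" if "D \<in> S" for D
    using that unfolding S_def
  proof (induction rule: span_induct_alt)
    case base
    have "([], \<lambda>_ _. []) \<in> F 0" by (simp add: F_def)
    then show ?case by blast
  next
    case (step c B D)
    then obtain y0 v where B: "B = axis y0 (rank_one v v)" by blast
    have "F (c *\<^sub>R B) \<noteq> {}"
    proof (cases "c \<ge> 0")
      case True
      have "([], \<lambda>y b. if y = y0 \<and> b = b0 then [v] else []) \<in> F B"
        by (auto simp: F_def B axis_def sum_indicator_ensemble)
      from scal(1)[OF this True] show ?thesis by blast
    next
      case False
      \<comment> \<open>A negative multiple of \<open>|v\<rangle>\<langle>v|\<close> in the component \<open>y0\<close>: \<open>\<rho>\<close> creates it in all components, and the ensembles compensate in the others.\<close>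
      have "([v], \<lambda>y b. if y \<noteq> y0 \<and> b = b0 then [v] else []) \<in> F (- B)"
        by (auto simp: F_def B axis_def sum_indicator_ensemble)
      from scal(1)[OF this, of "- c"] False show ?thesis by auto
    qed
    then show ?case using join(1) step by blast
  qed
  have val0: "0 \<le> val t" if "t \<in> F 0" for t
    using that le by (auto simp: F_def val_def split: prod.splits)
  have bdd: "bdd_below (val ` F D)" if D: "D \<in> S" for D
  proof -
    obtain t' where t': "t' \<in> F (- D)" using ne[of "- D"] D S by (auto simp: subspace_neg)
    have "- val t' \<le> val t" if "t \<in> F D" for t
      using val0[of "join t t'"] join[OF that t'] by simp
    then show ?thesis by (rule bdd_belowI2)
  qed
  have p_le: "p D \<le> val t" if "D \<in> S" "t \<in> F D" for D t
    unfolding p_def using bdd that by (intro cINF_lower) auto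
  have "sublinear_on S p"
    unfolding sublinear_on_def
  proof (intro conjI ballI allI impI)
    fix D D' assume D: "D \<in> S" "D' \<in> S"
    show "p (D + D') \<le> p D + p D'"
      unfolding p_def[of D] p_def[of D']
    proof (rule le_INF_add[OF ne[OF D(1)] ne[OF D(2)]])
      fix t t' assume "t \<in> F D" "t' \<in> F D'"
      then show "p (D + D') \<le> val t + val t'"
        using p_le[of "D + D'" "join t t'"] join[of t D t' D'] D S by (simp add: subspace_add)
    qed
  next
    fix D and c :: real assume D: "D \<in> S" and c: "c > 0"
    have "p (c *\<^sub>R D) / c \<le> val t" if "t \<in> F D" for t
      using p_le[of "c *\<^sub>R D" "scal c t"] scal[OF that, of c] D S c
      by (simp add: subspace_scale field_simps)
    then have "p (c *\<^sub>R D) / c \<le> p D" unfolding p_def[of D] by (intro cINF_greatest ne D)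
    then show "p (c *\<^sub>R D) \<le> c * p D" using c by (simp add: field_simps)
  qed
  from hahn_banach_sublinear[OF S this] obtain l
    where l_add: "\<And>D D'. D \<in> S \<Longrightarrow> D' \<in> S \<Longrightarrow> l (D + D') = l D + l D'"
      and l_scale: "\<And>c D. D \<in> S \<Longrightarrow> l (c *\<^sub>R D) = c * l D"
      and l_le: "\<And>D. D \<in> S \<Longrightarrow> l D \<le> p D" by blast
  define A where "A y T = (axis y T :: ('h \<Rightarrow>\<^sub>L 'h) ^ 'y)" for y T
  have A_add: "A y (T + T') = A y T + A y T'" and A_scale: "A y (c *\<^sub>R T) = c *\<^sub>R A y T"
    and A_minus: "A y (- T) = - A y T" for y T T' c
    by (simp_all add: A_def vec_eq_iff axis_def)
  have gen: "A y (rank_one v v) \<in> S" for y v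
    unfolding S_def A_def by (rule span_base) blast
  \<comment> \<open>The symmetrised rank-one operators polarise \<open>|v\<rangle>\<langle>v|\<close> and depend on both vectors in a real bilinear way.\<close>
  define h where "h v w = rank_one v w + rank_one w v" for v w :: 'h
  have h: "A y (h v w) \<in> S" for y v w
  proof -
    have "h v w = rank_one (v + w) (v + w) + (- rank_one v v + - rank_one w w)"
      by (simp add: h_def rank_one_add_left rank_one_add_right)
    then have "A y (h v w) = A y (rank_one (v + w) (v + w)) + (- A y (rank_one v v) + - A y (rank_one w w))"
      by (simp only: A_add A_minus)
    then show ?thesis by (simp only: subspace_add[OF S] subspace_neg[OF S] gen)
  qed
  define R where "R y v w = - l (A y (h v w)) / 2" for y v w
  have h_self: "h v v = 2 *\<^sub>R rank_one v v" for v by (simp add: h_def scaleR_2)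
  have R_self: "R y v v = - l (A y (rank_one v v))" for y v
    by (simp add: R_def h_self A_scale l_scale[OF gen])
  have lower: "Re (cinner v (bop_apply (G y b) v)) \<le> R y v v" for y b v
  proof -
    let ?t = "([], \<lambda>y' b'. if y' = y \<and> b' = b then [v] else [])"
    have "?t \<in> F (A y (rank_one v v))"
      by (auto simp: F_def A_def axis_def sum_indicator_ensemble)
    then have "l (A y (rank_one v v)) \<le> val ?t" using l_le[OF gen] p_le[OF gen] order_trans by blast
    also have "val ?t = - Re (cinner v (bop_apply (G y b) v))"
      by (simp add: val_def sum_indicator_ensemble)
    finally show ?thesis by (simp add: R_self)
  qed
  have upper: "(\<Sum>y\<in>UNIV. R y v v) \<le> \<gamma> * (norm v)\<^sup>2" for v
  proof -
    have mem: "(\<Sum>y\<in>Y. A y (rank_one v v)) \<in> S \<and> l (\<Sum>y\<in>Y. A y (rank_one v v)) = (\<Sum>y\<in>Y. l (A y (rank_one v v)))"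
      if "finite Y" for Y
      using that
    proof induction
      case empty
      show ?case using S l_scale[of 0 0] by (simp add: subspace_0)
    next
      case (insert y Y)
      then show ?case using S gen by (auto simp: subspace_add l_add)
    qed
    let ?D = "\<Sum>y\<in>UNIV. A y (rank_one v v)"
    have D: "?D $ y = rank_one v v" for y
      by (simp add: A_def axis_def)
    have "([v], \<lambda>_ _. []) \<in> F (- ?D)" by (simp add: F_def D del: sum_component)
    moreover have "- ?D \<in> S" using mem[of UNIV] S by (simp add: subspace_neg)
    ultimately have "l (- ?D) \<le> val ([v], \<lambda>_ _. [])" using l_le p_le order_trans by blast
    moreover have "l (- ?D) = (\<Sum>y\<in>UNIV. R y v v)"
      using mem[of UNIV] l_scale[of ?D "-1"] by (simp add: R_self sum_negf)
    ultimately show ?thesis by (simp add: val_def Re_cinner_self)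
  qed
  have "\<exists>T. star T = T \<and> (\<forall>v. Re (cinner v (bop_apply T v)) = R y v v)" for y
  proof -
    define K where "K y b = (SOME K. K \<ge> 0 \<and> (\<forall>v. \<bar>Re (cinner v (bop_apply (G y b) v))\<bar> \<le> K * (norm v)\<^sup>2))" for y b
    have K: "K y b \<ge> 0 \<and> (\<forall>v. \<bar>Re (cinner v (bop_apply (G y b) v))\<bar> \<le> K y b * (norm v)\<^sup>2)" for y b
      unfolding K_def by (rule someI_ex, rule bop_bound_nonneg[of "G y b"]) blast
    define L where "L = (\<Sum>y\<in>UNIV. K y b0)"
    have L: "- (K y b0 * (norm v)\<^sup>2) \<le> R y v v" for y v
      using lower[of v y b0] K[of y b0] by (smt (verit))
    have "\<bar>R y v v\<bar> \<le> (\<bar>\<gamma>\<bar> + L) * (norm v)\<^sup>2" for v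
    proof (rule abs_leI)
      have KL: "K y b0 \<le> L" unfolding L_def by (rule member_le_sum) (use K in auto)
      have "- R y v v \<le> K y b0 * (norm v)\<^sup>2" using L[of y v] by simp
      also have "\<dots> \<le> (\<bar>\<gamma>\<bar> + L) * (norm v)\<^sup>2" by (rule mult_right_mono) (use KL in auto)
      finally show "- R y v v \<le> (\<bar>\<gamma>\<bar> + L) * (norm v)\<^sup>2" .
      \<comment> \<open>The upper bound on the sum bounds each term, because the others are bounded below.\<close>
      have nonneg: "0 \<le> R y v v + K y b0 * (norm v)\<^sup>2" for y using L[of y v] by linarith
      have "R y v v + K y b0 * (norm v)\<^sup>2 \<le> (\<Sum>y\<in>UNIV. R y v v + K y b0 * (norm v)\<^sup>2)"
        by (rule member_le_sum[of y UNIV "\<lambda>y. R y v v + K y b0 * (norm v)\<^sup>2"]) (use nonneg in auto)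
      also have "\<dots> \<le> \<gamma> * (norm v)\<^sup>2 + L * (norm v)\<^sup>2"
        using upper[of v] by (simp add: sum.distrib L_def sum_distrib_right)
      also have "\<dots> \<le> (\<bar>\<gamma>\<bar> + L) * (norm v)\<^sup>2"
        by (simp add: distrib_right mult_right_mono)
      finally show "R y v v \<le> (\<bar>\<gamma>\<bar> + L) * (norm v)\<^sup>2" using K[of y b0] by (smt (verit) mult_nonneg_nonneg zero_le_power2)
    qed
    moreover have "R y v (w + w') = R y v w + R y v w'" for v w w'
    proof -
      have "h v (w + w') = h v w + h v w'" by (simp add: h_def rank_one_add_left rank_one_add_right)
      then show ?thesis by (simp add: R_def A_add l_add[OF h h])
    qed
    moreover have "R y v (r *\<^sub>R w) = r * R y v w" for v w r
    proof -
      have "h v (r *\<^sub>R w) = r *\<^sub>R h v w" by (simp add: h_def rank_one_scaleR_left rank_one_scaleR_right scaleR_add_right)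
      then show ?thesis by (simp add: R_def A_scale l_scale[OF h])
    qed
    moreover have "R y v w = R y w v" for v w by (simp add: R_def h_def add.commute)
    moreover have "R y (\<i> *\<^sub>C v) (\<i> *\<^sub>C w) = R y v w" for v w by (simp add: R_def h_def rank_one_rotate)
    ultimately show ?thesis by (intro bop_of_bounded_real_form[where M = "\<bar>\<gamma>\<bar> + L"])
  qed
  then obtain Z where Z: "\<And>y. star (Z y) = Z y" "\<And>y v. Re (cinner v (bop_apply (Z y) v)) = R y v v" by metis
  have sum_apply: "bop_apply (\<Sum>y\<in>Y. Z y) v = (\<Sum>y\<in>Y. bop_apply (Z y) v)" for Y v
    by (induction Y rule: infinite_finite_induct) auto
  have star_sum: "star (\<Sum>y\<in>Y. Z y) = (\<Sum>y\<in>Y. Z y)" for Y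
    by (induction Y rule: infinite_finite_induct) (auto simp: star_add Z)
  have star_diff: "star (S - T) = star S - star T" for S T :: "'h bop"
    using star_add[of S "- T"] by (simp add: star_minus)
  have "pos_bop (Z y - G y b)" for y b
    using lower[of _ y b] Z G by (simp add: pos_bop_def star_diff cinner_diff_right)
  moreover have "pos_bop (of_real \<gamma> *\<^sub>C 1 - (\<Sum>y\<in>UNIV. Z y))"
    using upper Z(2)
    by (simp add: pos_bop_def star_diff star_scaleC star_sum cinner_diff_right sum_apply cinner.sum_right
        cinner_scaleC_right Re_cinner_self)
  ultimately show ?thesis by blast
qed

section \<open>Correlations of an invariant state\<close>

lemma state_on_UNIV_simps:
  assumes "state_on UNIV \<omega>"
  shows "\<omega> (S + T) = \<omega> S + \<omega> T" "\<omega> (c *\<^sub>C T) = c * \<omega> T" "\<omega> (S - T) = \<omega> S - \<omega> T" "\<omega> 1 = 1"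
    "\<omega> (\<Sum>i\<in>I. f i) = (\<Sum>i\<in>I. \<omega> (f i))"
proof -
  show add: "\<omega> (S + T) = \<omega> S + \<omega> T" and scale: "\<omega> (c *\<^sub>C T) = c * \<omega> T" and "\<omega> 1 = 1" for S T c
    using assms by (simp_all add: state_on_def)
  show "\<omega> (S - T) = \<omega> S - \<omega> T"
    using add[of S "(-1) *\<^sub>C T"] scale[of "-1" T] by simp
  show "\<omega> (\<Sum>i\<in>I. f i) = (\<Sum>i\<in>I. \<omega> (f i))"
    using scale[of 0 0] by (induction I rule: infinite_finite_induct) (simp_all add: add)
qed

text \<open>For the unitary \<open>u = 2 Q - 1\<close>, invariance applied to \<open>T u\<close> reads \<open>\<omega> (u T) = \<omega> (T u)\<close>.\<close>

lemma hypertrace_commutes_projection: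
  fixes \<omega> :: "'h::chilbert_space bop \<Rightarrow> complex"
  assumes \<omega>: "state_on UNIV \<omega>" and inv: "\<And>T u. u \<in> U \<Longrightarrow> unitary u \<Longrightarrow> \<omega> (u * T * star u) = \<omega> T"
    and U: "star_subalgebra U" and Q: "Q \<in> U" "projection Q"
  shows "\<omega> (Q * T) = \<omega> (T * Q)"
proof -
  define u where "u = 2 *\<^sub>C Q + (-1) *\<^sub>C 1"
  have uU: "u \<in> U" using U Q unfolding u_def star_subalgebra_def by blast
  have two: "2 *\<^sub>C S = S + S" for S :: "'h bop" using scaleC_add_left[of 1 1 S] by simp
  have su: "star u = u" using Q
    by (simp add: u_def star_add star_scaleC projection_def star_minus del: scaleC_minus_left add_uminus_conv_diff)
  have uu: "u * u = 1" using Q by (simp add: u_def two projection_def algebra_simps)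
  have "\<omega> (u * (T * u) * star u) = \<omega> (T * u)"
    by (rule inv) (use uU su uu in \<open>auto simp: unitary_def\<close>)
  then have "\<omega> (u * T) = \<omega> (T * u)" by (simp add: su uu mult.assoc)
  then show ?thesis
    using \<omega> by (simp add: u_def distrib_left distrib_right state_on_UNIV_simps left_diff_distrib right_diff_distrib)
qed

text \<open>The form \<open>\<Sum> |\<langle>w, v\<rangle>|\<^sup>2\<close> of a sum of positive operators vanishes only if all its terms do; at a member \<open>v\<close>
of one of the ensembles, one term is \<open>\<parallel>v\<parallel>\<^sup>4\<close>.\<close>

lemma ensemble_op_sum_eq_0:
  fixes \<sigma> :: "'b::finite \<Rightarrow> 'h::chilbert_space list"
  assumes "(\<Sum>b\<in>UNIV. ensemble_op (\<sigma> b)) = 0" and v: "v \<in> set (\<sigma> b)"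
  shows "v = 0"
proof -
  define N where "N b = (\<Sum>w\<leftarrow>\<sigma> b. (cmod (cinner w v))\<^sup>2)" for b
  have form: "Re (cinner v (blinfun_apply (ensemble_op \<tau>) v)) = (\<Sum>w\<leftarrow>\<tau>. (cmod (cinner w v))\<^sup>2)" for \<tau>
  proof (induction \<tau>)
    case (Cons w \<tau>)
    have "cinner w v * cinner v w = of_real ((cmod (cinner w v))\<^sup>2)"
      using complex_norm_square[of "cinner w v"] cinner_commute[of v w] by simp
    then show ?case using Cons
      by (simp add: ensemble_op_def blinfun.add_left cinner_add_right cinner_scaleC_right)
  qed (simp add: ensemble_op_def)
  have nonneg: "0 \<le> N b" for b unfolding N_def by (rule sum_list_nonneg) auto
  have "(\<Sum>b\<in>UNIV. N b) = Re (cinner v (blinfun_apply (\<Sum>b\<in>UNIV. ensemble_op (\<sigma> b)) v))"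
    by (simp add: N_def blinfun.sum_left cinner.sum_right form)
  then have "(\<Sum>b\<in>UNIV. N b) = 0" using assms(1) by simp
  then have "N b = 0" using nonneg by (simp add: sum_nonneg_eq_0_iff)
  then have "(cmod (cinner v v))\<^sup>2 = 0"
    using v unfolding N_def by (subst (asm) sum_list_nonneg_eq_0_iff) auto
  then show ?thesis by (simp add: cinner_self)
qed

text \<open>The functionals \<open>T \<mapsto> \<omega> (F y b * T * F y b) = \<omega> (T * F y b)\<close> are positive on all bounded operators, and
their sums over \<open>b\<close> equal \<open>\<omega>\<close> for every \<open>y\<close>: they form an assemblage like those of
\<open>ensemble_correlation_in_C_q\<close>, except that \<open>\<omega>\<close> need not come from a density operator.  The correlations of
ensembles form a convex set.  If \<open>p\<close> were not in its closure, a linear functional with coefficients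
\<open>c\<close> would separate it: with \<open>G y b = \<Sum>\<^sub>x\<^sub>a c x y a b E x a\<close>, all ensembles would have value at most \<open>\<gamma>\<close> and
\<open>p\<close> a larger one.  But the operators \<open>Z y \<ge> G y b\<close> with \<open>\<Sum> Z y \<le> \<gamma>\<close> from \<open>ensemble_duality\<close> bound the value of
\<open>p\<close> as well:
\<open>\<Sum> \<omega> (G y b * F y b) \<le> \<Sum> \<omega> (Z y * F y b) = \<omega> (\<Sum> Z y) \<le> \<gamma>\<close>.\<close>

theorem hypertrace_correlation_in_C_qa:
  fixes E :: "'x::finite \<Rightarrow> 'a::finite \<Rightarrow> 'h::chilbert_space bop"
    and F :: "'y::finite \<Rightarrow> 'b::finite \<Rightarrow> 'h bop"
  assumes E: "is_pvm_family E" and F: "is_pvm_family F" and \<omega>: "state_on UNIV \<omega>"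
    and tr: "\<And>y b T. \<omega> (F y b * T) = \<omega> (T * F y b)"
    and p: "\<And>x y a b. \<omega> (E x a * F y b) = complex_of_real (p x y a b)"
  shows "p \<in> C_qa"
proof -
  define cor where "cor \<sigma> = (\<chi> i. case i of (x, y, a, b) \<Rightarrow> ensemble_exp (\<sigma> y b) (E x a))" for \<sigma> :: "'y \<Rightarrow> 'b \<Rightarrow> 'h list"
  define W where "W = {cor \<sigma> | \<rho> \<sigma>. (\<forall>y. (\<Sum>b\<in>UNIV. ensemble_op (\<sigma> y b)) = ensemble_op \<rho>) \<and>
      ensemble_exp \<rho> 1 = 1}"
  define \<phi> :: "real ^ ('x \<times> 'y \<times> 'a \<times> 'b) \<Rightarrow> 'x \<Rightarrow> 'y \<Rightarrow> 'a \<Rightarrow> 'b \<Rightarrow> real"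
    where "\<phi> r = (\<lambda>x y a b. r $ (x, y, a, b))" for r
  define z :: "real ^ ('x \<times> 'y \<times> 'a \<times> 'b)" where "z = (\<chi> i. case i of (x, y, a, b) \<Rightarrow> p x y a b)"
  have W_C_q: "\<phi> ` W \<subseteq> C_q"
  proof safe
    fix r assume "r \<in> W"
    then obtain \<rho> \<sigma> where r1: "r = cor \<sigma>" "\<And>y. (\<Sum>b\<in>UNIV. ensemble_op (\<sigma> y b)) = ensemble_op \<rho>" "ensemble_exp \<rho> 1 = 1"
      unfolding W_def by blast
    have "\<phi> r = (\<lambda>x y a b. ensemble_exp (\<sigma> y b) (E x a))" by (simp add: \<phi>_def r1(1) cor_def)
    then show "\<phi> r \<in> C_q"
      using ensemble_correlation_in_C_q[OF E r1(2)] r1(3) by (simp add: ensemble_exp_one)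
  qed
  have conv: "convex W"
    unfolding convex_def
  proof (intro ballI allI impI)
    fix r r' and s t :: real assume r: "r \<in> W" "r' \<in> W" and st: "0 \<le> s" "0 \<le> t" "s + t = 1"
    from r(1) obtain \<rho> \<sigma> where r1: "r = cor \<sigma>" "\<And>y. (\<Sum>b\<in>UNIV. ensemble_op (\<sigma> y b)) = ensemble_op \<rho>" "ensemble_exp \<rho> 1 = 1"
      unfolding W_def by blast
    from r(2) obtain \<rho>' \<sigma>' where r2: "r' = cor \<sigma>'" "\<And>y. (\<Sum>b\<in>UNIV. ensemble_op (\<sigma>' y b)) = ensemble_op \<rho>'" "ensemble_exp \<rho>' 1 = 1"
      unfolding W_def by blast
    define \<sigma>'' where "\<sigma>'' y b = scale_ensemble s (\<sigma> y b) @ scale_ensemble t (\<sigma>' y b)" for y b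
    have "s *\<^sub>R r + t *\<^sub>R r' = cor \<sigma>''"
      using st by (simp add: vec_eq_iff cor_def r1 r2 \<sigma>''_def scale_ensemble)
    moreover have "(\<Sum>b\<in>UNIV. ensemble_op (\<sigma>'' y b)) = ensemble_op (scale_ensemble s \<rho> @ scale_ensemble t \<rho>')" for y
      using st by (simp add: \<sigma>''_def scale_ensemble sum.distrib r1 r2 flip: scaleR_sum_right)
    moreover have "ensemble_exp (scale_ensemble s \<rho> @ scale_ensemble t \<rho>') 1 = 1"
      using st by (simp add: scale_ensemble r1 r2)
    ultimately show "s *\<^sub>R r + t *\<^sub>R r' \<in> W" unfolding W_def by blast
  qed
  have "z \<in> closure W"
  proof (rule ccontr)
    assume "z \<notin> closure W"
    then obtain a \<beta> where sep: "a \<bullet> z < \<beta>" "\<And>r. r \<in> closure W \<Longrightarrow> a \<bullet> r > \<beta>"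
      using separating_hyperplane_closed_point[OF convex_closure[OF conv] closed_closure] by blast
    \<comment> \<open>The separating functional bounds the ensembles from below, so that its negative bounds them from above.\<close>
    define c where "c x y a' b = - a $ (x, y, a', b)" for x y a' b
    have inner: "a \<bullet> r = - (\<Sum>y\<in>UNIV. \<Sum>b\<in>UNIV. \<Sum>x\<in>UNIV. \<Sum>a'\<in>UNIV. c x y a' b * r $ (x, y, a', b))" for r
    proof -
      have "a \<bullet> r = (\<Sum>i\<in>UNIV \<times> UNIV \<times> UNIV \<times> UNIV. a $ i * r $ i)" by (simp add: inner_vec_def)
      also have "\<dots> = (\<Sum>x\<in>UNIV. \<Sum>y\<in>UNIV. \<Sum>a'\<in>UNIV. \<Sum>b\<in>UNIV. a $ (x, y, a', b) * r $ (x, y, a', b))"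
        by (simp only: sum.cartesian_product case_prod_unfold) simp
      also have "\<dots> = (\<Sum>y\<in>UNIV. \<Sum>x\<in>UNIV. \<Sum>b\<in>UNIV. \<Sum>a'\<in>UNIV. a $ (x, y, a', b) * r $ (x, y, a', b))"
        by (subst sum.swap, rule sum.cong[OF HOL.refl], rule sum.cong[OF HOL.refl], rule sum.swap)
      also have "\<dots> = (\<Sum>y\<in>UNIV. \<Sum>b\<in>UNIV. \<Sum>x\<in>UNIV. \<Sum>a'\<in>UNIV. a $ (x, y, a', b) * r $ (x, y, a', b))"
        by (rule sum.cong[OF HOL.refl], rule sum.swap)
      finally show ?thesis by (simp add: c_def sum_negf)
    qed
    define \<gamma> where "\<gamma> = - \<beta>"
    define G where "G y b = (\<Sum>x\<in>UNIV. \<Sum>a'\<in>UNIV. of_real (c x y a' b) *\<^sub>C E x a')" for y b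
    have star_sum: "star (\<Sum>i\<in>I. f i) = (\<Sum>i\<in>I. star (f i))" for I and f :: "'i \<Rightarrow> 'h bop"
      by (induction I rule: infinite_finite_induct) (auto simp: star_add)
    have exp_sum: "ensemble_exp \<tau> (\<Sum>i\<in>I. f i) = (\<Sum>i\<in>I. ensemble_exp \<tau> (f i))" for \<tau> I and f :: "'i \<Rightarrow> 'h bop"
    proof -
      have "ensemble_exp \<tau> (S + T) = ensemble_exp \<tau> S + ensemble_exp \<tau> T" for S T
        by (simp add: ensemble_exp_def cinner_add_right sum_list_addf)
      moreover have "ensemble_exp \<tau> 0 = 0" by (simp add: ensemble_exp_def)
      ultimately show ?thesis by (induction I rule: infinite_finite_induct) simp_all
    qed
    have exp_scale: "ensemble_exp \<tau> (of_real r *\<^sub>C T) = r * ensemble_exp \<tau> T" for \<tau> r T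
      by (simp add: ensemble_exp_def cinner_scaleC_right sum_list_const_mult)
    have starG: "star (G y b) = G y b" for y b
      using E by (simp add: G_def star_sum star_scaleC is_pvm_family_def projection_def)
    have expG: "(\<Sum>y\<in>UNIV. \<Sum>b\<in>UNIV. ensemble_exp (\<sigma> y b) (G y b)) = - (a \<bullet> cor \<sigma>)" for \<sigma>
      by (simp add: inner cor_def G_def exp_sum exp_scale)
    have "(\<Sum>y\<in>UNIV. \<Sum>b\<in>UNIV. ensemble_exp (\<sigma> y b) (G y b)) \<le> \<gamma> * ensemble_exp \<rho> 1"
      if eq: "\<And>y. (\<Sum>b\<in>UNIV. ensemble_op (\<sigma> y b)) = ensemble_op \<rho>" for \<sigma> \<rho>
    \<comment> \<open>Ensembles of trace \<open>0\<close> vanish and all others can be normalised.\<close>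
    proof (cases "ensemble_exp \<rho> 1 = 0")
      case True
      have zero_\<rho>: "v = 0" if "v \<in> set \<rho>" for v
        using True that unfolding ensemble_exp_one by (subst (asm) sum_list_nonneg_eq_0_iff) auto
      have "rank_one v v = 0" if "v \<in> set \<rho>" for v
        by (rule blinfun_eqI) (simp add: zero_\<rho>[OF that])
      then have "map (\<lambda>v. rank_one v v) \<rho> = map (\<lambda>_. 0) \<rho>" by auto
      then have "ensemble_op \<rho> = 0" by (simp only: ensemble_op_def sum_list_0)
      then have zero: "v = 0" if "v \<in> set (\<sigma> y b)" for v y b
        using ensemble_op_sum_eq_0[of "\<sigma> y" v b] eq[of y] that by simp
      have "ensemble_exp (\<sigma> y b) T = 0" for y b T
      proof -
        have "Re (cinner v (bop_apply T v)) = 0" if "v \<in> set (\<sigma> y b)" for v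
          by (simp add: zero[OF that])
        then have "map (\<lambda>v. Re (cinner v (bop_apply T v))) (\<sigma> y b) = map (\<lambda>_. 0) (\<sigma> y b)"
          by auto
        then show ?thesis by (simp only: ensemble_exp_def sum_list_0)
      qed
      then show ?thesis using True by simp
    next
      case False
      define t where "t = ensemble_exp \<rho> 1"
      have "0 \<le> t" unfolding t_def ensemble_exp_one by (rule sum_list_nonneg) auto
      then have t: "t > 0" using False by (simp add: t_def)
      define \<sigma>' where "\<sigma>' y b = scale_ensemble (inverse t) (\<sigma> y b)" for y b
      have "cor \<sigma>' \<in> W"
      proof -
        have "(\<Sum>b\<in>UNIV. ensemble_op (\<sigma>' y b)) = ensemble_op (scale_ensemble (inverse t) \<rho>)" for y
          using t by (simp add: \<sigma>'_def scale_ensemble eq flip: scaleR_sum_right)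
        moreover have "ensemble_exp (scale_ensemble (inverse t) \<rho>) 1 = 1"
          using t by (simp add: scale_ensemble flip: t_def)
        ultimately show ?thesis unfolding W_def by blast
      qed
      then have "(\<Sum>y\<in>UNIV. \<Sum>b\<in>UNIV. ensemble_exp (\<sigma>' y b) (G y b)) \<le> \<gamma>"
        using sep(2)[of "cor \<sigma>'"] closure_subset[of W] unfolding expG \<gamma>_def by auto
      moreover have "(\<Sum>y\<in>UNIV. \<Sum>b\<in>UNIV. ensemble_exp (\<sigma>' y b) (G y b))
          = inverse t * (\<Sum>y\<in>UNIV. \<Sum>b\<in>UNIV. ensemble_exp (\<sigma> y b) (G y b))"
        using t by (simp add: \<sigma>'_def scale_ensemble sum_distrib_left)
      ultimately show ?thesis using t by (simp add: field_simps flip: t_def)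
    qed
    from ensemble_duality[of G \<gamma>, OF starG this] obtain Z
      where Z: "\<And>y b. pos_bop (Z y - G y b)" "pos_bop (of_real \<gamma> *\<^sub>C 1 - (\<Sum>y\<in>UNIV. Z y))" by blast
    note \<omega>_simps = state_on_UNIV_simps[OF \<omega>]
    have F': "star (F y b) = F y b" "F y b * F y b = F y b" for y b
      using F by (simp_all add: is_pvm_family_def projection_def)
    have "Re (\<omega> (G y b * F y b)) \<le> Re (\<omega> (Z y * F y b))" for y b
    proof -
      \<comment> \<open>Compression preserves positivity, and the property \<open>tr\<close> moves the left projection to the right.\<close>
      have "pos_bop (F y b * (Z y - G y b) * F y b)"
        using Z(1)[of y b] F' cinner_star_left[of "F y b"]
        by (simp add: pos_bop_def star_mult mult.assoc del: bop_apply_simps(4)) metis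
      then have "0 \<le> Re (\<omega> (F y b * ((Z y - G y b) * F y b)))"
        using state_pos_bop[OF \<omega>] by (simp add: complex_nonneg_Reals_iff mult.assoc)
      also have "\<omega> (F y b * ((Z y - G y b) * F y b)) = \<omega> ((Z y - G y b) * F y b)"
        by (simp add: tr mult.assoc F')
      finally show ?thesis by (simp add: left_diff_distrib \<omega>_simps)
    qed
    then have "(\<Sum>y\<in>UNIV. \<Sum>b\<in>UNIV. Re (\<omega> (G y b * F y b))) \<le> (\<Sum>y\<in>UNIV. \<Sum>b\<in>UNIV. Re (\<omega> (Z y * F y b)))"
      by (intro sum_mono)
    also have "\<dots> = Re (\<omega> (\<Sum>y\<in>UNIV. Z y))"
    proof -
      have "(\<Sum>b\<in>UNIV. Re (\<omega> (Z y * F y b))) = Re (\<omega> (Z y))" for y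
        using F by (simp add: is_pvm_family_def flip: Re_sum \<omega>_simps sum_distrib_left)
      then show ?thesis by (simp add: \<omega>_simps)
    qed
    also have "\<dots> \<le> \<gamma>"
      using state_pos_bop[OF \<omega> Z(2)] by (simp add: \<omega>_simps complex_nonneg_Reals_iff)
    also have "(\<Sum>y\<in>UNIV. \<Sum>b\<in>UNIV. Re (\<omega> (G y b * F y b))) = - (a \<bullet> z)"
    proof -
      have "\<omega> (G y b * F y b) = (\<Sum>x\<in>UNIV. \<Sum>a'\<in>UNIV. of_real (c x y a' b * p x y a' b))" for y b
        by (simp add: G_def sum_distrib_right \<omega>_simps p)
      then show ?thesis by (simp add: inner z_def)
    qed
    finally show False using sep(1) by (simp add: \<gamma>_def)
  qed
  moreover have "continuous_on (closure W) \<phi>"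
    unfolding \<phi>_def by (intro continuous_on_coordinatewise_then_product continuous_intros)
  then have "\<phi> ` closure W \<subseteq> closure (\<phi> ` W)"
    by (rule image_closure_subset[OF _ closed_closure closure_subset])
  ultimately have "\<phi> z \<in> closure (\<phi> ` W)" by blast
  moreover have "\<phi> z = p" by (simp add: \<phi>_def z_def)
  ultimately show ?thesis using closure_mono[OF W_C_q] by (auto simp: C_qa_def)
qed

section \<open>The projections coming from the tensor product\<close>

lemma elementary_tensor_mult: "(u \<otimes> v) * (u' \<otimes> v') = (u * u') \<otimes> (v * v')"
  by transfer (simp add: tensor_eq.refl)

lemma elementary_tensor_star: "star (u \<otimes> v) = star u \<otimes> star v"
  by transfer (simp add: tensor_eq.refl)

lemma elementary_tensor_one: "1 \<otimes> 1 = 1"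
  by transfer (simp add: tensor_eq.refl)

lemma elementary_tensor_sum_left: "finite I \<Longrightarrow> (\<Sum>i\<in>I. f i) \<otimes> v = (\<Sum>i\<in>I. f i \<otimes> v)"
proof (induction I rule: finite_induct)
  case empty
  show ?case by simp (transfer, rule tensor_eq.zero)
next
  case (insert i I)
  have "(u + u') \<otimes> v = u \<otimes> v + u' \<otimes> v" for u u' :: 'b
    by transfer (simp add: tensor_eq.add_left)
  then show ?case using insert by simp
qed

lemma elementary_tensor_sum_right: "finite I \<Longrightarrow> u \<otimes> (\<Sum>i\<in>I. f i) = (\<Sum>i\<in>I. u \<otimes> f i)"
proof (induction I rule: finite_induct)
  case empty
  show ?case
    by simp (transfer, metis scaleC_zero_left scaleC_zero_right tensor_eq.scale tensor_eq.sym tensor_eq.trans tensor_eq.zero)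
next
  case (insert i I)
  have "u \<otimes> (v + v') = u \<otimes> v + u \<otimes> v'" for v v' :: 'c
    by transfer (simp add: tensor_eq.add_right)
  then show ?case using insert by simp
qed

lemma projection_proj_gen: "projection (proj_gen x a)"
  unfolding projection_def by transfer (rule projection_univ_proj[unfolded projection_def])

lemma Rep_proj_alg_sum: "Rep_proj_alg (\<Sum>i\<in>I. f i) = (\<Sum>i\<in>I. Rep_proj_alg (f i))"
  by (induction I rule: infinite_finite_induct) (simp_all add: zero_proj_alg.rep_eq plus_proj_alg.rep_eq)

lemma sum_proj_gen: "(\<Sum>a\<in>UNIV. proj_gen x a) = 1"
proof -
  have "Rep_proj_alg (\<Sum>a\<in>UNIV. proj_gen x a) = Rep_proj_alg 1"
    by (simp add: Rep_proj_alg_sum proj_gen.rep_eq one_proj_alg.rep_eq sum_univ_proj)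
  then show ?thesis by (simp add: Rep_proj_alg_inject)
qed

text \<open>A \<open>*\<close>-homomorphism that does not preserve the unit maps a projection-valued measure to projections with
sum \<open>P\<close>, which may differ from \<open>1\<close>; the missing part goes to an arbitrary outcome.\<close>

lemma completed_pvm_family:
  fixes g :: "'x \<Rightarrow> 'a::finite \<Rightarrow> 'c::star_algebra"
  assumes g: "\<And>x a. projection (g x a)" and P: "projection P" and sum: "\<And>x. (\<Sum>a\<in>UNIV. g x a) = P"
    and gP: "\<And>x a. g x a * P = g x a" and Pg: "\<And>x a. P * g x a = g x a"
  shows "is_pvm_family (\<lambda>x a. g x a + (if a = a0 then 1 - P else 0))"
  unfolding is_pvm_family_def
proof (intro conjI allI)
  fix x a
  have "star (1 - P) = 1 - P"
    using P star_add[of 1 "- P"] by (simp add: projection_def star_minus)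
  then show "projection (g x a + (if a = a0 then 1 - P else 0))"
    using g[of x a] P gP Pg by (simp add: projection_def star_add algebra_simps)
  show "(\<Sum>a\<in>UNIV. g x a + (if a = a0 then 1 - P else 0)) = 1"
    by (simp add: sum.distrib sum)
qed

theorem theorem2p2:
  fixes \<mu> :: "'x::finite \<Rightarrow> 'y::finite \<Rightarrow> 'a::finite \<Rightarrow> 'b::finite \<Rightarrow> nat"
    and p :: "'x \<Rightarrow> 'y \<Rightarrow> 'a \<Rightarrow> 'b \<Rightarrow> real"
    and U :: "'h::chilbert_space bop set"
    and \<rho> :: "(('x, 'a) proj_alg, ('y, 'b) proj_alg) alg_tensor \<Rightarrow> 'h bop"
    and \<tau> :: "'h bop \<Rightarrow> complex"
  assumes "imitation_game \<mu>"
    and "p \<in> C_ns_game \<mu>"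
    and "von_neumann_algebra U"
    and "star_hom \<rho>" and "range \<rho> \<subseteq> U"
    and "tracial_state_on U \<tau>" and "amenable_on U \<tau>"
    and "\<forall>x y a b. \<tau> (\<rho> (proj_gen x a \<otimes> proj_gen y b)) = complex_of_real (p x y a b)"
  shows "p \<in> C_qa_game \<mu>"
proof -
  from \<open>amenable_on U \<tau>\<close> obtain \<omega> where \<omega>: "state_on UNIV \<omega>" and \<omega>\<tau>: "\<And>T. T \<in> U \<Longrightarrow> \<omega> T = \<tau> T"
    and inv: "\<And>T u. u \<in> U \<Longrightarrow> unitary u \<Longrightarrow> \<omega> (u * T * star u) = \<omega> T"
    unfolding amenable_on_def by blast
  have U: "star_subalgebra U" using assms(3) by (simp add: von_neumann_algebra_def)
  have hom: "\<rho> (s + t) = \<rho> s + \<rho> t" "\<rho> (s * t) = \<rho> s * \<rho> t" "\<rho> (star s) = star (\<rho> s)" "\<rho> (k *\<^sub>C s) = k *\<^sub>C \<rho> s" for s t k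
    using assms(4) by (simp_all add: star_hom_def)
  have hom_sum: "\<rho> (\<Sum>i\<in>I. f i) = (\<Sum>i\<in>I. \<rho> (f i))" for I and f :: "'i \<Rightarrow> _"
    using hom(4)[of 0 0] by (induction I rule: infinite_finite_induct) (simp_all add: hom)
  have hom_proj: "projection (\<rho> s)" if "projection s" for s
    using that by (simp add: projection_def flip: hom)
  have ranU: "\<rho> s \<in> U" for s using assms(5) by blast
  define P where "P = \<rho> 1"
  define E0 where "E0 x a = \<rho> (proj_gen x a \<otimes> 1)" for x a
  define F0 where "F0 y b = \<rho> (1 \<otimes> proj_gen y b)" for y b
  have proj_tensor: "projection (u \<otimes> v)" if "projection u" "projection v"
    for u :: "('x, 'a) proj_alg" and v :: "('y, 'b) proj_alg"
    using that by (simp add: projection_def elementary_tensor_star elementary_tensor_mult)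
  have proj_one: "projection (1 :: 'z::star_algebra)" by (simp add: projection_def)
  have P: "projection P" unfolding P_def by (intro hom_proj proj_one)
  have unit: "P * \<rho> s = \<rho> s" "\<rho> s * P = \<rho> s" for s by (simp_all add: P_def flip: hom)
  have E0: "projection (E0 x a)" "(\<Sum>a\<in>UNIV. E0 x a) = P" for x a
    by (simp_all add: E0_def P_def hom_proj proj_tensor proj_one projection_proj_gen sum_proj_gen
        elementary_tensor_one flip: hom_sum elementary_tensor_sum_left)
  have F0: "projection (F0 y b)" "(\<Sum>b\<in>UNIV. F0 y b) = P" for y b
    by (simp_all add: F0_def P_def hom_proj proj_tensor proj_one projection_proj_gen sum_proj_gen
        elementary_tensor_one flip: hom_sum elementary_tensor_sum_right)
  define a0 :: 'a where "a0 = undefined"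
  define b0 :: 'b where "b0 = undefined"
  define E where "E x a = E0 x a + (if a = a0 then 1 - P else 0)" for x a
  define F where "F y b = F0 y b + (if b = b0 then 1 - P else 0)" for y b
  have E_pvm: "is_pvm_family E"
    unfolding E_def[abs_def] by (rule completed_pvm_family[OF E0(1) P E0(2)]) (simp_all add: E0_def unit)
  have F_pvm: "is_pvm_family F"
    unfolding F_def[abs_def] by (rule completed_pvm_family[OF F0(1) P F0(2)]) (simp_all add: F0_def unit)
  have FU: "F y b \<in> U" for y b
  proof -
    have "F y b = \<rho> (1 \<otimes> proj_gen y b) + (if b = b0 then 1 else 0) *\<^sub>C (1 + (-1) *\<^sub>C P)"
      by (simp add: F_def F0_def)
    then show ?thesis using U ranU unfolding star_subalgebra_def P_def by metis
  qed
  have tr: "\<omega> (F y b * T) = \<omega> (T * F y b)" for y b T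
    using hypertrace_commutes_projection[OF \<omega> inv U FU] F_pvm by (simp add: is_pvm_family_def)
  have EF0: "E0 x a * F0 y b = \<rho> (proj_gen x a \<otimes> proj_gen y b)" for x a y b
    by (simp add: E0_def F0_def elementary_tensor_mult flip: hom)
  have \<omega>EF0: "\<omega> (E0 x a * F0 y b) = complex_of_real (p x y a b)" for x a y b
    using assms(8) by (simp add: EF0 \<omega>\<tau> ranU)
  \<comment> \<open>The correlations for any pair of questions add up to \<open>\<omega> P\<close>, so the completion does not change the correlation.\<close>
  have "\<omega> P = 1"
  proof -
    fix x y
    have "P = (\<Sum>a\<in>UNIV. E0 x a) * (\<Sum>b\<in>UNIV. F0 y b)" using P by (simp add: E0 F0 projection_def)
    then have "\<omega> P = (\<Sum>a\<in>UNIV. \<Sum>b\<in>UNIV. complex_of_real (p x y a b))"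
      by (simp add: sum_product state_on_UNIV_simps[OF \<omega>] \<omega>EF0)
    also have "\<dots> = complex_of_real (\<Sum>(a, b)\<in>UNIV. p x y a b)"
      by (simp add: sum.cartesian_product case_prod_unfold)
    also have "(\<Sum>(a, b)\<in>UNIV. p x y a b) = 1" using assms(2) by (simp add: C_ns_game_def C_ns_def)
    finally show ?thesis by (simp only: of_real_1)
  qed
  then have \<omega>P: "\<omega> (1 - P) = 0" by (simp add: state_on_UNIV_simps[OF \<omega>])
  have "\<omega> (E x a * F y b) = complex_of_real (p x y a b)" for x a y b
  proof -
    have "(1 - P) * (1 - P) = 1 - P" using P by (simp add: projection_def algebra_simps)
    moreover have "E0 x a * (1 - P) = 0" "(1 - P) * F0 y b = 0" for x a y b
      by (simp_all add: E0_def F0_def algebra_simps unit)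
    ultimately have "E x a * F y b = E0 x a * F0 y b + (if a = a0 \<and> b = b0 then 1 - P else 0)"
      by (simp add: E_def F_def distrib_left distrib_right)
    then show ?thesis
      using \<omega>P state_on_UNIV_simps(2)[OF \<omega>, of 0 0] by (simp add: state_on_UNIV_simps[OF \<omega>] \<omega>EF0)
  qed
  from hypertrace_correlation_in_C_qa[OF E_pvm F_pvm \<omega> tr this] have "p \<in> C_qa" .
  then show ?thesis using assms(2) by (simp add: C_qa_game_def)
qed

end
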